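(* Let $\pi$ and $\mathcal{S}$ satisfy the regularity assumptions (R1)–(R2) of the context, let $\pi_{W^*}$ be as in the noise assumption (N) of the context, and let $\mu>0$. For almost every realisation $\{\gamma_i\}_{i\ge1}$ of an i.i.d. sequence of $\mathrm{Uniform}([0,1])$ random variables, the expected squared jumping distance $$\mathrm{ESJD}^{(d)}=\mathbb{E}\left[\left\|\mathbf{X}^{(d)}_{k+1}-\mathbf{X}^{(d)}_k\right\|^2\right]$$ of the stationary Markov chain $\{(\mathbf{X}^{(d)}_k,W^{(d)}_k)\}_{k\ge0}$ described in the context satisfies $$\lim_{d\to\infty}\mathrm{ESJD}^{(d)}=\alpha_{12}\times\left(\frac{\mu}{I}\right)^2,$$ where $$\alpha_{12}=\mathbb{E}\left[F(Q^\infty_\Delta+S^\infty_\Delta)\,F(W_\Delta-S^\infty_\Delta)\right],\qquad \begin{bmatrix} Q^\infty_\Delta\\ S^\infty_\Delta\end{bmatrix}\sim \mathrm{N}\left(-\frac{\mu^2}{2}\begin{bmatrix}1\\-\beta_1\end{bmatrix},\ \mu^2\begin{bmatrix}1&-\beta_1\\-\beta_1&\beta_2^2\end{bmatrix}\right),$$ and, independently of $(Q^\infty_\Delta,S^\infty_\Delta)$, $W_\Delta=W^*-W$ with $(W^*,W)\sim\pi_{W^*}\otimes\pi_W$.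
   Context: $\pi:\mathbb{R}\to(0,\infty)$ is a probability density on $\mathbb{R}$ and $\mathcal{S}:\mathbb{R}\times[0,1]\to\mathbb{R}$ is a measurable function. Regularity assumptions: (R1) $x\mapsto\log\pi(x)$ is thrice differentiable with bounded second and third derivatives, and $\mathbb{E}[((\log\pi)'(X))^2]<\infty$ for $X\sim\pi$; (R2) the first three derivatives of $(x,\gamma)\mapsto\mathcal{S}(x,\gamma)$ with respect to the first argument exist and are bounded over $\mathbb{R}\times[0,1]$. Constants: $I>0$ with $I^2=\mathbb{E}[((\log\pi)'(X))^2]$, $X\sim\pi$; and, for independent $X\sim\pi$, $\Gamma\sim\mathrm{Uniform}([0,1])$, $\beta_1=\mathbb{E}[\partial_{xx}\mathcal{S}(X,\Gamma)]/I^2$ and $\beta_2=\{\mathbb{E}[(\partial_x\mathcal{S}(X,\Gamma))^2]/I^2\}^{1/2}$. For $\mathbf{x}=(x_1,\dots,x_d)$ set $\pi^{(d)}(\mathbf{x})=\prod_{i=1}^d\pi(x_i)$ (also used for the corresponding probability distribution) and, for a given sequence $\{\gamma_i\}_{i\ge1}\subset[0,1]$, $s^{(d)}(\mathbf{x})=\sum_{i=1}^d\mathcal{S}(x_i,\gamma_i)$; the cheap approximation to $\pi^{(d)}$ is $\pi_a^{(d)}=\pi^{(d)}\exp(s^{(d)})$. Put $q^{(d)}_\Delta(\mathbf{x},\mathbf{x}^* )=\log[\pi^{(d)}(\mathbf{x}^* )/\pi^{(d)}(\mathbf{x})]$ and $s^{(d)}_\Delta(\mathbf{x},\mathbf{x}^*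 )=s^{(d)}(\mathbf{x}^* )-s^{(d)}(\mathbf{x})$. Let $F(u)=\min(1,e^u)$, and let $\|\cdot\|$ be the Euclidean norm. Noise assumption (N): the additive noise $W^*$ in the estimated log-target at a proposal has a law that does not depend on the proposal; it has density $\pi_{W^*}$ on $\mathbb{R}$ with $\int e^w\pi_{W^*}(w)\,dw=1$. The distribution $\pi_W$ has density $\pi_W(w)=e^w\pi_{W^*}(w)$. Delayed-acceptance pseudo-marginal random walk Metropolis (DAPsMRWM) chain, for fixed $\{\gamma_i\}$: the Markov chain $\{(\mathbf{X}^{(d)}_k,W^{(d)}_k)\}_{k\ge0}$ on $\mathbb{R}^d\times\mathbb{R}$ which, from the state $(\mathbf{x},w)$, draws independently $\mathbf{Z}\sim\mathrm{N}(\mathbf 0,\mathbf I_d)$ and $W^*\sim\pi_{W^*}$, sets $\mathbf{X}^*=\mathbf{x}+\mu d^{-1/2}\mathbf{Z}/I$, moves to $(\mathbf{X}^*,W^* )$ with probability $$F\left(q^{(d)}_\Delta(\mathbf{x},\mathbf{X}^* )+s^{(d)}_\Delta(\mathbf{x},\mathbf{X}^* )\right)\times F\left(W^*-w-s^{(d)}_\Delta(\mathbf{x},\mathbf{X}^* )\right),$$ and otherwise stays at $(\mathbf{x},w)$. It is reversible with respect to $\pi^{(d)}\otimes\pi_W$; "stationary" means $(\mathbf{X}^{(d)}_0,W^{(d)}_0)\sim\pi^{(d)}\otimes\pi_W$. *)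

theory Defs
  imports "HOL-Probability.Probability"
begin

section \<open>Regularity assumptions\<close>

definition thrice_differentiable :: "(real \<Rightarrow> real) \<Rightarrow> bool" where
  "thrice_differentiable f \<longleftrightarrow> (\<forall>k<3. \<forall>x. ((deriv ^^ k) f) differentiable (at x))"

definition positive_density :: "(real \<Rightarrow> real) \<Rightarrow> bool" where
  "positive_density \<pi> \<longleftrightarrow>
     (\<forall>x. 0 < \<pi> x) \<and> \<pi> \<in> borel_measurable borel \<and> (\<integral>\<^sup>+ x. ennreal (\<pi> x) \<partial>lborel) = 1"

definition regular_target :: "(real \<Rightarrow> real) \<Rightarrow> bool" where
  "regular_target \<pi> \<longleftrightarrow>
     thrice_differentiable (\<lambda>x. ln (\<pi> x)) \<and>
     bounded (range ((deriv ^^ 2) (\<lambda>x. ln (\<pi> x)))) \<and>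
     bounded (range ((deriv ^^ 3) (\<lambda>x. ln (\<pi> x)))) \<and>
     integrable (density lborel \<pi>) (\<lambda>x. (deriv (\<lambda>y. ln (\<pi> y)) x)\<^sup>2)"

text \<open>\<open>S\<close> is a function on \<open>\<real> \<times> [0,1]\<close>; its values at second arguments outside
  \<open>[0,1]\<close> are never constrained and never used.\<close>

definition measurable_error :: "(real \<Rightarrow> real \<Rightarrow> real) \<Rightarrow> bool" where
  "measurable_error S \<longleftrightarrow>
     case_prod S \<in> borel_measurable (borel \<Otimes>\<^sub>M restrict_space borel {0..1})"

definition regular_error :: "(real \<Rightarrow> real \<Rightarrow> real) \<Rightarrow> bool" where
  "regular_error S \<longleftrightarrow>
     (\<forall>\<gamma>\<in>{0..1}. thrice_differentiable (\<lambda>x. S x \<gamma>)) \<and>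
     (\<forall>k\<in>{1,2,3}. \<exists>B. \<forall>x. \<forall>\<gamma>\<in>{0..1}. \<bar>(deriv ^^ k) (\<lambda>y. S y \<gamma>) x\<bar> \<le> B)"

definition noise_density :: "(real \<Rightarrow> real) \<Rightarrow> bool" where
  "noise_density p \<longleftrightarrow>
     (\<forall>w. 0 \<le> p w) \<and> p \<in> borel_measurable borel \<and>
     (\<integral>\<^sup>+ w. ennreal (p w) \<partial>lborel) = 1 \<and> (\<integral>\<^sup>+ w. ennreal (exp w * p w) \<partial>lborel) = 1"

text \<open>The argument \<open>p\<close> is the density of the noise \<open>W\<^sup>*\<close> at a proposal; the result is the
  density of the noise \<open>W\<close> at stationarity.\<close>

definition stationary_noise_density :: "(real \<Rightarrow> real) \<Rightarrow> real \<Rightarrow> real" where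
  "stationary_noise_density p w = exp w * p w"

section \<open>Constants\<close>

text \<open>The uniform law on \<open>[0,1]\<close> has \<open>[0,1]\<close> itself as its space. This matters for the
  integrals below: nothing is assumed about the measurability of \<open>S\<close> outside
  \<open>\<real> \<times> [0,1]\<close>, and the Bochner integral of a nonmeasurable function is 0.\<close>

definition uniform01 :: "real measure" where
  "uniform01 = restrict_space lborel {0..1}"

definition const_I :: "(real \<Rightarrow> real) \<Rightarrow> real" where
  "const_I \<pi> = sqrt (\<integral>x. (deriv (\<lambda>y. ln (\<pi> y)) x)\<^sup>2 \<partial>(density lborel \<pi>))"

definition beta1 :: "(real \<Rightarrow> real) \<Rightarrow> (real \<Rightarrow> real \<Rightarrow> real) \<Rightarrow> real" where
  "beta1 \<pi> S =
     (\<integral>(x, \<gamma>). (deriv ^^ 2) (\<lambda>y. S y \<gamma>) x \<partial>(density lborel \<pi> \<Otimes>\<^sub>M uniform01)) / (const_I \<pi>)\<^sup>2"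

definition beta2 :: "(real \<Rightarrow> real) \<Rightarrow> (real \<Rightarrow> real \<Rightarrow> real) \<Rightarrow> real" where
  "beta2 \<pi> S = sqrt
     ((\<integral>(x, \<gamma>). (deriv (\<lambda>y. S y \<gamma>) x)\<^sup>2 \<partial>(density lborel \<pi> \<Otimes>\<^sub>M uniform01)) / (const_I \<pi>)\<^sup>2)"

section \<open>The chain\<close>

text \<open>A point of \<open>\<real>\<^sup>d\<close> is an extensional function on the index set \<open>{..<d}\<close>, so that \<open>d\<close> can
  vary inside a formula; coordinates and the sequence \<open>\<gamma>\<close> are indexed from 0.\<close>

definition F :: "real \<Rightarrow> real" where
  "F u = min 1 (exp u)"

definition q_Delta :: "(real \<Rightarrow> real) \<Rightarrow> nat \<Rightarrow> (nat \<Rightarrow> real) \<Rightarrow> (nat \<Rightarrow> real) \<Rightarrow> real" where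
  "q_Delta \<pi> d x x' = ln ((\<Prod>i<d. \<pi> (x' i)) / (\<Prod>i<d. \<pi> (x i)))"

definition s_Delta ::
  "(real \<Rightarrow> real \<Rightarrow> real) \<Rightarrow> (nat \<Rightarrow> real) \<Rightarrow> nat \<Rightarrow> (nat \<Rightarrow> real) \<Rightarrow> (nat \<Rightarrow> real) \<Rightarrow> real" where
  "s_Delta S \<gamma> d x x' = (\<Sum>i<d. S (x' i) (\<gamma> i)) - (\<Sum>i<d. S (x i) (\<gamma> i))"

definition state_space :: "nat \<Rightarrow> ((nat \<Rightarrow> real) \<times> real) measure" where
  "state_space d = (\<Pi>\<^sub>M i\<in>{..<d}. borel) \<Otimes>\<^sub>M borel"

definition proposal :: "(real \<Rightarrow> real) \<Rightarrow> real \<Rightarrow> nat \<Rightarrow> (nat \<Rightarrow> real) \<Rightarrow> (nat \<Rightarrow> real) \<Rightarrow> nat \<Rightarrow> real"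
  where "proposal \<pi> \<mu> d x z = (\<lambda>i\<in>{..<d}. x i + \<mu> / sqrt (real d) * z i / const_I \<pi>)"

definition acceptance_prob ::
  "(real \<Rightarrow> real) \<Rightarrow> (real \<Rightarrow> real \<Rightarrow> real) \<Rightarrow> (nat \<Rightarrow> real) \<Rightarrow> nat \<Rightarrow>
     (nat \<Rightarrow> real) \<times> real \<Rightarrow> (nat \<Rightarrow> real) \<times> real \<Rightarrow> real" where
  "acceptance_prob \<pi> S \<gamma> d = (\<lambda>(x, w) (x', w').
     F (q_Delta \<pi> d x x' + s_Delta S \<gamma> d x x') * F (w' - w - s_Delta S \<gamma> d x x'))"

text \<open>Acceptance with probability \<open>a\<close> is the event \<open>u \<le> a\<close> for a further independent
  uniform variable \<open>u\<close>.\<close>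

definition dapsmrwm_kernel ::
  "(real \<Rightarrow> real) \<Rightarrow> (real \<Rightarrow> real \<Rightarrow> real) \<Rightarrow> (real \<Rightarrow> real) \<Rightarrow> real \<Rightarrow> (nat \<Rightarrow> real) \<Rightarrow> nat \<Rightarrow>
     (nat \<Rightarrow> real) \<times> real \<Rightarrow> ((nat \<Rightarrow> real) \<times> real) measure" where
  "dapsmrwm_kernel \<pi> S p \<mu> \<gamma> d = (\<lambda>(x, w).
     distr ((\<Pi>\<^sub>M i\<in>{..<d}. density lborel std_normal_density) \<Otimes>\<^sub>M density lborel p \<Otimes>\<^sub>M uniform01)
       (state_space d)
       (\<lambda>(z, w', u).
          let x' = proposal \<pi> \<mu> d x z
          in if u \<le> acceptance_prob \<pi> S \<gamma> d (x, w) (x', w') then (x', w') else (x, w)))"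

definition stationary_law ::
  "(real \<Rightarrow> real) \<Rightarrow> (real \<Rightarrow> real) \<Rightarrow> nat \<Rightarrow> ((nat \<Rightarrow> real) \<times> real) measure" where
  "stationary_law \<pi> p d =
     (\<Pi>\<^sub>M i\<in>{..<d}. density lborel \<pi>) \<Otimes>\<^sub>M density lborel (stationary_noise_density p)"

text \<open>The last conjunct is the Markov property
  \<open>P (Y\<^sub>k\<^sub>+\<^sub>1 \<in> B | Y\<^sub>0, \<dots>, Y\<^sub>k) = K Y\<^sub>k B\<close> almost surely, integrated over the events
  \<open>(Y\<^sub>0, \<dots>, Y\<^sub>k) \<in> A\<close>.\<close>

definition markov_chain ::
  "'s measure \<Rightarrow> 's measure \<Rightarrow> ('s \<Rightarrow> 's measure) \<Rightarrow> 'a measure \<Rightarrow> (nat \<Rightarrow> 'a \<Rightarrow> 's) \<Rightarrow> bool" where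
  "markov_chain E \<nu> K M Y \<longleftrightarrow>
     prob_space M \<and> (\<forall>k. Y k \<in> measurable M E) \<and> distr M E (Y 0) = \<nu> \<and>
     (\<forall>k. \<forall>A\<in>sets (\<Pi>\<^sub>M i\<in>{..k}. E). \<forall>B\<in>sets E.
        emeasure M {\<omega>\<in>space M. (\<lambda>i\<in>{..k}. Y i \<omega>) \<in> A \<and> Y (Suc k) \<omega> \<in> B} =
        (\<integral>\<^sup>+\<omega>. indicator A (\<lambda>i\<in>{..k}. Y i \<omega>) * emeasure (K (Y k \<omega>)) B \<partial>M))"

definition stationary_dapsmrwm_chain ::
  "(real \<Rightarrow> real) \<Rightarrow> (real \<Rightarrow> real \<Rightarrow> real) \<Rightarrow> (real \<Rightarrow> real) \<Rightarrow> real \<Rightarrow> (nat \<Rightarrow> real) \<Rightarrow> nat \<Rightarrow>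
     'a measure \<Rightarrow> (nat \<Rightarrow> 'a \<Rightarrow> (nat \<Rightarrow> real) \<times> real) \<Rightarrow> bool" where
  "stationary_dapsmrwm_chain \<pi> S p \<mu> \<gamma> d M Y \<longleftrightarrow>
     markov_chain (state_space d) (stationary_law \<pi> p d) (dapsmrwm_kernel \<pi> S p \<mu> \<gamma> d) M Y"

definition ESJD :: "nat \<Rightarrow> 'a measure \<Rightarrow> (nat \<Rightarrow> 'a \<Rightarrow> (nat \<Rightarrow> real) \<times> real) \<Rightarrow> nat \<Rightarrow> real" where
  "ESJD d M Y k =
     (\<integral>\<omega>. (L2_set (\<lambda>i. fst (Y (Suc k) \<omega>) i - fst (Y k \<omega>) i) {..<d})\<^sup>2 \<partial>M)"

section \<open>The limit\<close>

definition std_normal_vector :: "(real ^ 'n) measure" where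
  "std_normal_vector = density lborel (\<lambda>z. ennreal (\<Prod>i\<in>UNIV. std_normal_density (z $ i)))"

text \<open>The normal law with mean \<open>m\<close> and positive semidefinite, possibly singular, covariance
  matrix \<open>V\<close>: the law of \<open>m + A Z\<close> with \<open>Z\<close> standard normal and \<open>A A\<^sup>T = V\<close>. It does not depend
  on which such \<open>A\<close> is chosen. For \<open>V\<close> not positive semidefinite the value is meaningless.\<close>

definition normal_vector :: "real ^ 'n \<Rightarrow> real ^ 'n ^ 'n \<Rightarrow> (real ^ 'n) measure" where
  "normal_vector m V =
     distr std_normal_vector borel (\<lambda>z. m + (SOME A :: real ^ 'n ^ 'n. A ** transpose A = V) *v z)"

definition limit_law :: "real \<Rightarrow> real \<Rightarrow> real \<Rightarrow> (real ^ 2) measure" where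
  "limit_law \<mu> b1 b2 =
     normal_vector
       (- (\<mu>\<^sup>2 / 2) *\<^sub>R vector [1, - b1])
       (\<mu>\<^sup>2 *\<^sub>R vector [vector [1, - b1], vector [- b1, b2\<^sup>2]])"

definition alpha12 :: "(real \<Rightarrow> real) \<Rightarrow> (real \<Rightarrow> real \<Rightarrow> real) \<Rightarrow> (real \<Rightarrow> real) \<Rightarrow> real \<Rightarrow> real" where
  "alpha12 \<pi> S p \<mu> =
     (\<integral>(v, w', w). F (v $ 1 + v $ 2) * F ((w' - w) - v $ 2)
        \<partial>(limit_law \<mu> (beta1 \<pi> S) (beta2 \<pi> S) \<Otimes>\<^sub>M
           density lborel p \<Otimes>\<^sub>M density lborel (stationary_noise_density p)))"

end

theory Submission
  imports Defs "HOL-Real_Asymp.Real_Asymp"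
begin

text \<open>An accepted jump has squared length \<open>(\<mu> / I)\<^sup>2\<close> times \<open>|Z|\<^sup>2 / d\<close>, and \<open>|Z|\<^sup>2 / d\<close> concentrates at 1, so the
expected squared jumping distance tends to \<open>(\<mu> / I)\<^sup>2\<close> times the limit of the mean acceptance
probability at stationarity. Averaging the acceptance probability over the two noise variables leaves a
function \<open>G q s\<close> of the increments \<open>q\<close> of the log-target and \<open>s\<close> of the log-error; it takes values in
\<open>[0,1]\<close> and is Lipschitz (\<open>G_lipschitz\<close>). The whole problem is the limit of \<open>G\<close>'s expectation.

Write \<open>l\<close> for the logarithm of the density and \<open>h = \<mu> / (I \<surd>d)\<close> for the step. A second-order Taylor
expansion (\<open>expansion_L1\<close>) splits each increment into a linear form in \<open>Z\<close>, with coefficients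
\<open>h l'(x\<^sub>i)\<close> or \<open>h \<partial>\<^sub>x S(x\<^sub>i, \<gamma>\<^sub>i)\<close>, a quadratic term that concentrates at \<open>-\<mu>\<^sup>2 / 2\<close> or
\<open>\<mu>\<^sup>2 \<beta>\<^sub>1 / 2\<close>, and a remainder of order \<open>1 / \<surd>d\<close>. The first mean is as stated because integration by
parts gives \<open>E l'' = - I\<^sup>2\<close>.

The limit law of the linear forms comes without a central limit theorem: given \<open>x\<close>, the
two forms are exactly jointly normal, with covariance their Gram matrix
(\<open>distr_PiM_std_normal_pair\<close>, a consequence of the rotation invariance of the normal law). The
entries of the Gram matrix are averages over the coordinates of \<open>x\<close>, and laws of large numbers make
them converge in \<open>L\<^sup>1\<close> (\<open>weak_law_L1\<close>, \<open>average_L1\<close>) to the covariance matrix in the statement; its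
off-diagonal entry is \<open>- \<mu>\<^sup>2 \<beta>\<^sub>1\<close> because \<open>E (l' \<partial>\<^sub>x S) = - E (\<partial>\<^sub>x\<^sub>x S)\<close>, again by parts. The expectation of
\<open>G\<close> under a normal law is continuous in the covariance matrix at the limit (\<open>rate_continuous\<close>):
the limiting variance \<open>\<mu>\<^sup>2\<close> of the first component is positive, so the Cholesky factor is continuous
there, even if the limit covariance is singular.

The sequence \<open>\<gamma>\<close> enters only through the averages of two bounded functions of \<open>\<gamma>\<^sub>i\<close>. These
converge almost surely by a strong law (\<open>strong_law_bounded\<close>), and the limit holds for every
sequence for which they do (\<open>ESJD_tendsto\<close>).

The time \<open>k\<close> is arbitrary, so one also has to know that the chain remains stationary. This is
detailed balance (\<open>acceptance_balance\<close>, \<open>stationary_invariant\<close>); the Markov property then reduces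
the jumping distance to one step from the stationary law (\<open>ESJD_eq\<close>).\<close>

section \<open>Laws of large numbers\<close>

lemma (in prob_space) expectation_abs_le_sqrt:
  fixes Y :: "'a \<Rightarrow> real"
  assumes Y: "integrable M Y" and Y2: "integrable M (\<lambda>x. (Y x)\<^sup>2)"
    and le: "expectation (\<lambda>x. (Y x)\<^sup>2) \<le> C"
  shows "expectation (\<lambda>x. \<bar>Y x\<bar>) \<le> sqrt C"
proof -
  define m where "m = expectation (\<lambda>x. \<bar>Y x\<bar>)"
  have "0 \<le> expectation (\<lambda>x. (\<bar>Y x\<bar> - m)\<^sup>2)"
    by simp
  also have "(\<lambda>x. (\<bar>Y x\<bar> - m)\<^sup>2) = (\<lambda>x. (Y x)\<^sup>2 - 2 * m * \<bar>Y x\<bar> + m\<^sup>2)"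
    by (auto simp: power2_diff algebra_simps)
  also have "expectation \<dots> = expectation (\<lambda>x. (Y x)\<^sup>2) - 2 * m * m + m\<^sup>2"
    using Y Y2 by (simp add: m_def prob_space)
  finally have "m\<^sup>2 \<le> C"
    using le by (simp add: power2_eq_square)
  then show ?thesis
    unfolding m_def[symmetric] by (rule real_le_rsqrt)
qed

lemma (in prob_space) integrable_component:
  fixes g :: "'a \<Rightarrow> real"
  assumes "finite I" "i \<in> I" "integrable M g"
  shows "integrable (Pi\<^sub>M I (\<lambda>_. M)) (\<lambda>x. g (x i))"
    and "(\<integral>x. g (x i) \<partial>Pi\<^sub>M I (\<lambda>_. M)) = (\<integral>x. g x \<partial>M)"
proof -
  interpret P: product_prob_space "\<lambda>_. M" I by unfold_locales
  have d: "distr (Pi\<^sub>M I (\<lambda>_. M)) M (\<lambda>x. x i) = M"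
    using P.PiM_component[OF assms(2)] by simp
  have "integrable (distr (Pi\<^sub>M I (\<lambda>_. M)) M (\<lambda>x. x i)) g"
    using assms(3) by (simp add: d)
  then show "integrable (Pi\<^sub>M I (\<lambda>_. M)) (\<lambda>x. g (x i))"
    using assms by (subst (asm) integrable_distr_eq) auto
  have "(\<integral>x. g x \<partial>distr (Pi\<^sub>M I (\<lambda>_. M)) M (\<lambda>x. x i)) = (\<integral>x. g (x i) \<partial>Pi\<^sub>M I (\<lambda>_. M))"
    using assms by (intro integral_distr) auto
  then show "(\<integral>x. g (x i) \<partial>Pi\<^sub>M I (\<lambda>_. M)) = (\<integral>x. g x \<partial>M)"
    by (simp add: d)
qed

lemma (in prob_space) integral_two_components:
  fixes g h :: "'a \<Rightarrow> real"
  assumes I: "finite I" "i \<in> I" "j \<in> I" "i \<noteq> j" and g: "integrable M g" and h: "integrable M h"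
  shows "integrable (Pi\<^sub>M I (\<lambda>_. M)) (\<lambda>x. g (x i) * h (x j))"
    and "(\<integral>x. g (x i) * h (x j) \<partial>Pi\<^sub>M I (\<lambda>_. M)) = (\<integral>x. g x \<partial>M) * (\<integral>x. h x \<partial>M)"
proof -
  interpret P: product_prob_space "\<lambda>_. M" I by unfold_locales
  define f where "f k = (if k = i then g else if k = j then h else (\<lambda>_. 1))" for k
  have eq: "(\<Prod>k\<in>I. f k (x k)) = g (x i) * h (x j)" for x
    using I by (subst prod.remove[of _ i], simp, simp, subst prod.remove[of _ j])
      (auto simp: f_def intro!: prod.neutral)
  have eq2: "(\<Prod>k\<in>I. integral\<^sup>L M (f k)) = integral\<^sup>L M g * integral\<^sup>L M h"
    using I by (subst prod.remove[of _ i], simp, simp, subst prod.remove[of _ j])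
      (auto simp: f_def prob_space intro!: prod.neutral)
  have int: "integrable M (f k)" for k
    using g h by (auto simp: f_def)
  show "integrable (Pi\<^sub>M I (\<lambda>_. M)) (\<lambda>x. g (x i) * h (x j))"
    using P.product_integrable_prod[of I f] int I by (simp add: eq)
  show "(\<integral>x. g (x i) * h (x j) \<partial>Pi\<^sub>M I (\<lambda>_. M)) = (\<integral>x. g x \<partial>M) * (\<integral>x. h x \<partial>M)"
    using P.product_integral_prod[of I f] int I by (simp add: eq eq2)
qed

text \<open>Independent centred summands are orthogonal, so the second moment of the sum is at most the number of
summands times \<open>C\<close>.\<close>

lemma (in prob_space) expectation_abs_sum_centred_le:
  fixes g :: "'i \<Rightarrow> 'a \<Rightarrow> real" and C :: real
  assumes I: "finite I"
    and g: "\<And>i. i \<in> I \<Longrightarrow> integrable M (g i)"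
    and g2: "\<And>i. i \<in> I \<Longrightarrow> integrable M (\<lambda>x. (g i x)\<^sup>2)"
    and centred: "\<And>i. i \<in> I \<Longrightarrow> expectation (g i) = 0"
    and le: "\<And>i. i \<in> I \<Longrightarrow> expectation (\<lambda>x. (g i x)\<^sup>2) \<le> C"
  shows "(\<integral>x. \<bar>\<Sum>i\<in>I. g i (x i)\<bar> \<partial>Pi\<^sub>M I (\<lambda>_. M)) \<le> sqrt (card I * C)"
proof -
  interpret P: product_prob_space "\<lambda>_. M" I by unfold_locales
  have sq: "(\<Sum>i\<in>I. g i (x i))\<^sup>2 = (\<Sum>i\<in>I. \<Sum>j\<in>I. g i (x i) * g j (x j))" for x
    by (simp add: power2_eq_square sum_product)
  have int: "integrable (Pi\<^sub>M I (\<lambda>_. M)) (\<lambda>x. g i (x i) * g j (x j))"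
    and val: "(\<integral>x. g i (x i) * g j (x j) \<partial>Pi\<^sub>M I (\<lambda>_. M)) \<le> (if i = j then C else 0)"
    if "i \<in> I" "j \<in> I" for i j
    using integral_two_components[OF I that _ g[OF that(1)] g[OF that(2)]]
      integrable_component[OF I that(1) g2[OF that(1)]] that centred le
    by (cases "i = j"; auto simp: power2_eq_square)+
  have "P.expectation (\<lambda>x. (\<Sum>i\<in>I. g i (x i))\<^sup>2) =
      (\<Sum>i\<in>I. \<Sum>j\<in>I. \<integral>x. g i (x i) * g j (x j) \<partial>Pi\<^sub>M I (\<lambda>_. M))"
    unfolding sq using int by (simp add: Bochner_Integration.integral_sum)
  also have "\<dots> \<le> (\<Sum>i\<in>I. \<Sum>j\<in>I. if i = j then C else 0)"
    using val by (intro sum_mono) auto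
  also have "\<dots> = card I * C"
    using I by simp
  finally have "P.expectation (\<lambda>x. (\<Sum>i\<in>I. g i (x i))\<^sup>2) \<le> card I * C" .
  then show ?thesis
    using int integrable_component(1)[OF I _ g]
    by (intro P.expectation_abs_le_sqrt) (auto simp: sq)
qed

lemma (in prob_space) integral_truncation:
  fixes g :: "'a \<Rightarrow> real"
  assumes "integrable M g"
  shows "(\<lambda>K. \<integral>x. (if \<bar>g x\<bar> \<le> real K then 0 else \<bar>g x\<bar>) \<partial>M) \<longlonglongrightarrow> 0"
proof -
  have "(\<lambda>K. \<integral>x. (if \<bar>g x\<bar> \<le> real K then 0 else \<bar>g x\<bar>) \<partial>M) \<longlonglongrightarrow> (\<integral>x. 0 \<partial>M)"
  proof (rule integral_dominated_convergence[where w="\<lambda>x. \<bar>g x\<bar>"])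
    show "AE x in M. (\<lambda>K. if \<bar>g x\<bar> \<le> real K then 0 else \<bar>g x\<bar>) \<longlonglongrightarrow> 0"
    proof (rule AE_I2)
      fix x
      obtain n where n: "\<bar>g x\<bar> \<le> real n" using real_arch_simple by blast
      have "eventually (\<lambda>K. (if \<bar>g x\<bar> \<le> real K then 0 else \<bar>g x\<bar>) = 0) sequentially"
        using eventually_ge_at_top[of n] by eventually_elim (use n in auto)
      then show "(\<lambda>K. if \<bar>g x\<bar> \<le> real K then 0 else \<bar>g x\<bar>) \<longlonglongrightarrow> 0"
        by (rule tendsto_eventually)
    qed
  qed (use assms in auto)
  then show ?thesis by simp
qed

text \<open>The summands need not have a second moment, so \<open>g\<close> is truncated at a level \<open>K\<close>: the bounded part
obeys the second-moment bound, and the mean of the tail is small for large \<open>K\<close>. The lemma is used for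
the squared score, of which only the first moment is known to be finite.\<close>

lemma (in prob_space) weak_law_L1:
  fixes g :: "'a \<Rightarrow> real"
  assumes g: "integrable M g"
  shows "(\<lambda>n. \<integral>x. \<bar>(\<Sum>i<n. g (x i)) / real n - expectation g\<bar> \<partial>Pi\<^sub>M {..<n} (\<lambda>_. M)) \<longlonglongrightarrow> 0"
    (is "?L \<longlonglongrightarrow> 0")
proof (rule LIMSEQ_I)
  fix e :: real assume e: "0 < e"
  have "eventually (\<lambda>K. (\<integral>x. (if \<bar>g x\<bar> \<le> real K then 0 else \<bar>g x\<bar>) \<partial>M) < e / 4) sequentially"
    using order_tendstoD(2)[OF integral_truncation[OF g], of "e / 4"] e by simp
  then obtain K :: nat where K: "(\<integral>x. (if \<bar>g x\<bar> \<le> real K then 0 else \<bar>g x\<bar>) \<partial>M) < e / 4"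
    by (auto simp: eventually_sequentially)
  define g1 where "g1 x = (if \<bar>g x\<bar> \<le> real K then g x else 0)" for x
  define g2 where "g2 x = (if \<bar>g x\<bar> \<le> real K then 0 else g x)" for x
  have meas [measurable]: "g \<in> borel_measurable M" "g1 \<in> borel_measurable M" "g2 \<in> borel_measurable M"
    using g by (auto simp: g1_def[abs_def] g2_def[abs_def])
  have sum12: "g x = g1 x + g2 x" for x by (simp add: g1_def g2_def)
  have i1: "integrable M g1"
    by (rule Bochner_Integration.integrable_bound[OF g]) (auto simp: g1_def)
  have i2: "integrable M g2"
    by (rule Bochner_Integration.integrable_bound[OF g]) (auto simp: g2_def)
  have abs2: "\<bar>g2 x\<bar> = (if \<bar>g x\<bar> \<le> real K then 0 else \<bar>g x\<bar>)" for x by (simp add: g2_def)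
  have e2: "(\<integral>x. \<bar>g2 x\<bar> \<partial>M) < e / 4" using K by (simp add: abs2)
  define m1 where "m1 = expectation g1"
  define h where "h x = g1 x - m1" for x
  have m1: "\<bar>m1\<bar> \<le> real K"
  proof -
    have "\<bar>m1\<bar> \<le> (\<integral>x. \<bar>g1 x\<bar> \<partial>M)" unfolding m1_def by (rule integral_abs_bound)
    also have "\<dots> \<le> (\<integral>x. real K \<partial>M)"
      by (intro integral_mono integrable_abs i1) (auto simp: g1_def)
    finally show ?thesis by (simp add: prob_space)
  qed
  have hb: "\<bar>h x\<bar> \<le> 2 * real K" for x
    using m1 by (auto simp: h_def g1_def)
  have ih: "integrable M h" using i1 by (simp add: h_def[abs_def])
  have h2b: "(h x)\<^sup>2 \<le> (2 * real K)\<^sup>2" for x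
    using hb[of x] by (metis abs_ge_zero power2_abs power_mono)
  have ih2: "integrable M (\<lambda>x. (h x)\<^sup>2)"
    using h2b ih by (intro integrable_const_bound[where B="(2 * real K)\<^sup>2"]) auto
  have eh2: "expectation (\<lambda>x. (h x)\<^sup>2) \<le> (2 * real K)\<^sup>2"
    using h2b ih2 by (intro integral_le_const) auto
  have eh: "expectation h = 0" using i1 by (simp add: h_def[abs_def] m1_def prob_space)
  have m2: "\<bar>expectation g2\<bar> \<le> e / 4"
    using integral_abs_bound[of M g2] e2 by linarith
  have mg: "expectation g = m1 + expectation g2"
    using i1 i2 by (simp add: m1_def sum12[abs_def])
  have bound: "?L n \<le> 2 * real K / sqrt n + e / 2" if n: "0 < n" for n
  proof -
    interpret P: product_prob_space "\<lambda>_. M" "{..<n}" by unfold_locales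
    have ic: "integrable (Pi\<^sub>M {..<n} (\<lambda>_. M)) (\<lambda>x. f (x i))"
        "(\<integral>x. f (x i) \<partial>Pi\<^sub>M {..<n} (\<lambda>_. M)) = expectation f"
      if "i \<in> {..<n}" "integrable M f" for i and f :: "'a \<Rightarrow> real"
      using integrable_component[OF _ that] by auto
    have pw: "\<bar>(\<Sum>i<n. g (x i)) / real n - expectation g\<bar>
        \<le> \<bar>\<Sum>i<n. h (x i)\<bar> / n + (\<Sum>i<n. \<bar>g2 (x i)\<bar>) / n + e / 4" for x
    proof -
      have "(\<Sum>i<n. g (x i)) / real n - expectation g =
          (\<Sum>i<n. h (x i)) / n + (\<Sum>i<n. g2 (x i)) / n - expectation g2"
        using n by (simp add: sum12 h_def sum.distrib sum_subtractf mg add_divide_distrib diff_divide_distrib)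
      also have "\<bar>\<dots>\<bar> \<le> \<bar>\<Sum>i<n. h (x i)\<bar> / n + \<bar>\<Sum>i<n. g2 (x i)\<bar> / n + e / 4"
        proof -
        have "\<bar>u + v - w\<bar> \<le> \<bar>u\<bar> + \<bar>v\<bar> + e / 4" if "\<bar>w\<bar> \<le> e / 4" for u v w :: real
          using that by linarith
        from this[OF m2, of "(\<Sum>i<n. h (x i)) / n" "(\<Sum>i<n. g2 (x i)) / n"]
        show ?thesis by (simp only: abs_divide abs_of_nat)
      qed
      also have "\<dots> \<le> \<bar>\<Sum>i<n. h (x i)\<bar> / n + (\<Sum>i<n. \<bar>g2 (x i)\<bar>) / n + e / 4"
        by (intro add_mono divide_right_mono sum_abs) auto
      finally show ?thesis .
    qed
    have a: "integrable (Pi\<^sub>M {..<n} (\<lambda>_. M)) (\<lambda>x. \<bar>\<Sum>i<n. h (x i)\<bar> / n)"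
      by (intro integrable_divide integrable_abs Bochner_Integration.integrable_sum ic(1) ih)
    have b: "integrable (Pi\<^sub>M {..<n} (\<lambda>_. M)) (\<lambda>x. (\<Sum>i<n. \<bar>g2 (x i)\<bar>) / n)"
      by (intro integrable_divide integrable_abs Bochner_Integration.integrable_sum ic(1) i2)
    have cg: "integrable (Pi\<^sub>M {..<n} (\<lambda>_. M)) (\<lambda>x. (\<Sum>i<n. g (x i)) / n)"
      by (intro integrable_divide Bochner_Integration.integrable_sum ic(1) g)
    have "?L n \<le> (\<integral>x. \<bar>\<Sum>i<n. h (x i)\<bar> / n + (\<Sum>i<n. \<bar>g2 (x i)\<bar>) / n + e / 4 \<partial>Pi\<^sub>M {..<n} (\<lambda>_. M))"
      using pw by (intro integral_mono Bochner_Integration.integrable_add Bochner_Integration.integrable_diff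
          integrable_abs a b cg) auto
    also have "\<dots> = (\<integral>x. \<bar>\<Sum>i<n. h (x i)\<bar> \<partial>Pi\<^sub>M {..<n} (\<lambda>_. M)) / n + (\<integral>x. \<bar>g2 x\<bar> \<partial>M) + e / 4"
    proof -
      have c: "(\<integral>x. (\<Sum>i<n. \<bar>g2 (x i)\<bar>) / n \<partial>Pi\<^sub>M {..<n} (\<lambda>_. M)) = (\<integral>x. \<bar>g2 x\<bar> \<partial>M)"
        using i2 n ic(1)[of _ "\<lambda>x. \<bar>g2 x\<bar>"] ic(2)[of _ "\<lambda>x. \<bar>g2 x\<bar>"]
        by (simp add: Bochner_Integration.integral_sum)
      show ?thesis using a b c P.P.prob_space by simp
    qed
    also have "\<dots> \<le> sqrt (card {..<n} * (2 * real K)\<^sup>2) / n + e / 4 + e / 4"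
      using e2 ih ih2 eh eh2
      by (intro add_mono divide_right_mono expectation_abs_sum_centred_le) auto
    also have "\<dots> = 2 * real K / sqrt n + e / 2"
      using n by (simp add: real_sqrt_mult field_simps)
    finally show ?thesis .
  qed
  have lim0: "(\<lambda>n. 2 * real K / sqrt (real n)) \<longlonglongrightarrow> 0"
    by real_asymp
  then have "eventually (\<lambda>n. 2 * real K / sqrt (real n) < e / 2) sequentially"
    using order_tendstoD(2)[OF lim0, of "e / 2"] e by simp
  then obtain N where N: "\<And>n. N \<le> n \<Longrightarrow> 2 * real K / sqrt (real n) < e / 2"
    by (auto simp: eventually_sequentially)
  show "\<exists>no. \<forall>n\<ge>no. norm (?L n - 0) < e"
  proof (intro exI allI impI)
    fix n assume "max N 1 \<le> n"
    then have "?L n < e" using bound[of n] N[of n] by auto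
    moreover have "0 \<le> ?L n" by (intro integral_nonneg_AE) auto
    ultimately show "norm (?L n - 0) < e" by simp
  qed
qed

text \<open>Hoeffding's inequality makes the probabilities of a deviation by any fixed amount summable, and the
Borel-Cantelli lemma applies to each deviation \<open>1 / (k + 1)\<close>.\<close>

lemma (in prob_space) strong_law_bounded:
  fixes X :: "nat \<Rightarrow> 'a \<Rightarrow> 'b" and g :: "'b \<Rightarrow> real"
  assumes indep: "indep_vars (\<lambda>_. N) X UNIV"
    and law: "\<And>i. distr M N (X i) = D"
    and g [measurable]: "g \<in> borel_measurable N"
    and bound: "\<And>y. y \<in> space N \<Longrightarrow> \<bar>g y\<bar> \<le> B"
  shows "AE \<omega> in M. (\<lambda>n. (\<Sum>i<n. g (X i \<omega>)) / real n) \<longlonglongrightarrow> (\<integral>y. g y \<partial>D)"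
proof -
  \<comment> \<open>The summand 1 keeps the interval nondegenerate, as the inequality requires, also for \<open>B = 0\<close>.\<close>
  define a b where "a = - (\<bar>B\<bar> + 1)" and "b = \<bar>B\<bar> + 1"
  have ab: "a < b" "0 < (b - a)\<^sup>2" by (auto simp: a_def b_def)
  have X [measurable]: "X i \<in> measurable M N" for i
    using indep by (auto simp: indep_vars_def)
  have gX: "\<bar>g (X i \<omega>)\<bar> \<le> B" if "\<omega> \<in> space M" for i \<omega>
    using bound measurable_space[OF X that] by auto
  have indep': "indep_vars (\<lambda>_. borel) (\<lambda>i \<omega>. g (X i \<omega>)) UNIV"
    by (rule indep_vars_compose2[OF indep]) simp
  define m where "m = (\<integral>y. g y \<partial>D)"
  have gdist: "distr M borel (\<lambda>\<omega>. g (X i \<omega>)) = distr D borel g" for i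
    unfolding law[of i, symmetric] by (subst distr_distr) (auto simp: comp_def)
  have m: "m = expectation (\<lambda>\<omega>. g (X 0 \<omega>))"
    unfolding m_def law[of 0, symmetric] by (rule integral_distr) auto
  define A where "A e n = {\<omega>\<in>space M. e \<le> \<bar>(\<Sum>i<n. g (X i \<omega>)) / real n - m\<bar>}" for e :: real and n :: nat
  have [measurable]: "A e n \<in> sets M" for e n
    unfolding A_def by measurable
  have tail: "prob (A e n) \<le> 2 * exp (- (2 * e\<^sup>2 / (b - a)\<^sup>2)) ^ n" if e: "0 < e" and n: "0 < n" for e n
  proof -
    interpret H: Hoeffding_ineq_iid M "{..<n}" "\<lambda>i \<omega>. g (X i \<omega>)" "\<lambda>\<omega>. g (X 0 \<omega>)" a b m
    proof (unfold_locales, goal_cases)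
      case 2 show ?case by (rule indep_vars_subset[OF indep']) auto
    next
      case 5 then show ?case using gX[of _ 0] by (auto simp: a_def b_def intro!: AE_I2) (smt (verit))+
    qed (auto simp: gdist m)
    have "prob (A e n) \<le> 2 * exp (- 2 * real n * e\<^sup>2 / (b - a)\<^sup>2)"
      using H.Hoeffding_ineq_abs_ge'[of e] e n ab unfolding A_def by auto
    also have "exp (- 2 * real n * e\<^sup>2 / (b - a)\<^sup>2) = exp (real n * - (2 * e\<^sup>2 / (b - a)\<^sup>2))"
      by (simp add: field_simps)
    also have "\<dots> = exp (- (2 * e\<^sup>2 / (b - a)\<^sup>2)) ^ n"
      by (rule exp_of_nat_mult)
    finally show ?thesis .
  qed
  have summ: "summable (\<lambda>n. prob (A e n))" if e: "0 < e" for e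
  proof (rule summable_comparison_test')
    show "summable (\<lambda>n. 2 * exp (- (2 * e\<^sup>2 / (b - a)\<^sup>2)) ^ n)"
      using e ab by (intro summable_mult summable_geometric) auto
    show "norm (prob (A e n)) \<le> 2 * exp (- (2 * e\<^sup>2 / (b - a)\<^sup>2)) ^ n" if "1 \<le> n" for n
      using tail[OF e, of n] that by auto
  qed
  have "AE \<omega> in M. \<forall>k. eventually (\<lambda>n. \<omega> \<in> space M - A (1 / real (Suc k)) n) sequentially"
    unfolding AE_all_countable
    by (intro allI borel_cantelli_AE1 summ) (auto simp: emeasure_eq_measure)
  then show ?thesis
  proof eventually_elim
    case (elim \<omega>)
    show ?case
    proof (rule LIMSEQ_I)
      fix r :: real assume "0 < r"
      then obtain k where k: "1 / real (Suc k) < r"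
        using nat_approx_posE by auto
      from elim have "eventually (\<lambda>n. \<omega> \<in> space M - A (1 / real (Suc k)) n) sequentially" by blast
      then obtain N where N: "\<And>n. N \<le> n \<Longrightarrow> \<omega> \<in> space M - A (1 / real (Suc k)) n"
        by (auto simp: eventually_sequentially)
      show "\<exists>no. \<forall>n\<ge>no. norm ((\<Sum>i<n. g (X i \<omega>)) / real n - (\<integral>y. g y \<partial>D)) < r"
        using N k by (intro exI[of _ N]) (force simp: A_def m_def)
    qed
  qed
qed

section \<open>Linear forms in independent normal variables\<close>

abbreviation std_normal :: "real measure" where
  "std_normal \<equiv> density lborel std_normal_density"

abbreviation normal2 :: "(real \<Rightarrow> real \<Rightarrow> ennreal) \<Rightarrow> ennreal" where
  "normal2 f \<equiv> \<integral>\<^sup>+x. \<integral>\<^sup>+y. f x y \<partial>std_normal \<partial>std_normal"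

lemma prob_space_std_normal: "prob_space std_normal"
  by (rule prob_space_normal_density) simp

lemma nn_integral_std_normal:
  "f \<in> borel_measurable borel \<Longrightarrow>
    (\<integral>\<^sup>+x. f x \<partial>std_normal) = (\<integral>\<^sup>+x. ennreal (std_normal_density x) * f x \<partial>lborel)"
  by (subst nn_integral_density) auto

lemma nn_integral_std_normal_uminus:
  assumes [measurable]: "f \<in> borel_measurable borel"
  shows "(\<integral>\<^sup>+x. f (- x) \<partial>std_normal) = (\<integral>\<^sup>+x. f x \<partial>std_normal)"
proof -
  have "(\<integral>\<^sup>+x. f x \<partial>std_normal) = (\<integral>\<^sup>+x. ennreal (std_normal_density x) * f x \<partial>lborel)"
    by (rule nn_integral_std_normal) simp
  also have "\<dots> = (\<integral>\<^sup>+x. ennreal (std_normal_density (- x)) * f (- x) \<partial>lborel)"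
    by (subst nn_integral_real_affine[where c="-1" and t=0]) auto
  also have "\<dots> = (\<integral>\<^sup>+x. f (- x) \<partial>std_normal)"
    by (subst nn_integral_std_normal) (auto simp: normal_density_def)
  finally show ?thesis by simp
qed

lemma nn_integral_lborel_translate:
  fixes f :: "real \<Rightarrow> ennreal"
  assumes "f \<in> borel_measurable borel"
  shows "(\<integral>\<^sup>+x. f (x + a) \<partial>lborel) = (\<integral>\<^sup>+x. f x \<partial>lborel)"
  using nn_integral_real_affine[OF assms, of 1 a] by (simp add: add.commute)

lemma nn_integral_lborel2_shear:
  fixes f :: "real \<Rightarrow> real \<Rightarrow> ennreal"
  assumes [measurable]: "case_prod f \<in> borel_measurable (borel \<Otimes>\<^sub>M borel)"
  shows "(\<integral>\<^sup>+x. \<integral>\<^sup>+y. f (x + t * y) y \<partial>lborel \<partial>lborel) = (\<integral>\<^sup>+x. \<integral>\<^sup>+y. f x y \<partial>lborel \<partial>lborel)"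
proof -
  have "(\<integral>\<^sup>+x. \<integral>\<^sup>+y. f (x + t * y) y \<partial>lborel \<partial>lborel) = (\<integral>\<^sup>+y. \<integral>\<^sup>+x. f (x + t * y) y \<partial>lborel \<partial>lborel)"
    by (rule lborel_pair.Fubini') simp
  also have "\<dots> = (\<integral>\<^sup>+y. \<integral>\<^sup>+x. f x y \<partial>lborel \<partial>lborel)"
    by (intro nn_integral_cong nn_integral_lborel_translate) simp
  also have "\<dots> = (\<integral>\<^sup>+x. \<integral>\<^sup>+y. f x y \<partial>lborel \<partial>lborel)"
    by (rule lborel_pair.Fubini'[symmetric]) simp
  finally show ?thesis .
qed

lemma nn_integral_lborel2_shear':
  fixes f :: "real \<Rightarrow> real \<Rightarrow> ennreal"
  assumes [measurable]: "case_prod f \<in> borel_measurable (borel \<Otimes>\<^sub>M borel)"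
  shows "(\<integral>\<^sup>+x. \<integral>\<^sup>+y. f x (y + t * x) \<partial>lborel \<partial>lborel) = (\<integral>\<^sup>+x. \<integral>\<^sup>+y. f x y \<partial>lborel \<partial>lborel)"
  by (intro nn_integral_cong nn_integral_lborel_translate) simp

text \<open>A rotation by an angle other than a half turn is a product of three shears, and each shear preserves
the area by translation invariance in one coordinate.\<close>

lemma nn_integral_lborel2_rotate:
  fixes f :: "real \<Rightarrow> real \<Rightarrow> ennreal"
  assumes [measurable]: "case_prod f \<in> borel_measurable (borel \<Otimes>\<^sub>M borel)"
    and cs: "c\<^sup>2 + s\<^sup>2 = 1"
  shows "(\<integral>\<^sup>+x. \<integral>\<^sup>+y. f (c * x - s * y) (s * x + c * y) \<partial>lborel \<partial>lborel) =
    (\<integral>\<^sup>+x. \<integral>\<^sup>+y. f x y \<partial>lborel \<partial>lborel)"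
proof (cases "c = -1")
  case True
  then have s: "s = 0" using cs by simp
  have neg: "(\<integral>\<^sup>+x. g x \<partial>lborel) = (\<integral>\<^sup>+x. g (- x) \<partial>lborel)"
    if "g \<in> borel_measurable borel" for g :: "real \<Rightarrow> ennreal"
    using that by (subst nn_integral_real_affine[where c="-1" and t=0]) auto
  show ?thesis
    unfolding True s
    by (subst (2) neg, measurable, rule nn_integral_cong, subst neg) auto
next
  case False
  \<comment> \<open>For the rotation by \<open>\<theta>\<close> this is \<open>- tan (\<theta> / 2)\<close>, the parameter of the outer two shears.\<close>
  define t where "t = - s / (1 + c)"
  have c1: "1 + c \<noteq> 0" using False by linarith
  have "s * t = - (s\<^sup>2 / (1 + c))" by (simp add: t_def power2_eq_square)
  also have "s\<^sup>2 = (1 - c) * (1 + c)"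
  proof -
    have "s\<^sup>2 = 1 - c\<^sup>2" using cs by linarith
    also have "\<dots> = (1 - c) * (1 + c)" by (simp add: power2_eq_square algebra_simps)
    finally show ?thesis .
  qed
  finally have st: "s * t = c - 1" using c1 by simp
  have "t + t * c = t * (1 + c)" by (simp add: algebra_simps)
  then have tt: "t + t * c = - s" using c1 by (simp add: t_def)
  have *: "(x + t * y) + t * (y + s * (x + t * y)) = c * x - s * y"
       "y + s * (x + t * y) = s * x + c * y" for x y
  proof -
    have "y + s * (x + t * y) = s * x + y * (1 + s * t)" by (simp add: distrib_left mult_ac)
    then show 2: "y + s * (x + t * y) = s * x + c * y" by (simp add: st mult.commute)
    have "(x + t * y) + t * (y + s * (x + t * y)) = x * (1 + s * t) + y * (t + t * c)"
      unfolding 2 by (simp add: algebra_simps)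
    then show "(x + t * y) + t * (y + s * (x + t * y)) = c * x - s * y"
      unfolding st tt by (simp add: algebra_simps)
  qed
  have "(\<integral>\<^sup>+x. \<integral>\<^sup>+y. f x y \<partial>lborel \<partial>lborel) = (\<integral>\<^sup>+x. \<integral>\<^sup>+y. f (x + t * y) y \<partial>lborel \<partial>lborel)"
    by (rule nn_integral_lborel2_shear[where f=f and t=t, symmetric]) simp
  also have "\<dots> = (\<integral>\<^sup>+x. \<integral>\<^sup>+y. f (x + t * (y + s * x)) (y + s * x) \<partial>lborel \<partial>lborel)"
    by (rule nn_integral_lborel2_shear'[where f="\<lambda>x y. f (x + t * y) y" and t=s, symmetric]) measurable
  also have "\<dots> = (\<integral>\<^sup>+x. \<integral>\<^sup>+y. f ((x + t * y) + t * (y + s * (x + t * y))) (y + s * (x + t * y)) \<partial>lborel \<partial>lborel)"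
    by (rule nn_integral_lborel2_shear[where f="\<lambda>x y. f (x + t * (y + s * x)) (y + s * x)" and t=t, symmetric]) measurable
  also have "\<dots> = (\<integral>\<^sup>+x. \<integral>\<^sup>+y. f (c * x - s * y) (s * x + c * y) \<partial>lborel \<partial>lborel)"
    by (intro nn_integral_cong arg_cong2[where f=f] *)
  finally show ?thesis by (rule sym)
qed

lemma nn_integral_std_normal2:
  fixes f :: "real \<Rightarrow> real \<Rightarrow> ennreal"
  assumes [measurable]: "case_prod f \<in> borel_measurable (borel \<Otimes>\<^sub>M borel)"
  shows "normal2 (\<lambda>x y. f x y) =
    (\<integral>\<^sup>+x. \<integral>\<^sup>+y. ennreal (exp (- (x\<^sup>2 + y\<^sup>2) / 2) / (2 * pi)) * f x y \<partial>lborel \<partial>lborel)"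
proof -
  have d: "std_normal_density x * std_normal_density y = exp (- (x\<^sup>2 + y\<^sup>2) / 2) / (2 * pi)" for x y
    by (simp add: std_normal_density_def exp_add[symmetric] field_simps)
  have "normal2 (\<lambda>x y. f x y) =
      (\<integral>\<^sup>+x. ennreal (std_normal_density x) * (\<integral>\<^sup>+y. ennreal (std_normal_density y) * f x y \<partial>lborel) \<partial>lborel)"
    by (simp add: nn_integral_std_normal cong: nn_integral_cong)
  also have "\<dots> = (\<integral>\<^sup>+x. \<integral>\<^sup>+y. ennreal (std_normal_density x * std_normal_density y) * f x y \<partial>lborel \<partial>lborel)"
    by (intro nn_integral_cong, subst nn_integral_cmult[symmetric])
      (auto simp: ennreal_mult mult.assoc)
  finally show ?thesis unfolding d .
qed

lemma nn_integral_std_normal_rotate: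
  fixes f :: "real \<Rightarrow> real \<Rightarrow> ennreal"
  assumes [measurable]: "case_prod f \<in> borel_measurable (borel \<Otimes>\<^sub>M borel)"
    and cs: "c\<^sup>2 + s\<^sup>2 = 1"
  shows "normal2 (\<lambda>x y. f (c * x - s * y) (s * x + c * y)) =
    normal2 (\<lambda>x y. f x y)"
proof -
  have norm: "(c * x - s * y)\<^sup>2 + (s * x + c * y)\<^sup>2 = x\<^sup>2 + y\<^sup>2" for x y
  proof -
    have "(c * x - s * y)\<^sup>2 + (s * x + c * y)\<^sup>2 = (c\<^sup>2 + s\<^sup>2) * (x\<^sup>2 + y\<^sup>2)"
      by (simp add: power2_eq_square algebra_simps)
    then show ?thesis by (simp add: cs)
  qed
  show ?thesis
    using nn_integral_lborel2_rotate[where c=c and s=s and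
        f="\<lambda>x y. ennreal (exp (- (x\<^sup>2 + y\<^sup>2) / 2) / (2 * pi)) * f x y"] cs
    by (simp add: nn_integral_std_normal2 norm)
qed

lemma unit_circle_divide:
  fixes a b r :: real
  assumes "r\<^sup>2 = a\<^sup>2 + b\<^sup>2" "r \<noteq> 0"
  shows "(a / r)\<^sup>2 + (- b / r)\<^sup>2 = 1"
proof -
  have "(a / r)\<^sup>2 + (- b / r)\<^sup>2 = (a\<^sup>2 + b\<^sup>2) / r\<^sup>2"
    by (simp add: power_divide add_divide_distrib)
  also have "\<dots> = r\<^sup>2 / r\<^sup>2" by (simp only: assms(1))
  also have "\<dots> = 1" using assms(2) by simp
  finally show ?thesis .
qed

lemma nn_integral_std_normal_linear:
  fixes G :: "real \<Rightarrow> ennreal"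
  assumes [measurable]: "G \<in> borel_measurable borel"
    and r: "r\<^sup>2 = a\<^sup>2 + b\<^sup>2"
  shows "normal2 (\<lambda>x y. G (a * x + b * y)) = (\<integral>\<^sup>+x. G (r * x) \<partial>std_normal)"
proof -
  interpret N: prob_space std_normal by (rule prob_space_std_normal)
  show ?thesis
  proof (cases "r = 0")
    case True
    with r have "a\<^sup>2 + b\<^sup>2 = 0" by simp
    then have "a = 0" "b = 0" by (auto simp: sum_power2_eq_zero_iff)
    with True show ?thesis using N.emeasure_space_1 by simp
  next
    case False
    have "(a / r)\<^sup>2 + (- b / r)\<^sup>2 = 1"
      by (rule unit_circle_divide[OF r False])
    from nn_integral_std_normal_rotate[OF _ this, of "\<lambda>x y. G (r * x)"]
    have "normal2 (\<lambda>x y. G (r * (a / r * x - - b / r * y))) =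
        (\<integral>\<^sup>+x. G (r * x) \<partial>std_normal)"
      using N.emeasure_space_1 by simp
    moreover have "r * (a / r * x - - b / r * y) = a * x + b * y" for x y
      using False by (simp add: field_simps)
    ultimately show ?thesis by (simp only:)
  qed
qed

text \<open>The rotation that takes the vector \<open>(a, b)\<close> to the first axis makes the first form a multiple of the
first variable alone; the second form keeps its inner product with the first and its norm.\<close>

lemma nn_integral_std_normal_rows:
  fixes G :: "real \<Rightarrow> real \<Rightarrow> ennreal"
  assumes [measurable]: "case_prod G \<in> borel_measurable (borel \<Otimes>\<^sub>M borel)"
    and r: "r\<^sup>2 = a\<^sup>2 + b\<^sup>2" "r \<noteq> 0"
  shows "normal2 (\<lambda>x y. G (a * x + b * y) (c * x + e * y)) =
    normal2 (\<lambda>x y. G (r * x) ((a * c + b * e) / r * x + (a * e - b * c) / r * y))"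
proof -
  have r1: "(a / r)\<^sup>2 + (- b / r)\<^sup>2 = 1"
    by (rule unit_circle_divide[OF r])
  have 1: "r * (a / r * x - - b / r * y) = a * x + b * y" for x y
    using r(2) by (simp add: field_simps)
  have 2: "(a * c + b * e) / r * (a / r * x - - b / r * y) + (a * e - b * c) / r * (- b / r * x + a / r * y)
      = c * x + e * y" for x y
  proof -
    have "(a * c + b * e) / r * (a / r * x - - b / r * y) + (a * e - b * c) / r * (- b / r * x + a / r * y)
      = (a\<^sup>2 + b\<^sup>2) * (c * x + e * y) / r\<^sup>2"
      by (simp add: power2_eq_square divide_simps) (simp add: algebra_simps)
    also have "\<dots> = c * x + e * y" unfolding r(1)[symmetric] using r(2) by simp
    finally show ?thesis .
  qed
  show ?thesis
    using nn_integral_std_normal_rotate[OF _ r1, of "\<lambda>x y. G (r * x)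
       ((a * c + b * e) / r * x + (a * e - b * c) / r * y)"]
    unfolding 1 2 by simp
qed

lemma pair_sigma_finite_std_normal: "pair_sigma_finite std_normal std_normal"
proof -
  interpret N: prob_space std_normal by (rule prob_space_std_normal)
  show ?thesis by unfold_locales
qed

lemma nn_integral_std_normal_swap:
  fixes h :: "real \<Rightarrow> real \<Rightarrow> ennreal"
  assumes [measurable]: "case_prod h \<in> borel_measurable (borel \<Otimes>\<^sub>M borel)"
  shows "(\<integral>\<^sup>+z. \<integral>\<^sup>+x. h x z \<partial>std_normal \<partial>std_normal) = (\<integral>\<^sup>+x. \<integral>\<^sup>+z. h x z \<partial>std_normal \<partial>std_normal)"
proof -
  interpret NN: pair_sigma_finite std_normal std_normal by (rule pair_sigma_finite_std_normal)
  show ?thesis by (rule NN.Fubini') simp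
qed

text \<open>Absorbing one further independent normal variable into a lower triangular pair: the first
  rotation, in the plane of the first and the new variable, removes the new one from the first form,
  the second then merges what is left of it into the diagonal.\<close>

lemma nn_integral_std_normal_absorb:
  fixes a b c u v :: real
  obtains a' c' b' :: real where "a'\<^sup>2 = a\<^sup>2 + u\<^sup>2" "a' * c' = a * c + u * v" "c'\<^sup>2 + b'\<^sup>2 = c\<^sup>2 + b\<^sup>2 + v\<^sup>2" and
    "\<And>G :: real \<Rightarrow> real \<Rightarrow> ennreal. case_prod G \<in> borel_measurable (borel \<Otimes>\<^sub>M borel) \<Longrightarrow>
      (\<integral>\<^sup>+z. \<integral>\<^sup>+x. \<integral>\<^sup>+y. G (a * x + u * z) (c * x + b * y + v * z) \<partial>std_normal \<partial>std_normal \<partial>std_normal) =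
      normal2 (\<lambda>x y. G (a' * x) (c' * x + b' * y))"
proof (cases "a = 0 \<and> u = 0")
  case True
  interpret N: prob_space std_normal by (rule prob_space_std_normal)
  define r where "r = sqrt (c\<^sup>2 + b\<^sup>2)"
  define b' where "b' = sqrt (r\<^sup>2 + v\<^sup>2)"
  have r: "r\<^sup>2 = c\<^sup>2 + b\<^sup>2" "b'\<^sup>2 = r\<^sup>2 + v\<^sup>2" by (auto simp: r_def b'_def)
  show ?thesis
  proof (rule that[of 0 0 b'])
    fix G :: "real \<Rightarrow> real \<Rightarrow> ennreal"
    assume [measurable]: "case_prod G \<in> borel_measurable (borel \<Otimes>\<^sub>M borel)"
    have "(\<integral>\<^sup>+z. \<integral>\<^sup>+x. \<integral>\<^sup>+y. G 0 (c * x + b * y + v * z) \<partial>std_normal \<partial>std_normal \<partial>std_normal) =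
        (\<integral>\<^sup>+z. \<integral>\<^sup>+x. G 0 (r * x + v * z) \<partial>std_normal \<partial>std_normal)"
      using r by (intro nn_integral_cong nn_integral_std_normal_linear[where G="\<lambda>t. G 0 (t + v * z)" for z]) auto
    also have "\<dots> = (\<integral>\<^sup>+x. \<integral>\<^sup>+z. G 0 (r * x + v * z) \<partial>std_normal \<partial>std_normal)"
      by (rule nn_integral_std_normal_swap[where h="\<lambda>x z. G 0 (r * x + v * z)"]) simp
    also have "\<dots> = (\<integral>\<^sup>+x. G 0 (b' * x) \<partial>std_normal)"
      using r by (intro nn_integral_std_normal_linear[where G="G 0"]) auto
    finally show "(\<integral>\<^sup>+z. \<integral>\<^sup>+x. \<integral>\<^sup>+y. G (a * x + u * z) (c * x + b * y + v * z) \<partial>std_normal \<partial>std_normal \<partial>std_normal) =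
      normal2 (\<lambda>x y. G (0 * x) (0 * x + b' * y))"
      using True N.emeasure_space_1 by simp
  qed (use True r in auto)
next
  case False
  interpret N: prob_space std_normal by (rule prob_space_std_normal)
  define r where "r = sqrt (a\<^sup>2 + u\<^sup>2)"
  have r: "r\<^sup>2 = a\<^sup>2 + u\<^sup>2" by (simp add: r_def)
  have r0: "r \<noteq> 0" using False by (auto simp: r_def sum_power2_eq_zero_iff)
  define k l b' where "k = (a * c + u * v) / r" and "l = (a * v - u * c) / r" and "b' = sqrt (b\<^sup>2 + l\<^sup>2)"
  have b': "b'\<^sup>2 = b\<^sup>2 + l\<^sup>2" by (simp add: b'_def)
  have "k\<^sup>2 + l\<^sup>2 = (a\<^sup>2 + u\<^sup>2) * (c\<^sup>2 + v\<^sup>2) / r\<^sup>2"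
    by (simp add: k_def l_def power2_eq_square add_divide_distrib[symmetric]) (simp add: algebra_simps)
  then have kl: "k\<^sup>2 + l\<^sup>2 = c\<^sup>2 + v\<^sup>2" unfolding r[symmetric] using r0 by simp
  show ?thesis
  proof (rule that[of r k b'])
    fix G :: "real \<Rightarrow> real \<Rightarrow> ennreal"
    assume [measurable]: "case_prod G \<in> borel_measurable (borel \<Otimes>\<^sub>M borel)"
    have "(\<integral>\<^sup>+z. \<integral>\<^sup>+x. \<integral>\<^sup>+y. G (a * x + u * z) (c * x + b * y + v * z) \<partial>std_normal \<partial>std_normal \<partial>std_normal) =
        (\<integral>\<^sup>+z. \<integral>\<^sup>+y. \<integral>\<^sup>+x. G (a * x + u * z) (c * x + b * y + v * z) \<partial>std_normal \<partial>std_normal \<partial>std_normal)"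
      by (intro nn_integral_cong nn_integral_std_normal_swap
          [where h="\<lambda>y x. G (a * x + u * z) (c * x + b * y + v * z)" for z]) simp
    also have "\<dots> = (\<integral>\<^sup>+y. \<integral>\<^sup>+z. \<integral>\<^sup>+x. G (a * x + u * z) (c * x + b * y + v * z) \<partial>std_normal \<partial>std_normal \<partial>std_normal)"
      by (rule nn_integral_std_normal_swap[where h="\<lambda>y z. \<integral>\<^sup>+x. G (a * x + u * z) (c * x + b * y + v * z) \<partial>std_normal"]) simp
    also have "\<dots> = (\<integral>\<^sup>+y. \<integral>\<^sup>+x. \<integral>\<^sup>+z. G (a * x + u * z) (c * x + b * y + v * z) \<partial>std_normal \<partial>std_normal \<partial>std_normal)"
      by (intro nn_integral_cong nn_integral_std_normal_swap
          [where h="\<lambda>x z. G (a * x + u * z) (c * x + b * y + v * z)" for y]) simp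
    also have "\<dots> = (\<integral>\<^sup>+y. \<integral>\<^sup>+x. \<integral>\<^sup>+z. G (a * x + u * z) (c * x + v * z + b * y) \<partial>std_normal \<partial>std_normal \<partial>std_normal)"
      by (simp only: add.assoc add.commute[of "v * z" "b * y" for z y])
    also have "\<dots> = (\<integral>\<^sup>+y. \<integral>\<^sup>+x. \<integral>\<^sup>+z. G (r * x) (k * x + l * z + b * y) \<partial>std_normal \<partial>std_normal \<partial>std_normal)"
      unfolding k_def l_def using r r0
      by (intro nn_integral_cong nn_integral_std_normal_rows[where G="\<lambda>s t. G s (t + b * y)" for y]) auto
    also have "\<dots> = normal2 (\<lambda>x y. \<integral>\<^sup>+z. G (r * x) (k * x + l * z + b * y) \<partial>std_normal)"
      by (rule nn_integral_std_normal_swap[where h="\<lambda>x y. \<integral>\<^sup>+z. G (r * x) (k * x + l * z + b * y) \<partial>std_normal"]) simp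
    also have "\<dots> = normal2 (\<lambda>x y. \<integral>\<^sup>+z. G (r * x) (b * y + l * z + k * x) \<partial>std_normal)"
      by (intro nn_integral_cong arg_cong2[where f=G]) auto
    also have "\<dots> = normal2 (\<lambda>x y. G (r * x) (b' * y + k * x))"
      using b' by (intro nn_integral_cong nn_integral_std_normal_linear[where G="\<lambda>t. G (r * x) (t + k * x)" for x]) auto
    finally show "(\<integral>\<^sup>+z. \<integral>\<^sup>+x. \<integral>\<^sup>+y. G (a * x + u * z) (c * x + b * y + v * z) \<partial>std_normal \<partial>std_normal \<partial>std_normal) =
      normal2 (\<lambda>x y. G (r * x) (k * x + b' * y))"
      by (simp add: add.commute)
  next
    show "r * k = a * c + u * v" using r0 by (simp add: k_def)
    show "k\<^sup>2 + b'\<^sup>2 = c\<^sup>2 + b\<^sup>2 + v\<^sup>2" using kl b' by simp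
  qed (rule r)
qed

text \<open>The variables are absorbed one at a time into a lower triangular pair with the same inner products.\<close>

lemma PiM_std_normal_pair:
  fixes u v :: "nat \<Rightarrow> real"
  obtains a c b :: real where "a\<^sup>2 = (\<Sum>i<n. (u i)\<^sup>2)" "a * c = (\<Sum>i<n. u i * v i)" "c\<^sup>2 + b\<^sup>2 = (\<Sum>i<n. (v i)\<^sup>2)" and
    "\<And>G :: real \<Rightarrow> real \<Rightarrow> ennreal. case_prod G \<in> borel_measurable (borel \<Otimes>\<^sub>M borel) \<Longrightarrow>
      (\<integral>\<^sup>+z. G (\<Sum>i<n. u i * z i) (\<Sum>i<n. v i * z i) \<partial>Pi\<^sub>M {..<n} (\<lambda>_. std_normal)) =
      normal2 (\<lambda>x y. G (a * x) (c * x + b * y))"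
proof (induction n arbitrary: thesis)
  case 0
  interpret N: prob_space std_normal by (rule prob_space_std_normal)
  interpret P: product_prob_space "\<lambda>_. std_normal" "{} :: nat set" by unfold_locales
  show ?case
    by (rule "0.prems"[of 0 0 0]) (use N.emeasure_space_1 P.emeasure_space_1 in auto)
next
  case (Suc n)
  interpret N: prob_space std_normal by (rule prob_space_std_normal)
  interpret P: product_prob_space "\<lambda>_. std_normal" "{..<n}" by unfold_locales
  from Suc.IH obtain a c b where IH: "a\<^sup>2 = (\<Sum>i<n. (u i)\<^sup>2)" "a * c = (\<Sum>i<n. u i * v i)" "c\<^sup>2 + b\<^sup>2 = (\<Sum>i<n. (v i)\<^sup>2)"
    "\<And>G :: real \<Rightarrow> real \<Rightarrow> ennreal. case_prod G \<in> borel_measurable (borel \<Otimes>\<^sub>M borel) \<Longrightarrow>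
      (\<integral>\<^sup>+z. G (\<Sum>i<n. u i * z i) (\<Sum>i<n. v i * z i) \<partial>Pi\<^sub>M {..<n} (\<lambda>_. std_normal)) =
      normal2 (\<lambda>x y. G (a * x) (c * x + b * y))"
    by (rule Suc.IH) (rule that, assumption+)
  obtain a' c' b' where S: "a'\<^sup>2 = a\<^sup>2 + (u n)\<^sup>2" "a' * c' = a * c + u n * v n" "c'\<^sup>2 + b'\<^sup>2 = c\<^sup>2 + b\<^sup>2 + (v n)\<^sup>2"
    "\<And>G :: real \<Rightarrow> real \<Rightarrow> ennreal. case_prod G \<in> borel_measurable (borel \<Otimes>\<^sub>M borel) \<Longrightarrow>
      (\<integral>\<^sup>+z. \<integral>\<^sup>+x. \<integral>\<^sup>+y. G (a * x + u n * z) (c * x + b * y + v n * z) \<partial>std_normal \<partial>std_normal \<partial>std_normal) =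
      normal2 (\<lambda>x y. G (a' * x) (c' * x + b' * y))"
    by (rule nn_integral_std_normal_absorb[of a "u n" c "v n" b]) (rule that, assumption+)
  show ?case
  proof (rule Suc.prems[of a' c' b'])
    fix G :: "real \<Rightarrow> real \<Rightarrow> ennreal"
    assume [measurable]: "case_prod G \<in> borel_measurable (borel \<Otimes>\<^sub>M borel)"
    have "(\<integral>\<^sup>+z. G (\<Sum>i<Suc n. u i * z i) (\<Sum>i<Suc n. v i * z i) \<partial>Pi\<^sub>M {..<Suc n} (\<lambda>_. std_normal)) =
       (\<integral>\<^sup>+t. \<integral>\<^sup>+z. G (\<Sum>i<Suc n. u i * (z(n := t)) i) (\<Sum>i<Suc n. v i * (z(n := t)) i)
          \<partial>Pi\<^sub>M {..<n} (\<lambda>_. std_normal) \<partial>std_normal)"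
      unfolding lessThan_Suc by (rule P.product_nn_integral_insert_rev) auto
    also have "\<dots> = (\<integral>\<^sup>+t. \<integral>\<^sup>+z. G ((\<Sum>i<n. u i * z i) + u n * t) ((\<Sum>i<n. v i * z i) + v n * t)
          \<partial>Pi\<^sub>M {..<n} (\<lambda>_. std_normal) \<partial>std_normal)"
      by simp
    also have "\<dots> = (\<integral>\<^sup>+t. \<integral>\<^sup>+x. \<integral>\<^sup>+y. G (a * x + u n * t) (c * x + b * y + v n * t) \<partial>std_normal \<partial>std_normal \<partial>std_normal)"
      by (intro nn_integral_cong IH(4)[of "\<lambda>q s. G (q + u n * t) (s + v n * t)" for t]) simp
    also have "\<dots> = normal2 (\<lambda>x y. G (a' * x) (c' * x + b' * y))"
      by (rule S(4)) simp
    finally show "(\<integral>\<^sup>+z. G (\<Sum>i<Suc n. u i * z i) (\<Sum>i<Suc n. v i * z i) \<partial>Pi\<^sub>M {..<Suc n} (\<lambda>_. std_normal)) =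
      normal2 (\<lambda>x y. G (a' * x) (c' * x + b' * y))" .
  qed (use IH S in auto)
qed

text \<open>The lower triangular representation is unique up to signs, which the symmetry of the normal
  law absorbs. In the degenerate case \<open>A = 0\<close> one has \<open>C = 0\<close>, and the convention \<open>x / 0 = 0\<close> makes
  the right-hand side correct: the second form is then \<open>sqrt B\<close> times a normal variable.\<close>

lemma nn_integral_std_normal_gram:
  fixes G :: "real \<Rightarrow> real \<Rightarrow> ennreal"
  assumes G [measurable]: "case_prod G \<in> borel_measurable (borel \<Otimes>\<^sub>M borel)"
    and gram: "a\<^sup>2 = A" "a * c = C" "c\<^sup>2 + b\<^sup>2 = B"
  shows "normal2 (\<lambda>x y. G (a * x) (c * x + b * y)) =
    normal2 (\<lambda>x y. G (sqrt A * x) (C / sqrt A * x + sqrt (B - (C / sqrt A)\<^sup>2) * y))"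
proof (cases "a = 0")
  case True
  interpret N: prob_space std_normal by (rule prob_space_std_normal)
  have "normal2 (\<lambda>x y. G 0 (c * x + b * y)) = (\<integral>\<^sup>+y. G 0 (sqrt B * y) \<partial>std_normal)"
    using gram by (intro nn_integral_std_normal_linear) auto
  then show ?thesis
    using True gram N.emeasure_space_1 by simp
next
  case False
  interpret N: prob_space std_normal by (rule prob_space_std_normal)
  have flip1: "normal2 (\<lambda>x y. G (- a * x) (- c * x + b * y)) =
      normal2 (\<lambda>x y. G (a * x) (c * x + b * y))" for a c b
  proof -
    have "(\<lambda>x. \<integral>\<^sup>+y. G (a * x) (c * x + b * y) \<partial>std_normal) \<in> borel_measurable borel"
      by (rule N.borel_measurable_nn_integral) measurable
    from nn_integral_std_normal_uminus[OF this] show ?thesis by simp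
  qed
  have flip2: "normal2 (\<lambda>x y. G (a * x) (c * x + - b * y)) =
      normal2 (\<lambda>x y. G (a * x) (c * x + b * y))" for a c b
  proof (rule nn_integral_cong)
    fix x
    have "(\<lambda>y. G (a * x) (c * x + b * y)) \<in> borel_measurable borel"
      by measurable
    from nn_integral_std_normal_uminus[OF this]
    show "(\<integral>\<^sup>+y. G (a * x) (c * x + - b * y) \<partial>std_normal) = (\<integral>\<^sup>+y. G (a * x) (c * x + b * y) \<partial>std_normal)"
      by simp
  qed
  have sA: "sqrt A = \<bar>a\<bar>" using gram(1) by auto
  have C: "C / sqrt A = sgn a * c" unfolding sA gram(2)[symmetric] using False by (auto simp: sgn_if)
  have "(sgn a * c)\<^sup>2 = c\<^sup>2" using False by (auto simp: sgn_if)
  then have b2: "B - (C / sqrt A)\<^sup>2 = b\<^sup>2" unfolding C using gram(3) by simp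
  have b: "sqrt (B - (C / sqrt A)\<^sup>2) = b \<or> sqrt (B - (C / sqrt A)\<^sup>2) = - b" unfolding b2 by auto
  then have "normal2 (\<lambda>x y. G (sqrt A * x) (C / sqrt A * x + sqrt (B - (C / sqrt A)\<^sup>2) * y)) =
      normal2 (\<lambda>x y. G (\<bar>a\<bar> * x) (sgn a * c * x + b * y))"
    using flip2[of "\<bar>a\<bar>" "sgn a * c" b] unfolding C unfolding sA by (elim disjE) (simp_all only:)
  also have "\<dots> = normal2 (\<lambda>x y. G (a * x) (c * x + b * y))"
    using False flip1[of a c b] by (cases "a > 0") auto
  finally show ?thesis ..
qed

text \<open>The centred normal law on the plane with covariance matrix \<open>((A, C), (C, B))\<close>, if this
is positive semidefinite, through its Cholesky factor.\<close>

definition normal_pair :: "real \<Rightarrow> real \<Rightarrow> real \<Rightarrow> (real \<times> real) measure" where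
  "normal_pair A C B = distr (std_normal \<Otimes>\<^sub>M std_normal) (borel \<Otimes>\<^sub>M borel)
     (\<lambda>(x, y). (sqrt A * x, C / sqrt A * x + sqrt (B - (C / sqrt A)\<^sup>2) * y))"

lemma sets_normal_pair [measurable_cong, simp]: "sets (normal_pair A C B) = sets (borel \<Otimes>\<^sub>M borel)"
  by (simp add: normal_pair_def)

lemma prob_space_normal_pair: "prob_space (normal_pair A C B)"
proof -
  interpret N: prob_space std_normal by (rule prob_space_std_normal)
  interpret NN: pair_prob_space std_normal std_normal by unfold_locales
  show ?thesis unfolding normal_pair_def by (rule NN.prob_space_distr) measurable
qed

lemma emeasure_normal_pair:
  assumes [measurable]: "X \<in> sets (borel \<Otimes>\<^sub>M borel)"
  shows "emeasure (normal_pair A C B) X = (\<integral>\<^sup>+x. \<integral>\<^sup>+y.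
    indicator X (sqrt A * x, C / sqrt A * x + sqrt (B - (C / sqrt A)\<^sup>2) * y) \<partial>std_normal \<partial>std_normal)"
proof -
  interpret N: prob_space std_normal by (rule prob_space_std_normal)
  have "emeasure (normal_pair A C B) X = (\<integral>\<^sup>+z. indicator X z \<partial>normal_pair A C B)"
    by (simp)
  also have "\<dots> = (\<integral>\<^sup>+z. indicator X ((\<lambda>(x, y). (sqrt A * x, C / sqrt A * x + sqrt (B - (C / sqrt A)\<^sup>2) * y)) z)
      \<partial>(std_normal \<Otimes>\<^sub>M std_normal))"
    unfolding normal_pair_def by (rule nn_integral_distr) measurable
  also have "\<dots> = (\<integral>\<^sup>+x. \<integral>\<^sup>+y.
    indicator X (sqrt A * x, C / sqrt A * x + sqrt (B - (C / sqrt A)\<^sup>2) * y) \<partial>std_normal \<partial>std_normal)"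
    by (subst N.nn_integral_fst[symmetric]) auto
  finally show ?thesis .
qed

lemma distr_PiM_std_normal_pair:
  fixes u v :: "nat \<Rightarrow> real"
  shows "distr (Pi\<^sub>M {..<n} (\<lambda>_. std_normal)) (borel \<Otimes>\<^sub>M borel) (\<lambda>z. (\<Sum>i<n. u i * z i, \<Sum>i<n. v i * z i)) =
    normal_pair (\<Sum>i<n. (u i)\<^sup>2) (\<Sum>i<n. u i * v i) (\<Sum>i<n. (v i)\<^sup>2)"
    (is "distr ?P ?M ?f = normal_pair ?A ?C ?B")
proof (rule measure_eqI)
  fix X assume "X \<in> sets (distr ?P ?M ?f)"
  then have X [measurable]: "X \<in> sets (borel \<Otimes>\<^sub>M borel)" by simp
  obtain a c b where abc: "a\<^sup>2 = ?A" "a * c = ?C" "c\<^sup>2 + b\<^sup>2 = ?B"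
    "\<And>G :: real \<Rightarrow> real \<Rightarrow> ennreal. case_prod G \<in> borel_measurable (borel \<Otimes>\<^sub>M borel) \<Longrightarrow>
      (\<integral>\<^sup>+z. G (\<Sum>i<n. u i * z i) (\<Sum>i<n. v i * z i) \<partial>?P) =
      normal2 (\<lambda>x y. G (a * x) (c * x + b * y))"
    by (rule PiM_std_normal_pair[of u n v]) (rule that, assumption+)
  define G :: "real \<Rightarrow> real \<Rightarrow> ennreal" where "G q s = indicator X (q, s)" for q s
  have G: "case_prod G \<in> borel_measurable (borel \<Otimes>\<^sub>M borel)"
    unfolding G_def by measurable
  have "emeasure (distr ?P ?M ?f) X = (\<integral>\<^sup>+z. indicator X z \<partial>distr ?P ?M ?f)"
    by simp
  also have "\<dots> = (\<integral>\<^sup>+z. G (\<Sum>i<n. u i * z i) (\<Sum>i<n. v i * z i) \<partial>?P)"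
    unfolding G_def by (rule nn_integral_distr) measurable
  also have "\<dots> = normal2 (\<lambda>x y. G (a * x) (c * x + b * y))"
    by (rule abc(4)[OF G])
  also have "\<dots> = emeasure (normal_pair ?A ?C ?B) X"
    unfolding nn_integral_std_normal_gram[OF G abc(1-3)] by (simp add: emeasure_normal_pair G_def)
  finally show "emeasure (distr ?P ?M ?f) X = emeasure (normal_pair ?A ?C ?B) X" .
qed simp

text \<open>Together with the next lemma this relates the standard normal law on vectors, where the coordinates
are indexed by a type, to an iterated integral.\<close>

lemma nn_integral_lborel_real2:
  fixes f :: "real \<Rightarrow> real \<Rightarrow> ennreal"
  assumes [measurable]: "case_prod f \<in> borel_measurable (borel \<Otimes>\<^sub>M borel)"
  shows "(\<integral>\<^sup>+z. f (z $ 1) (z $ 2) \<partial>(lborel :: (real ^ 2) measure)) = (\<integral>\<^sup>+x. \<integral>\<^sup>+y. f x y \<partial>lborel \<partial>lborel)"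
proof -
  interpret L: product_sigma_finite "\<lambda>_::real ^ 2. lborel :: real measure" by standard
  let ?e1 = "axis 1 1 :: real ^ 2" and ?e2 = "axis 2 1 :: real ^ 2"
  have ne: "?e1 \<noteq> ?e2" by (simp add: axis_eq_axis)
  have B: "(Basis :: (real ^ 2) set) = insert ?e1 {?e2}"
    by (auto simp: Basis_vec_def UNIV_2)
  have comp: "(\<Sum>b\<in>insert ?e1 {?e2}. x b *\<^sub>R b) $ 1 = x ?e1" "(\<Sum>b\<in>insert ?e1 {?e2}. x b *\<^sub>R b) $ 2 = x ?e2" for x
    using ne by (auto simp: axis_def)
  have "(\<integral>\<^sup>+z. f (z $ 1) (z $ 2) \<partial>(lborel :: (real ^ 2) measure)) =
      (\<integral>\<^sup>+x. f ((\<Sum>b\<in>Basis. x b *\<^sub>R b) $ 1) ((\<Sum>b\<in>Basis. x b *\<^sub>R b) $ 2) \<partial>Pi\<^sub>M (Basis :: (real ^ 2) set) (\<lambda>_. lborel))"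
    by (subst lborel_eq, subst nn_integral_distr) auto
  also have "\<dots> = (\<integral>\<^sup>+x. f (x ?e1) (x ?e2) \<partial>Pi\<^sub>M (insert ?e1 {?e2}) (\<lambda>_. lborel))"
    unfolding B comp ..
  also have "\<dots> = (\<integral>\<^sup>+a. \<integral>\<^sup>+x. f ((x(?e1 := a)) ?e1) ((x(?e1 := a)) ?e2) \<partial>Pi\<^sub>M {?e2} (\<lambda>_. lborel) \<partial>lborel)"
    using ne by (intro L.product_nn_integral_insert_rev) auto
  also have "\<dots> = (\<integral>\<^sup>+a. \<integral>\<^sup>+b. f a b \<partial>lborel \<partial>lborel)"
    using ne by (intro nn_integral_cong) (auto intro!: L.product_nn_integral_singleton)
  finally show ?thesis .
qed

lemma nn_integral_std_normal_vector2:
  fixes f :: "real \<Rightarrow> real \<Rightarrow> ennreal"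
  assumes [measurable]: "case_prod f \<in> borel_measurable (borel \<Otimes>\<^sub>M borel)"
  shows "(\<integral>\<^sup>+z. f (z $ 1) (z $ 2) \<partial>(std_normal_vector :: (real ^ 2) measure)) =
    normal2 (\<lambda>x y. f x y)"
proof -
  have "(\<integral>\<^sup>+z. f (z $ 1) (z $ 2) \<partial>(std_normal_vector :: (real ^ 2) measure)) =
     (\<integral>\<^sup>+z. ennreal (std_normal_density (z $ 1) * std_normal_density (z $ 2)) * f (z $ 1) (z $ 2) \<partial>(lborel :: (real ^ 2) measure))"
    unfolding std_normal_vector_def UNIV_2 by (subst nn_integral_density) auto
  also have "\<dots> = (\<integral>\<^sup>+x. \<integral>\<^sup>+y. ennreal (std_normal_density x * std_normal_density y) * f x y \<partial>lborel \<partial>lborel)"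
    by (rule nn_integral_lborel_real2) measurable
  also have "\<dots> = (\<integral>\<^sup>+x. ennreal (std_normal_density x) * (\<integral>\<^sup>+y. ennreal (std_normal_density y) * f x y \<partial>lborel) \<partial>lborel)"
    by (intro nn_integral_cong, subst nn_integral_cmult[symmetric]) (auto simp: ennreal_mult mult.assoc)
  also have "\<dots> = normal2 (\<lambda>x y. f x y)"
    by (simp add: nn_integral_std_normal cong: nn_integral_cong)
  finally show ?thesis .
qed

text \<open>Only \<open>A A\<^sup>T = V\<close> is known of the chosen square root \<open>A\<close>; by rotation it has the same effect as the
Cholesky factor. The hypothesis \<open>le\<close> says that \<open>V\<close> is positive semidefinite, so that a root exists.\<close>

lemma distr_limit_law:
  assumes \<mu>: "0 < \<mu>" and le: "b1\<^sup>2 \<le> b2\<^sup>2"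
  shows "distr (limit_law \<mu> b1 b2) (borel \<Otimes>\<^sub>M borel) (\<lambda>v. (v $ 1 + \<mu>\<^sup>2 / 2, v $ 2 - \<mu>\<^sup>2 / 2 * b1)) =
    normal_pair (\<mu>\<^sup>2) (- \<mu>\<^sup>2 * b1) (\<mu>\<^sup>2 * b2\<^sup>2)"
proof -
  define V :: "real ^ 2 ^ 2" where "V = \<mu>\<^sup>2 *\<^sub>R vector [vector [1, - b1], vector [- b1, b2\<^sup>2]]"
  define m :: "real ^ 2" where "m = - (\<mu>\<^sup>2 / 2) *\<^sub>R vector [1, - b1]"
  define A where "A = (SOME A :: real ^ 2 ^ 2. A ** transpose A = V)"
  let ?w = "\<mu> * sqrt (b2\<^sup>2 - b1\<^sup>2)"
  have "(vector [vector [\<mu>, 0], vector [- \<mu> * b1, ?w]] :: real ^ 2 ^ 2) **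
      transpose (vector [vector [\<mu>, 0], vector [- \<mu> * b1, ?w]]) = V"
    using le by (auto simp: V_def vec_eq_iff forall_2 matrix_matrix_mult_def transpose_def sum_2 vector_2
        power2_eq_square algebra_simps)
  then have "\<exists>A :: real ^ 2 ^ 2. A ** transpose A = V" by blast
  then have AV: "A ** transpose A = V" unfolding A_def by (rule someI_ex)
  have A1: "\<mu>\<^sup>2 = (A $ 1 $ 1)\<^sup>2 + (A $ 1 $ 2)\<^sup>2"
    and A2: "A $ 1 $ 1 * A $ 2 $ 1 + A $ 1 $ 2 * A $ 2 $ 2 = - \<mu>\<^sup>2 * b1"
    and A3: "(A $ 2 $ 1)\<^sup>2 + (A $ 2 $ 2)\<^sup>2 = \<mu>\<^sup>2 * b2\<^sup>2"
    using AV by (auto simp: V_def vec_eq_iff forall_2 matrix_matrix_mult_def transpose_def sum_2 vector_2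
        power2_eq_square)
  have L: "limit_law \<mu> b1 b2 = distr std_normal_vector borel (\<lambda>z. m + A *v z)"
    unfolding limit_law_def normal_vector_def A_def V_def m_def ..
  have mat: "(\<lambda>z. m + A *v z) \<in> borel_measurable borel"
    by (intro borel_measurable_continuous_onI continuous_intros matrix_vector_mult_linear_continuous_on)
  have sets: "sets (std_normal_vector :: (real ^ 2) measure) = sets borel" by (simp add: std_normal_vector_def)
  note [measurable_cong] = sets
  have comp: "(m + A *v z) $ 1 + \<mu>\<^sup>2 / 2 = A $ 1 $ 1 * z $ 1 + A $ 1 $ 2 * z $ 2"
    "(m + A *v z) $ 2 - \<mu>\<^sup>2 / 2 * b1 = A $ 2 $ 1 * z $ 1 + A $ 2 $ 2 * z $ 2" for z
    by (auto simp: m_def matrix_vector_mult_def sum_2 vector_2)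
  have [measurable]: "(\<lambda>v :: real ^ 2. (v $ 1 + \<mu>\<^sup>2 / 2, v $ 2 - \<mu>\<^sup>2 / 2 * b1)) \<in> borel \<rightarrow>\<^sub>M borel \<Otimes>\<^sub>M borel"
    by measurable
  define D where "D = distr (std_normal_vector :: (real ^ 2) measure) (borel \<Otimes>\<^sub>M borel)
       (\<lambda>z. (A $ 1 $ 1 * z $ 1 + A $ 1 $ 2 * z $ 2, A $ 2 $ 1 * z $ 1 + A $ 2 $ 2 * z $ 2))"
  have D: "distr (limit_law \<mu> b1 b2) (borel \<Otimes>\<^sub>M borel) (\<lambda>v. (v $ 1 + \<mu>\<^sup>2 / 2, v $ 2 - \<mu>\<^sup>2 / 2 * b1)) = D"
    unfolding L D_def using mat
    by (subst distr_distr) (auto simp: comp_def comp[simplified] sets cong: measurable_cong_sets)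
  show ?thesis
    unfolding D
  proof (rule measure_eqI)
    fix X assume "X \<in> sets D"
    then have X [measurable]: "X \<in> sets (borel \<Otimes>\<^sub>M borel)" by (simp add: D_def)
    define G :: "real \<Rightarrow> real \<Rightarrow> ennreal" where "G q s = indicator X (q, s)" for q s
    have G [measurable]: "case_prod G \<in> borel_measurable (borel \<Otimes>\<^sub>M borel)"
      unfolding G_def by measurable
    define c e where "c = - \<mu> * b1" and "e = (A $ 1 $ 1 * A $ 2 $ 2 - A $ 1 $ 2 * A $ 2 $ 1) / \<mu>"
    have c: "(A $ 1 $ 1 * A $ 2 $ 1 + A $ 1 $ 2 * A $ 2 $ 2) / \<mu> = c"
      unfolding A2 c_def using \<mu> by (simp add: power2_eq_square)
    have "c\<^sup>2 + e\<^sup>2 = ((A $ 1 $ 1)\<^sup>2 + (A $ 1 $ 2)\<^sup>2) * ((A $ 2 $ 1)\<^sup>2 + (A $ 2 $ 2)\<^sup>2) / \<mu>\<^sup>2"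
      unfolding c[symmetric] e_def
      by (simp add: power_divide add_divide_distrib[symmetric]) (simp add: power2_eq_square algebra_simps)
    also have "\<dots> = \<mu>\<^sup>2 * b2\<^sup>2"
      unfolding A1[symmetric] A3 using \<mu> by (simp add: power2_eq_square)
    finally have ce: "c\<^sup>2 + e\<^sup>2 = \<mu>\<^sup>2 * b2\<^sup>2" .
    have "emeasure D X = (\<integral>\<^sup>+z. indicator X z \<partial>D)"
      by (simp add: D_def)
    also have "\<dots> = (\<integral>\<^sup>+z. G (A $ 1 $ 1 * z $ 1 + A $ 1 $ 2 * z $ 2) (A $ 2 $ 1 * z $ 1 + A $ 2 $ 2 * z $ 2)
        \<partial>(std_normal_vector :: (real ^ 2) measure))"
      unfolding G_def D_def by (rule nn_integral_distr) measurable
    also have "\<dots> = normal2 (\<lambda>x y. G (A $ 1 $ 1 * x + A $ 1 $ 2 * y) (A $ 2 $ 1 * x + A $ 2 $ 2 * y))"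
      by (rule nn_integral_std_normal_vector2) measurable
    also have "\<dots> = normal2 (\<lambda>x y. G (\<mu> * x) (c * x + e * y))"
      unfolding c[symmetric] e_def using A1 \<mu> by (intro nn_integral_std_normal_rows) auto
    also have "\<dots> = emeasure (normal_pair (\<mu>\<^sup>2) (- \<mu>\<^sup>2 * b1) (\<mu>\<^sup>2 * b2\<^sup>2)) X"
    proof -
      have "\<mu> * c = - \<mu>\<^sup>2 * b1" by (simp add: c_def power2_eq_square)
      from nn_integral_std_normal_gram[OF G refl this ce]
      show ?thesis by (simp only: emeasure_normal_pair[OF X]) (simp only: G_def)
    qed
    finally show "emeasure D X = emeasure (normal_pair (\<mu>\<^sup>2) (- \<mu>\<^sup>2 * b1) (\<mu>\<^sup>2 * b2\<^sup>2)) X" .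
  qed (simp add: D_def)
qed

section \<open>Integration by parts and Taylor expansion\<close>

lemma integral_lborel_translate:
  fixes f :: "real \<Rightarrow> real"
  shows "(\<integral>x. f (x + t) \<partial>lborel) = (\<integral>x. f x \<partial>lborel)"
  using lborel_integral_real_affine[of 1 f t] by (simp add: add.commute)

lemma integrable_lborel_translate:
  fixes f :: "real \<Rightarrow> real"
  assumes "integrable lborel f"
  shows "integrable lborel (\<lambda>x. f (x + t))"
  using lborel_integrable_real_affine[OF assms, of 1 t] by (simp add: add.commute)

text \<open>By translation invariance the integral of \<open>g'\<close> equals that
of the average of \<open>g'\<close> over \<open>[x, x + 1]\<close>, which is \<open>g (x + 1) - g x\<close>, and the integral of this
difference vanishes.\<close>

lemma integral_derivative_eq_0:
  fixes g g' :: "real \<Rightarrow> real"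
  assumes deriv: "\<And>x. (g has_real_derivative g' x) (at x)"
    and cont: "continuous_on UNIV g'"
    and g: "integrable lborel g" and g': "integrable lborel g'"
  shows "(\<integral>x. g' x \<partial>lborel) = 0"
proof -
  have [measurable]: "g' \<in> borel_measurable borel"
    using cont by (rule borel_measurable_continuous_onI)
  let ?h = "\<lambda>t x. indicator {0..1} t * g' (x + t) :: real"
  have int: "integrable (lborel \<Otimes>\<^sub>M lborel) (case_prod ?h)"
  proof (rule lborel_pair.Fubini_integrable)
    have "(\<lambda>t. \<integral>x. norm (case (t, x) of (t, x) \<Rightarrow> ?h t x) \<partial>lborel) =
        (\<lambda>t. indicator {0..1} t * (\<integral>x. \<bar>g' x\<bar> \<partial>lborel))"
      using integral_lborel_translate[of "\<lambda>x. \<bar>g' x\<bar>"] by (auto simp: abs_mult)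
    then show "integrable lborel (\<lambda>t. \<integral>x. norm (case (t, x) of (t, x) \<Rightarrow> ?h t x) \<partial>lborel)"
      by simp
    show "AE t in lborel. integrable lborel (\<lambda>x. case (t, x) of (t, x) \<Rightarrow> ?h t x)"
      using integrable_lborel_translate[OF g'] by auto
  qed measurable
  have "(\<integral>x. ?h t x \<partial>lborel) = indicator {0..1} t * (\<integral>x. g' x \<partial>lborel)" for t
    using integral_lborel_translate[of g' t] by simp
  then have "(\<integral>t. \<integral>x. ?h t x \<partial>lborel \<partial>lborel) = (\<integral>t. indicator {0..1::real} t * (\<integral>x. g' x \<partial>lborel) \<partial>lborel)"
    by (simp only:)
  then have "(\<integral>x. g' x \<partial>lborel) = (\<integral>t. \<integral>x. ?h t x \<partial>lborel \<partial>lborel)"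
    by (simp only: integral_mult_left_zero) simp
  also have "\<dots> = (\<integral>x. \<integral>t. ?h t x \<partial>lborel \<partial>lborel)"
    by (rule lborel_pair.Fubini_integral[symmetric, OF int])
  also have "\<dots> = (\<integral>x. g (x + 1) - g x \<partial>lborel)"
  proof (rule Bochner_Integration.integral_cong[OF refl])
    fix x
    have dg: "((\<lambda>t. g (x + t)) has_real_derivative g' (x + t)) (at t)" for t
      using deriv[of "t + x"] by (simp add: DERIV_shift[of g _ t x] add.commute[of x])
    have "has_bochner_integral lborel (\<lambda>t. indicator {0..1} t *\<^sub>R g' (x + t)) (g (x + 1) - g (x + 0))"
    proof (rule has_bochner_integral_FTC_Icc)
      show "((\<lambda>t. g (x + t)) has_vector_derivative g' (x + t)) (at t within {0..1})" for t
        unfolding has_real_derivative_iff_has_vector_derivative[symmetric]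
        using has_field_derivative_at_within[OF dg] .
      show "continuous_on {0..1} (\<lambda>t. g' (x + t))"
        by (intro continuous_on_compose2[OF cont] continuous_intros) auto
    qed auto
    then show "(\<integral>t. ?h t x \<partial>lborel) = g (x + 1) - g x"
      by (simp add: has_bochner_integral_integral_eq)
  qed
  also have "\<dots> = 0"
    using integrable_lborel_translate[OF g, of 1] g integral_lborel_translate[of g 1] by simp
  finally show ?thesis .
qed

lemma thrice_differentiable_derivs:
  assumes "thrice_differentiable f"
  shows "(f has_real_derivative deriv f x) (at x)"
    and "(deriv f has_real_derivative (deriv ^^ 2) f x) (at x)"
    and "((deriv ^^ 2) f has_real_derivative (deriv ^^ 3) f x) (at x)"
proof -
  have *: "(((deriv ^^ k) f) has_real_derivative (deriv ^^ Suc k) f x) (at x)" if "k < 3" for k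
  proof -
    have "(deriv ^^ k) f differentiable (at x)"
      using assms that unfolding thrice_differentiable_def by blast
    then show ?thesis by (simp add: DERIV_deriv_iff_real_differentiable)
  qed
  show "(f has_real_derivative deriv f x) (at x)" using *[of 0] by simp
  show "(deriv f has_real_derivative (deriv ^^ 2) f x) (at x)" using *[of 1] by (simp add: numeral_2_eq_2)
  show "((deriv ^^ 2) f has_real_derivative (deriv ^^ 3) f x) (at x)"
    using *[of 2] by (simp add: numeral_3_eq_3 numeral_2_eq_2)
qed

lemma continuous_on_of_derivative:
  assumes "\<And>x. (f has_real_derivative f' x) (at x)"
  shows "continuous_on A f"
  by (rule DERIV_continuous_on[where D=f'], rule has_field_derivative_at_within, rule assms)

lemma taylor_remainder_le:
  fixes f :: "real \<Rightarrow> real"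
  assumes f: "thrice_differentiable f" and B: "\<And>y. \<bar>(deriv ^^ 3) f y\<bar> \<le> B"
  shows "\<bar>f (x + t) - f x - deriv f x * t - (deriv ^^ 2) f x * t\<^sup>2 / 2\<bar> \<le> B * \<bar>t\<bar> ^ 3 / 6"
proof (cases "t = 0")
  case True then show ?thesis by simp
next
  case False
  have D: "\<forall>m y. m < 3 \<and> x - \<bar>t\<bar> \<le> y \<and> y \<le> x + \<bar>t\<bar> \<longrightarrow> DERIV ((deriv ^^ m) f) y :> (deriv ^^ Suc m) f y"
  proof (intro allI impI)
    fix m :: nat and y assume "m < 3 \<and> x - \<bar>t\<bar> \<le> y \<and> y \<le> x + \<bar>t\<bar>"
    then have "(deriv ^^ m) f differentiable at y"
      using f unfolding thrice_differentiable_def by blast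
    then show "DERIV ((deriv ^^ m) f) y :> (deriv ^^ Suc m) f y"
      by (simp add: DERIV_deriv_iff_real_differentiable)
  qed
  have "\<exists>z. (if x + t < x then x + t < z \<and> z < x else x < z \<and> z < x + t) \<and>
      f (x + t) = (\<Sum>m<3. (deriv ^^ m) f x / fact m * (x + t - x) ^ m) +
      (deriv ^^ 3) f z / fact 3 * (x + t - x) ^ 3"
    by (rule Taylor[where a="x - \<bar>t\<bar>" and b="x + \<bar>t\<bar>"]) (use D False in \<open>auto simp del: funpow.simps\<close>)
  then obtain z where z: "f (x + t) = (\<Sum>m<3. (deriv ^^ m) f x / fact m * (x + t - x) ^ m) +
      (deriv ^^ 3) f z / fact 3 * (x + t - x) ^ 3"
    by blast
  have "(\<Sum>m<3. (deriv ^^ m) f x / fact m * t ^ m) = f x + deriv f x * t + (deriv ^^ 2) f x * t\<^sup>2 / 2"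
    by (simp add: eval_nat_numeral)
  then have "f (x + t) - f x - deriv f x * t - (deriv ^^ 2) f x * t\<^sup>2 / 2 = (deriv ^^ 3) f z / fact 3 * t ^ 3"
    using z by simp
  also have "\<bar>\<dots>\<bar> = \<bar>(deriv ^^ 3) f z\<bar> * \<bar>t\<bar> ^ 3 / 6"
    by (simp add: abs_mult power_abs fact_numeral)
  also have "\<dots> \<le> B * \<bar>t\<bar> ^ 3 / 6"
    using B[of z] by (intro divide_right_mono mult_right_mono) auto
  finally show ?thesis .
qed

text \<open>The derivative is a pointwise limit of jointly measurable difference quotients.\<close>

lemma borel_measurable_partial_deriv:
  fixes S :: "real \<Rightarrow> 'b \<Rightarrow> real"
  assumes S [measurable]: "case_prod S \<in> borel_measurable (borel \<Otimes>\<^sub>M N)"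
    and diff: "\<And>g x. g \<in> space N \<Longrightarrow> (\<lambda>y. S y g) differentiable (at x)"
  shows "(\<lambda>(x, g). deriv (\<lambda>y. S y g) x) \<in> borel_measurable (borel \<Otimes>\<^sub>M N)"
proof (rule borel_measurable_LIMSEQ_real)
  let ?h = "\<lambda>n. 1 / real (Suc n)"
  fix z assume z: "z \<in> space ((borel :: real measure) \<Otimes>\<^sub>M N)"
  obtain x g where xg: "z = (x, g)" "g \<in> space N" using z by (auto simp: space_pair_measure)
  have "((\<lambda>y. S y g) has_real_derivative deriv (\<lambda>y. S y g) x) (at x)"
    using diff[OF xg(2)] by (simp add: DERIV_deriv_iff_real_differentiable)
  then have lim: "(\<lambda>h. (S (x + h) g - S x g) / h) \<midarrow>0\<rightarrow> deriv (\<lambda>y. S y g) x"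
    by (simp add: DERIV_def)
  have "filterlim ?h (at 0) sequentially"
    unfolding filterlim_at using LIMSEQ_inverse_real_of_nat by (auto simp: inverse_eq_divide)
  from filterlim_compose[OF lim this]
  show "(\<lambda>n. (\<lambda>n (x, g). (S (x + ?h n) g - S x g) / ?h n) n z) \<longlonglongrightarrow> (case z of (x, g) \<Rightarrow> deriv (\<lambda>y. S y g) x)"
    by (simp add: xg)
next
  show "(\<lambda>n (x, g). (S (x + 1 / real (Suc n)) g - S x g) / (1 / real (Suc n))) n \<in> borel_measurable (borel \<Otimes>\<^sub>M N)" for n
    by measurable
qed

section \<open>The target density\<close>

locale target =
  fixes \<pi> :: "real \<Rightarrow> real"
  assumes positive: "positive_density \<pi>" and regular: "regular_target \<pi>"
begin

text \<open>The derivative of \<open>l\<close> is the score. The law \<open>D\<close> is that of one coordinate of the stationary chain.\<close>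

definition "l = (\<lambda>x. ln (\<pi> x))"
definition "D = density lborel \<pi>"
abbreviation "I \<equiv> const_I \<pi>"

lemma pos: "0 < \<pi> x" and meas [measurable]: "\<pi> \<in> borel_measurable borel"
  using positive by (auto simp: positive_density_def)

lemma prob_D: "prob_space D"
  unfolding D_def by (rule prob_spaceI)
    (use positive in \<open>simp add: positive_density_def emeasure_density\<close>)

lemma sets_D [simp, measurable_cong]: "sets D = sets borel" and space_D [simp]: "space D = UNIV"
  by (simp_all add: D_def)

sublocale D: prob_space D by (rule prob_D)

lemma thrice_l: "thrice_differentiable l"
  using regular by (simp add: regular_target_def l_def)

lemma l_bounds: obtains B where "\<And>x. \<bar>(deriv ^^ 2) l x\<bar> \<le> B" "\<And>x. \<bar>(deriv ^^ 3) l x\<bar> \<le> B"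
proof -
  from regular obtain B1 B2 where "\<And>x. \<bar>(deriv ^^ 2) l x\<bar> \<le> B1" "\<And>x. \<bar>(deriv ^^ 3) l x\<bar> \<le> B2"
    by (auto simp: regular_target_def l_def bounded_iff)
  then show ?thesis by (intro that[of "max B1 B2"]) (auto intro: le_max_iff_disj[THEN iffD2])
qed

lemmas l_derivs = thrice_differentiable_derivs[OF thrice_l]

lemma \<pi>_eq: "\<pi> x = exp (l x)"
  using pos by (simp add: l_def)

lemma \<pi>_deriv: "(\<pi> has_real_derivative \<pi> x * deriv l x) (at x)"
proof -
  have "((\<lambda>x. exp (l x)) has_real_derivative exp (l x) * deriv l x) (at x)"
    by (intro DERIV_chain2[OF DERIV_exp] l_derivs)
  then show ?thesis by (simp add: \<pi>_eq[symmetric])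
qed

lemma measurable_l [measurable]: "l \<in> borel_measurable borel" "deriv l \<in> borel_measurable borel"
    "(deriv ^^ 2) l \<in> borel_measurable borel"
  using l_derivs[THEN continuous_on_of_derivative] by (auto intro: borel_measurable_continuous_onI)

lemma integrable_D_iff:
  fixes f :: "real \<Rightarrow> real"
  assumes [measurable]: "f \<in> borel_measurable borel"
  shows "integrable D f \<longleftrightarrow> integrable lborel (\<lambda>x. \<pi> x * f x)"
  unfolding D_def using pos by (subst integrable_density) (auto intro!: less_imp_le)

lemma integral_D:
  fixes f :: "real \<Rightarrow> real"
  assumes [measurable]: "f \<in> borel_measurable borel"
  shows "(\<integral>x. f x \<partial>D) = (\<integral>x. \<pi> x * f x \<partial>lborel)"
  unfolding D_def using pos by (subst integral_density) (auto intro!: less_imp_le)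

lemma integrable_D_bounded:
  fixes f :: "real \<Rightarrow> real"
  assumes "f \<in> borel_measurable borel" "\<And>x. \<bar>f x\<bar> \<le> B"
  shows "integrable D f"
  using assms by (intro D.integrable_const_bound[where B=B]) (auto simp: measurable_def)

lemma integrable_score_sq: "integrable D (\<lambda>x. (deriv l x)\<^sup>2)"
  using regular by (simp add: regular_target_def D_def l_def)

lemma integrable_score: "integrable D (deriv l)"
proof (rule Bochner_Integration.integrable_bound)
  show "integrable D (\<lambda>x. (deriv l x)\<^sup>2 + 1)" using integrable_score_sq by simp
  have "\<bar>y\<bar> \<le> y\<^sup>2 + 1" for y :: real
  proof -
    have "0 \<le> (\<bar>y\<bar> - 1)\<^sup>2" by simp
    then show ?thesis by (simp add: power2_diff)
  qed
  then show "AE x in D. norm (deriv l x) \<le> norm ((deriv l x)\<^sup>2 + 1)"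
    by (auto intro!: AE_I2 order_trans[OF _ abs_ge_self])
qed measurable

lemma I_sq: "I\<^sup>2 = (\<integral>x. (deriv l x)\<^sup>2 \<partial>D)"
  by (simp add: const_I_def l_def D_def)

text \<open>Integration by parts against the density, whose logarithmic derivative is the score: no
  boundary terms appear, because a derivative that is integrable along with its primitive has
  integral zero.\<close>

lemma integral_by_parts_score:
  assumes deriv: "\<And>x. (f has_real_derivative f' x) (at x)" and cont: "continuous_on UNIV f'"
    and f: "integrable D f" and f': "integrable D f'" and lf: "integrable D (\<lambda>x. deriv l x * f x)"
  shows "(\<integral>x. deriv l x * f x \<partial>D) = - (\<integral>x. f' x \<partial>D)"
proof -
  have [measurable]: "f \<in> borel_measurable borel" "f' \<in> borel_measurable borel"
    using continuous_on_of_derivative[OF deriv] cont by (auto intro: borel_measurable_continuous_onI)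
  have i: "integrable D (\<lambda>x. deriv l x * f x + f' x)"
    using f' lf by simp
  have "(\<integral>x. deriv l x * f x \<partial>D) + (\<integral>x. f' x \<partial>D) = (\<integral>x. deriv l x * f x + f' x \<partial>D)"
    using f' lf by simp
  also have "\<dots> = (\<integral>x. \<pi> x * (deriv l x * f x + f' x) \<partial>lborel)"
    by (rule integral_D) measurable
  also have "\<dots> = 0"
  proof (rule integral_derivative_eq_0)
    show "((\<lambda>x. \<pi> x * f x) has_real_derivative \<pi> x * (deriv l x * f x + f' x)) (at x)" for x
      by (rule derivative_eq_intros \<pi>_deriv deriv refl)+ (simp add: algebra_simps)
    show "continuous_on UNIV (\<lambda>x. \<pi> x * (deriv l x * f x + f' x))"
      using continuous_on_of_derivative[OF \<pi>_deriv] continuous_on_of_derivative[OF l_derivs(2)]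
        continuous_on_of_derivative[OF deriv] cont by (intro continuous_intros) auto
    show "integrable lborel (\<lambda>x. \<pi> x * f x)" using f by (subst (asm) integrable_D_iff) auto
    show "integrable lborel (\<lambda>x. \<pi> x * (deriv l x * f x + f' x))" using i by (subst (asm) integrable_D_iff) auto
  qed
  finally show ?thesis by simp
qed

lemma integral_l2: "(\<integral>x. (deriv ^^ 2) l x \<partial>D) = - I\<^sup>2"
proof -
  obtain B where B: "\<And>x. \<bar>(deriv ^^ 2) l x\<bar> \<le> B" using l_bounds by metis
  have "(\<integral>x. deriv l x * deriv l x \<partial>D) = - (\<integral>x. (deriv ^^ 2) l x \<partial>D)"
    using integrable_score_sq integrable_score
    by (intro integral_by_parts_score l_derivs continuous_on_of_derivative[OF l_derivs(3)]
        integrable_D_bounded[OF _ B]) (auto simp: power2_eq_square)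
  then show ?thesis unfolding I_sq by (simp add: power2_eq_square)
qed

text \<open>If \<open>I\<close> vanished, the score would be zero almost everywhere and the density constant, which is
impossible on the whole line.\<close>

lemma I_pos: "0 < I"
proof (rule ccontr)
  assume "\<not> 0 < I"
  moreover have "0 \<le> I" by (simp add: const_I_def)
  ultimately have "I = 0" by simp
  then have "AE x in D. (deriv l x)\<^sup>2 = 0"
    using integral_nonneg_eq_0_iff_AE[OF integrable_score_sq] I_sq by simp
  then have ae: "AE x in lborel. deriv l x = 0"
    unfolding D_def using pos by (subst (asm) AE_density) auto
  have const: "\<pi> b = \<pi> a" if "a \<le> b" for a b
  proof -
    have "has_bochner_integral lborel (\<lambda>x. indicator {a..b} x *\<^sub>R (\<pi> x * deriv l x)) (\<pi> b - \<pi> a)"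
    proof (rule has_bochner_integral_FTC_Icc[OF that])
      show "(\<pi> has_vector_derivative \<pi> x * deriv l x) (at x within {a..b})" for x
        using \<pi>_deriv[of x] unfolding has_real_derivative_iff_has_vector_derivative[symmetric]
        by (rule has_field_derivative_at_within)
      show "continuous_on {a..b} (\<lambda>x. \<pi> x * deriv l x)"
        by (intro continuous_intros continuous_on_of_derivative[OF \<pi>_deriv] continuous_on_of_derivative[OF l_derivs(2)])
    qed
    then have "\<pi> b - \<pi> a = (\<integral>x. indicator {a..b} x *\<^sub>R (\<pi> x * deriv l x) \<partial>lborel)"
      by (simp add: has_bochner_integral_integral_eq)
    also have "\<dots> = 0"
      by (rule integral_eq_zero_AE) (use ae in auto)
    finally show ?thesis by simp
  qed
  then have "\<pi> x = \<pi> 0" for x using const[of 0 x] const[of x 0] by linarith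
  then have "(\<integral>\<^sup>+x. ennreal (\<pi> x) \<partial>lborel) = (\<integral>\<^sup>+x. ennreal (\<pi> 0) \<partial>(lborel :: real measure))"
    by (metis (no_types, lifting))
  also have "\<dots> = \<infinity>" using pos[of 0] by (simp add: ennreal_mult_top)
  finally show False using positive by (simp add: positive_density_def)
qed

end

section \<open>One step of a Markov chain\<close>

text \<open>The kernel is represented by a map \<open>\<phi>\<close> applied to the state and independent noise with law \<open>R\<close>. The
Markov property, used only for events that concern the present state, fixes the joint law of two
consecutive states on rectangles, which determine it.\<close>

lemma markov_chain_pair_law:
  assumes chain: "markov_chain E \<nu> K M Y" and R: "prob_space R"
    and phi [measurable]: "case_prod \<phi> \<in> E \<Otimes>\<^sub>M R \<rightarrow>\<^sub>M E"
    and K: "\<And>y. y \<in> space E \<Longrightarrow> K y = distr R E (\<phi> y)"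
  shows "distr M (E \<Otimes>\<^sub>M E) (\<lambda>\<omega>. (Y k \<omega>, Y (Suc k) \<omega>)) =
    distr (distr M E (Y k) \<Otimes>\<^sub>M R) (E \<Otimes>\<^sub>M E) (\<lambda>(y, r). (y, \<phi> y r))" (is "?L = ?R")
proof -
  interpret M: prob_space M using chain by (simp add: markov_chain_def)
  interpret R: prob_space R by (rule R)
  have Y [measurable]: "Y j \<in> M \<rightarrow>\<^sub>M E" for j using chain by (simp add: markov_chain_def)
  interpret Yk: prob_space "distr M E (Y k)" by (rule M.prob_space_distr) simp
  interpret YR: pair_prob_space "distr M E (Y k)" R by unfold_locales
  have step: "emeasure M {\<omega>\<in>space M. Y k \<omega> \<in> A \<and> Y (Suc k) \<omega> \<in> B} =
      (\<integral>\<^sup>+\<omega>. indicator A (Y k \<omega>) * emeasure (K (Y k \<omega>)) B \<partial>M)" if [measurable]: "A \<in> sets E" "B \<in> sets E" for A B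
  proof -
    \<comment> \<open>Membership of the whole past in \<open>A'\<close> constrains its last state only.\<close>
    define A' where "A' = {x \<in> space (\<Pi>\<^sub>M i\<in>{..k}. E). x k \<in> A}"
    have A': "A' \<in> sets (\<Pi>\<^sub>M i\<in>{..k}. E)" unfolding A'_def by measurable
    have iff: "(\<lambda>i\<in>{..k}. Y i \<omega>) \<in> A' \<longleftrightarrow> Y k \<omega> \<in> A" if "\<omega> \<in> space M" for \<omega>
      using measurable_space[OF Y that] by (auto simp: space_PiM A'_def)
    have "{\<omega>\<in>space M. Y k \<omega> \<in> A \<and> Y (Suc k) \<omega> \<in> B} =
        {\<omega>\<in>space M. (\<lambda>i\<in>{..k}. Y i \<omega>) \<in> A' \<and> Y (Suc k) \<omega> \<in> B}"
      using iff by blast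
    also have "emeasure M \<dots> = (\<integral>\<^sup>+\<omega>. indicator A' (\<lambda>i\<in>{..k}. Y i \<omega>) * emeasure (K (Y k \<omega>)) B \<partial>M)"
      using chain A' that unfolding markov_chain_def by blast
    also have "\<dots> = (\<integral>\<^sup>+\<omega>. indicator A (Y k \<omega>) * emeasure (K (Y k \<omega>)) B \<partial>M)"
      by (intro nn_integral_cong) (simp add: indicator_def iff)
    finally show ?thesis .
  qed
  have rect: "emeasure ?L (A \<times> B) = emeasure ?R (A \<times> B)" if [measurable]: "A \<in> sets E" "B \<in> sets E" for A B
  proof -
    have "emeasure ?L (A \<times> B) = emeasure M {\<omega>\<in>space M. Y k \<omega> \<in> A \<and> Y (Suc k) \<omega> \<in> B}"
      by (subst emeasure_distr) (auto intro!: arg_cong[where f="emeasure M"])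
    also have "\<dots> = (\<integral>\<^sup>+\<omega>. indicator A (Y k \<omega>) * emeasure (K (Y k \<omega>)) B \<partial>M)"
      by (rule step) fact+
    also have "\<dots> = (\<integral>\<^sup>+\<omega>. indicator A (Y k \<omega>) * (\<integral>\<^sup>+r. indicator B (\<phi> (Y k \<omega>) r) \<partial>R) \<partial>M)"
    proof (rule nn_integral_cong)
      fix \<omega> assume w: "\<omega> \<in> space M"
      have y: "Y k \<omega> \<in> space E" using measurable_space[OF Y w] .
      have m: "\<phi> (Y k \<omega>) \<in> R \<rightarrow>\<^sub>M E" using measurable_Pair2[OF phi y] by simp
      have "emeasure (K (Y k \<omega>)) B = (\<integral>\<^sup>+z. indicator B z \<partial>distr R E (\<phi> (Y k \<omega>)))"
        using that by (simp add: K[OF y])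
      also have "\<dots> = (\<integral>\<^sup>+r. indicator B (\<phi> (Y k \<omega>) r) \<partial>R)"
        by (rule nn_integral_distr[OF m]) simp
      finally show "indicator A (Y k \<omega>) * emeasure (K (Y k \<omega>)) B = indicator A (Y k \<omega>) * (\<integral>\<^sup>+r. indicator B (\<phi> (Y k \<omega>) r) \<partial>R)"
        by simp
    qed
    also have "\<dots> = (\<integral>\<^sup>+y. indicator A y * (\<integral>\<^sup>+r. indicator B (\<phi> y r) \<partial>R) \<partial>distr M E (Y k))"
      by (rule nn_integral_distr[symmetric]) measurable
    also have "\<dots> = (\<integral>\<^sup>+y. \<integral>\<^sup>+r. indicator A y * indicator B (\<phi> y r) \<partial>R \<partial>distr M E (Y k))"
    proof (rule nn_integral_cong)
      fix y assume "y \<in> space (distr M E (Y k))"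
      then have y: "y \<in> space E" by simp
      have m [measurable]: "\<phi> y \<in> R \<rightarrow>\<^sub>M E" using measurable_Pair2[OF phi y] by simp
      show "indicator A y * (\<integral>\<^sup>+r. indicator B (\<phi> y r) \<partial>R) = (\<integral>\<^sup>+r. indicator A y * indicator B (\<phi> y r) \<partial>R)"
        by (rule nn_integral_cmult[symmetric]) measurable
    qed
    also have "\<dots> = (\<integral>\<^sup>+z. indicator (A \<times> B) ((\<lambda>(y, r). (y, \<phi> y r)) z) \<partial>(distr M E (Y k) \<Otimes>\<^sub>M R))"
      by (subst R.nn_integral_fst[symmetric]) (auto simp: indicator_times)
    also have "\<dots> = (\<integral>\<^sup>+z. indicator (A \<times> B) z \<partial>?R)"
      by (rule nn_integral_distr[symmetric]) measurable
    finally show ?thesis by simp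
  qed
  show ?thesis
  proof (rule measure_eqI_generator_eq[where E="{a \<times> b | a b. a \<in> sets E \<and> b \<in> sets E}" and
        \<Omega>="space E \<times> space E" and A="\<lambda>_. space E \<times> space E"])
    show "Int_stable {a \<times> b | a b. a \<in> sets E \<and> b \<in> sets E}" by (rule Int_stable_pair_measure_generator)
    show "{a \<times> b | a b. a \<in> sets E \<and> b \<in> sets E} \<subseteq> Pow (space E \<times> space E)"
      by (rule pair_measure_closed)
    show "emeasure ?L (space E \<times> space E) \<noteq> \<infinity>" for i :: nat
      using M.emeasure_finite by (subst emeasure_distr) auto
  qed (use rect in \<open>auto simp: sets_pair_measure\<close>)
qed

lemma markov_chain_stationary:
  assumes chain: "markov_chain E \<nu> K M Y" and R: "prob_space R"
    and phi [measurable]: "case_prod \<phi> \<in> E \<Otimes>\<^sub>M R \<rightarrow>\<^sub>M E"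
    and K: "\<And>y. y \<in> space E \<Longrightarrow> K y = distr R E (\<phi> y)"
    and inv: "distr (\<nu> \<Otimes>\<^sub>M R) E (case_prod \<phi>) = \<nu>"
  shows "distr M E (Y k) = \<nu>"
proof (induction k)
  case 0 then show ?case using chain by (simp add: markov_chain_def)
next
  case (Suc k)
  have [measurable]: "Y j \<in> M \<rightarrow>\<^sub>M E" for j using chain by (simp add: markov_chain_def)
  have sets: "sets \<nu> = sets E" using Suc by (metis sets_distr)
  note [measurable_cong] = sets
  have "distr M E (Y (Suc k)) = distr (distr M (E \<Otimes>\<^sub>M E) (\<lambda>\<omega>. (Y k \<omega>, Y (Suc k) \<omega>))) E snd"
    by (subst distr_distr) (auto simp: comp_def)
  also have "\<dots> = distr (\<nu> \<Otimes>\<^sub>M R) E (case_prod \<phi>)"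
    by (subst markov_chain_pair_law[OF chain R phi K], assumption, subst Suc, subst distr_distr)
      (auto simp: comp_def case_prod_beta')
  finally show ?case by (simp add: inv)
qed

lemma integral_markov_chain_pair:
  fixes f :: "'s \<times> 's \<Rightarrow> real"
  assumes chain: "markov_chain E \<nu> K M Y" and R: "prob_space R"
    and phi [measurable]: "case_prod \<phi> \<in> E \<Otimes>\<^sub>M R \<rightarrow>\<^sub>M E"
    and K: "\<And>y. y \<in> space E \<Longrightarrow> K y = distr R E (\<phi> y)"
    and inv: "distr (\<nu> \<Otimes>\<^sub>M R) E (case_prod \<phi>) = \<nu>"
    and f [measurable]: "f \<in> borel_measurable (E \<Otimes>\<^sub>M E)"
  shows "(\<integral>\<omega>. f (Y k \<omega>, Y (Suc k) \<omega>) \<partial>M) = (\<integral>(y, r). f (y, \<phi> y r) \<partial>(\<nu> \<Otimes>\<^sub>M R))"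
proof -
  have [measurable]: "Y j \<in> M \<rightarrow>\<^sub>M E" for j using chain by (simp add: markov_chain_def)
  have st: "distr M E (Y k) = \<nu>" by (rule markov_chain_stationary[OF chain R phi K inv])
  have sets: "sets \<nu> = sets E" using st by (metis sets_distr)
  note [measurable_cong] = sets
  have "(\<integral>\<omega>. f (Y k \<omega>, Y (Suc k) \<omega>) \<partial>M) = (\<integral>z. f z \<partial>distr M (E \<Otimes>\<^sub>M E) (\<lambda>\<omega>. (Y k \<omega>, Y (Suc k) \<omega>)))"
    by (rule integral_distr[symmetric]) measurable
  also have "\<dots> = (\<integral>(y, r). f (y, \<phi> y r) \<partial>(\<nu> \<Otimes>\<^sub>M R))"
    by (subst markov_chain_pair_law[OF chain R phi K], assumption, subst st, subst integral_distr)
      (auto simp: case_prod_beta')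
  finally show ?thesis .
qed

section \<open>Finite products of measures on the line\<close>

lemma PiM_density_lborel:
  fixes f :: "real \<Rightarrow> real" and I :: "nat set"
  assumes [measurable]: "f \<in> borel_measurable borel" and nonneg: "\<And>x. 0 \<le> f x"
    and prob: "prob_space (density lborel f)" and I: "finite I"
  shows "Pi\<^sub>M I (\<lambda>_. density lborel f) = density (Pi\<^sub>M I (\<lambda>_. lborel)) (\<lambda>x. ennreal (\<Prod>i\<in>I. f (x i)))"
proof -
  interpret f: prob_space "density lborel f" by (rule prob)
  interpret P: product_prob_space "\<lambda>_::nat. density lborel f" by unfold_locales
  interpret L: product_sigma_finite "\<lambda>_::nat. lborel :: real measure" by standard
  show ?thesis
  proof (rule P.PiM_eqI[symmetric, OF I])
    have s: "sets (Pi\<^sub>M I (\<lambda>_. density lborel f)) = sets (Pi\<^sub>M I (\<lambda>_. lborel :: real measure))"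
      by (intro sets_PiM_cong) auto
    then show "sets (density (Pi\<^sub>M I (\<lambda>_. lborel)) (\<lambda>x. ennreal (\<Prod>i\<in>I. f (x i)))) = sets (Pi\<^sub>M I (\<lambda>_. density lborel f))"
      by simp
    fix A :: "nat \<Rightarrow> real set" assume A: "\<And>i. i \<in> I \<Longrightarrow> A i \<in> sets (density lborel f)"
    then have A' [measurable]: "i \<in> I \<Longrightarrow> A i \<in> sets borel" for i by simp
    have [measurable]: "Pi\<^sub>E I A \<in> sets (Pi\<^sub>M I (\<lambda>_. lborel))"
      using A' by (intro sets_PiM_I_finite I) auto
    have "emeasure (density (Pi\<^sub>M I (\<lambda>_. lborel)) (\<lambda>x. ennreal (\<Prod>i\<in>I. f (x i)))) (Pi\<^sub>E I A) =
        (\<integral>\<^sup>+x. ennreal (\<Prod>i\<in>I. f (x i)) * indicator (Pi\<^sub>E I A) x \<partial>Pi\<^sub>M I (\<lambda>_. lborel))"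
      by (rule emeasure_density) measurable
    also have "\<dots> = (\<integral>\<^sup>+x. (\<Prod>i\<in>I. ennreal (f (x i)) * indicator (A i) (x i)) \<partial>Pi\<^sub>M I (\<lambda>_. lborel))"
    proof (rule nn_integral_cong)
      fix x :: "nat \<Rightarrow> real" assume x: "x \<in> space (Pi\<^sub>M I (\<lambda>_. lborel))"
      have "indicator (Pi\<^sub>E I A) x = (\<Prod>i\<in>I. indicator (A i) (x i) :: ennreal)"
      proof (cases "x \<in> Pi\<^sub>E I A")
        case True
        then have "(\<Prod>i\<in>I. indicator (A i) (x i) :: ennreal) = 1" by (intro prod.neutral) (auto simp: PiE_iff)
        with True show ?thesis by simp
      next
        case False
        then obtain i where "i \<in> I" "x i \<notin> A i" using x by (auto simp: space_PiM PiE_iff)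
        then have "(\<Prod>i\<in>I. indicator (A i) (x i) :: ennreal) = 0" using I by (intro prod_zero bexI[of _ i]) auto
        with False show ?thesis by simp
      qed
      then show "ennreal (\<Prod>i\<in>I. f (x i)) * indicator (Pi\<^sub>E I A) x = (\<Prod>i\<in>I. ennreal (f (x i)) * indicator (A i) (x i))"
        using nonneg by (simp add: prod.distrib prod_ennreal)
    qed
    also have "\<dots> = (\<Prod>i\<in>I. \<integral>\<^sup>+x. ennreal (f x) * indicator (A i) x \<partial>lborel)"
      using I by (intro L.product_nn_integral_prod) auto
    also have "\<dots> = (\<Prod>i\<in>I. emeasure (density lborel f) (A i))"
      by (intro prod.cong refl, subst emeasure_density) auto
    finally show "emeasure (density (Pi\<^sub>M I (\<lambda>_. lborel)) (\<lambda>x. ennreal (\<Prod>i\<in>I. f (x i)))) (Pi\<^sub>E I A) =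
        (\<Prod>i\<in>I. emeasure (density lborel f) (A i))" .
  qed
qed

text \<open>A map that acts on each coordinate by a measure preserving map preserves the product measure. It is
used for translations of Lebesgue measure and for the reflection of the normal law.\<close>

lemma distr_PiM_componentwise:
  fixes M :: "real measure" and I :: "nat set" and f :: "nat \<Rightarrow> real \<Rightarrow> real"
  assumes sf: "sigma_finite_measure M" and sets: "sets M = sets borel" and I: "finite I"
    and f [measurable]: "\<And>i. f i \<in> borel_measurable borel" and inv: "\<And>i. distr M borel (f i) = M"
  shows "distr (Pi\<^sub>M I (\<lambda>_. M)) (Pi\<^sub>M I (\<lambda>_. borel)) (\<lambda>x. \<lambda>i\<in>I. f i (x i)) = Pi\<^sub>M I (\<lambda>_. M)"
proof -
  interpret M: sigma_finite_measure M by (rule sf)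
  interpret P: product_sigma_finite "\<lambda>_::nat. M" by standard
  note [measurable_cong] = sets
  have space: "space M = UNIV" using sets_eq_imp_space_eq[OF sets] by simp
  show ?thesis
  proof (rule P.PiM_eqI[OF I])
    show "sets (distr (Pi\<^sub>M I (\<lambda>_. M)) (Pi\<^sub>M I (\<lambda>_. borel)) (\<lambda>x. \<lambda>i\<in>I. f i (x i))) = sets (Pi\<^sub>M I (\<lambda>_. M))"
      using sets by (auto intro!: sets_PiM_cong)
    fix A :: "nat \<Rightarrow> real set" assume A: "\<And>i. i \<in> I \<Longrightarrow> A i \<in> sets M"
    then have A' [measurable]: "i \<in> I \<Longrightarrow> A i \<in> sets borel" for i by (simp add: sets)
    have Ps: "Pi\<^sub>E I A \<in> sets (Pi\<^sub>M I (\<lambda>_. borel))"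
      using A' by (intro sets_PiM_I_finite I) auto
    have "emeasure (distr (Pi\<^sub>M I (\<lambda>_. M)) (Pi\<^sub>M I (\<lambda>_. borel)) (\<lambda>x. \<lambda>i\<in>I. f i (x i))) (Pi\<^sub>E I A) =
        emeasure (Pi\<^sub>M I (\<lambda>_. M)) (Pi\<^sub>E I (\<lambda>i. f i -` A i))"
    proof (subst emeasure_distr[OF _ Ps])
      show "(\<lambda>x. \<lambda>i\<in>I. f i (x i)) \<in> Pi\<^sub>M I (\<lambda>_. M) \<rightarrow>\<^sub>M Pi\<^sub>M I (\<lambda>_. borel)" by measurable
      show "emeasure (Pi\<^sub>M I (\<lambda>_. M)) ((\<lambda>x. \<lambda>i\<in>I. f i (x i)) -` Pi\<^sub>E I A \<inter> space (Pi\<^sub>M I (\<lambda>_. M))) =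
        emeasure (Pi\<^sub>M I (\<lambda>_. M)) (Pi\<^sub>E I (\<lambda>i. f i -` A i))"
        by (intro arg_cong[where f="emeasure (Pi\<^sub>M I (\<lambda>_. M))"]) (auto simp: space_PiM space PiE_iff)
    qed
    also have "\<dots> = (\<Prod>i\<in>I. emeasure M (f i -` A i))"
      using A' measurable_sets[OF f, of "A i" i for i] by (intro P.emeasure_PiM I) (simp add: sets)
    also have "\<dots> = (\<Prod>i\<in>I. emeasure M (A i))"
    proof (rule prod.cong[OF refl])
      fix i assume "i \<in> I"
      have "emeasure M (A i) = emeasure (distr M borel (f i)) (A i)" by (simp add: inv)
      also have "\<dots> = emeasure M (f i -` A i)"
        using A'[OF \<open>i \<in> I\<close>] by (subst emeasure_distr) (auto simp: space)
      finally show "emeasure M (f i -` A i) = emeasure M (A i)" ..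
    qed
    finally show "emeasure (distr (Pi\<^sub>M I (\<lambda>_. M)) (Pi\<^sub>M I (\<lambda>_. borel)) (\<lambda>x. \<lambda>i\<in>I. f i (x i))) (Pi\<^sub>E I A) =
       (\<Prod>i\<in>I. emeasure M (A i))" .
  qed
qed

lemma nn_integral_PiM_lborel_translate:
  fixes a :: "nat \<Rightarrow> real" and f :: "(nat \<Rightarrow> real) \<Rightarrow> ennreal"
  assumes I: "finite I" and [measurable]: "f \<in> borel_measurable (Pi\<^sub>M I (\<lambda>_. borel))"
  shows "(\<integral>\<^sup>+x. f (\<lambda>i\<in>I. x i + a i) \<partial>Pi\<^sub>M I (\<lambda>_. lborel)) = (\<integral>\<^sup>+x. f x \<partial>Pi\<^sub>M I (\<lambda>_. lborel))"
proof -
  have "(\<lambda>x. x + a i) = (+) (a i)" for i by (auto simp: fun_eq_iff)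
  then have "distr lborel borel (\<lambda>x. x + a i) = (lborel :: real measure)" for i
    by (simp only: lborel_distr_plus)
  then have "distr (Pi\<^sub>M I (\<lambda>_. lborel)) (Pi\<^sub>M I (\<lambda>_. borel)) (\<lambda>x. \<lambda>i\<in>I. x i + a i) = Pi\<^sub>M I (\<lambda>_. lborel :: real measure)"
    by (intro distr_PiM_componentwise I) (auto intro: sigma_finite_lborel)
  moreover have "(\<integral>\<^sup>+x. f x \<partial>distr (Pi\<^sub>M I (\<lambda>_. lborel)) (Pi\<^sub>M I (\<lambda>_. borel)) (\<lambda>x. \<lambda>i\<in>I. x i + a i)) =
     (\<integral>\<^sup>+x. f (\<lambda>i\<in>I. x i + a i) \<partial>Pi\<^sub>M I (\<lambda>_. lborel))"
    by (rule nn_integral_distr) measurable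
  ultimately show ?thesis by simp
qed

lemma nn_integral_PiM_std_normal_uminus:
  fixes f :: "(nat \<Rightarrow> real) \<Rightarrow> ennreal"
  assumes I: "finite I" and [measurable]: "f \<in> borel_measurable (Pi\<^sub>M I (\<lambda>_. borel))"
  shows "(\<integral>\<^sup>+z. f (\<lambda>i\<in>I. - z i) \<partial>Pi\<^sub>M I (\<lambda>_. std_normal)) = (\<integral>\<^sup>+z. f z \<partial>Pi\<^sub>M I (\<lambda>_. std_normal))"
proof -
  interpret N: prob_space std_normal by (rule prob_space_std_normal)
  have "distr std_normal borel uminus = std_normal"
  proof (rule measure_eqI)
    fix A assume "A \<in> sets (distr std_normal borel uminus)"
    then have [measurable]: "A \<in> sets borel" by simp
    have "emeasure (distr std_normal borel uminus) A = (\<integral>\<^sup>+x. indicator A x \<partial>distr std_normal borel uminus)"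
      by simp
    also have "\<dots> = (\<integral>\<^sup>+x. indicator A (- x) \<partial>std_normal)"
      by (rule nn_integral_distr) measurable
    also have "\<dots> = (\<integral>\<^sup>+x. indicator A x \<partial>std_normal)"
      by (rule nn_integral_std_normal_uminus) measurable
    finally show "emeasure (distr std_normal borel uminus) A = emeasure std_normal A" by simp
  qed simp
  then have "distr (Pi\<^sub>M I (\<lambda>_. std_normal)) (Pi\<^sub>M I (\<lambda>_. borel)) (\<lambda>x. \<lambda>i\<in>I. - x i) = Pi\<^sub>M I (\<lambda>_. std_normal)"
    by (intro distr_PiM_componentwise I) (auto intro: N.sigma_finite_measure_axioms)
  moreover have "(\<integral>\<^sup>+x. f x \<partial>distr (Pi\<^sub>M I (\<lambda>_. std_normal)) (Pi\<^sub>M I (\<lambda>_. borel)) (\<lambda>x. \<lambda>i\<in>I. - x i)) =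
     (\<integral>\<^sup>+x. f (\<lambda>i\<in>I. - x i) \<partial>Pi\<^sub>M I (\<lambda>_. std_normal))"
    by (rule nn_integral_distr) measurable
  ultimately show ?thesis by simp
qed

section \<open>The chain at stationarity\<close>

lemma F_le_1: "F u \<le> 1" and F_nonneg: "0 \<le> F u"
  by (auto simp: F_def)

lemma F_measurable [measurable]: "F \<in> borel_measurable borel"
  unfolding F_def by measurable

lemma prob_space_uniform01: "prob_space uniform01"
  unfolding uniform01_def by (rule prob_space_restrict_space) auto

lemma sets_uniform01: "sets uniform01 = sets (restrict_space borel {0..1})"
  by (simp add: uniform01_def sets_restrict_space)

lemma measurable_uniform01_borel: "f \<in> M \<rightarrow>\<^sub>M uniform01 \<Longrightarrow> f \<in> borel_measurable M"
  unfolding uniform01_def by (simp add: measurable_restrict_space2_iff)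

lemma nn_integral_uniform01_if:
  fixes A B :: ennreal
  assumes a: "0 \<le> a" "a \<le> 1"
  shows "(\<integral>\<^sup>+u. (if u \<le> a then A else B) \<partial>uniform01) = ennreal a * A + ennreal (1 - a) * B"
proof -
  have sp: "space uniform01 = {0..1}" by (simp add: uniform01_def space_restrict_space)
  have 1: "emeasure uniform01 {0..a} = ennreal a"
    unfolding uniform01_def using a by (subst emeasure_restrict_space) auto
  have 2: "emeasure uniform01 {a<..1} = ennreal (1 - a)"
    unfolding uniform01_def using a by (subst emeasure_restrict_space) auto
  have s: "{0..a} \<in> sets uniform01" "{a<..1} \<in> sets uniform01"
    using a by (auto simp: sets_uniform01 sets_restrict_space_iff)
  have "(\<integral>\<^sup>+u. (if u \<le> a then A else B) \<partial>uniform01) =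
      (\<integral>\<^sup>+u. A * indicator {0..a} u + B * indicator {a<..1} u \<partial>uniform01)"
    by (intro nn_integral_cong) (auto simp: sp)
  also have "\<dots> = A * ennreal a + B * ennreal (1 - a)"
    using s by (subst nn_integral_add) (auto simp: nn_integral_cmult_indicator 1 2)
  finally show ?thesis by (simp add: mult.commute)
qed

text \<open>Detailed balance and the formula for the jumping distance hold for any error that is measurable in its
first argument; smoothness enters with the limit.\<close>

locale dapsmrwm = target \<pi> for \<pi> :: "real \<Rightarrow> real" +
  fixes S :: "real \<Rightarrow> real \<Rightarrow> real" and p :: "real \<Rightarrow> real" and \<mu> :: real and \<gamma> :: "nat \<Rightarrow> real"
  assumes noise: "noise_density p"
    and S_meas [measurable]: "\<And>i. (\<lambda>x. S x (\<gamma> i)) \<in> borel_measurable borel"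
    and \<mu>_pos: "0 < \<mu>"
begin

text \<open>The state and the normal increment have the laws \<open>PX d\<close> and \<open>PZ d\<close>, and \<open>PL d\<close> is the reference measure for
densities; the measurable structure of all three is that of \<open>PB d\<close>. The noise has law \<open>W1\<close> at a proposal and
\<open>W2\<close> at stationarity.\<close>

abbreviation PX :: "nat \<Rightarrow> (nat \<Rightarrow> real) measure" where "PX d \<equiv> Pi\<^sub>M {..<d} (\<lambda>_. D)"
abbreviation PZ :: "nat \<Rightarrow> (nat \<Rightarrow> real) measure" where "PZ d \<equiv> Pi\<^sub>M {..<d} (\<lambda>_. std_normal)"
abbreviation PL :: "nat \<Rightarrow> (nat \<Rightarrow> real) measure" where "PL d \<equiv> Pi\<^sub>M {..<d} (\<lambda>_. lborel :: real measure)"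
abbreviation PB :: "nat \<Rightarrow> (nat \<Rightarrow> real) measure" where "PB d \<equiv> Pi\<^sub>M {..<d} (\<lambda>_. borel :: real measure)"
abbreviation PB4 :: "nat \<Rightarrow> ((nat \<Rightarrow> real) \<times> real \<times> (nat \<Rightarrow> real) \<times> real) measure" where
  "PB4 d \<equiv> PB d \<Otimes>\<^sub>M borel \<Otimes>\<^sub>M PB d \<Otimes>\<^sub>M borel"
definition "W1 = density lborel p"
definition "W2 = density lborel (stationary_noise_density p)"

abbreviation "PXZ d \<equiv> PX d \<Otimes>\<^sub>M PZ d"

text \<open>The order of integration follows the chain: current state and noise, then normal increment and noise at
the proposal.\<close>

abbreviation chain_integral ::
  "nat \<Rightarrow> ((nat \<Rightarrow> real) \<Rightarrow> real \<Rightarrow> (nat \<Rightarrow> real) \<Rightarrow> real \<Rightarrow> ennreal) \<Rightarrow> ennreal" where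
  "chain_integral d f \<equiv> \<integral>\<^sup>+x. \<integral>\<^sup>+w. \<integral>\<^sup>+z. \<integral>\<^sup>+w'. f x w z w' \<partial>W1 \<partial>PZ d \<partial>W2 \<partial>PX d"

abbreviation "prop d \<equiv> proposal \<pi> \<mu> d"
abbreviation "acc d \<equiv> acceptance_prob \<pi> S \<gamma> d"

definition step :: "nat \<Rightarrow> (nat \<Rightarrow> real) \<times> real \<Rightarrow> (nat \<Rightarrow> real) \<times> real \<times> real \<Rightarrow> (nat \<Rightarrow> real) \<times> real" where
  "step d = (\<lambda>(x, w) (z, w', u).
    if u \<le> acc d (x, w) (prop d x z, w') then (prop d x z, w') else (x, w))"

definition Noise :: "nat \<Rightarrow> ((nat \<Rightarrow> real) \<times> real \<times> real) measure" where
  "Noise d = PZ d \<Otimes>\<^sub>M W1 \<Otimes>\<^sub>M uniform01"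

lemma p_meas [measurable]: "p \<in> borel_measurable borel" and p_nonneg: "0 \<le> p w"
  using noise by (auto simp: noise_density_def)

lemma sets_W [simp, measurable_cong]: "sets W1 = sets borel" "sets W2 = sets borel"
  by (simp_all add: W1_def W2_def)

lemma stationary_noise_meas [measurable]: "stationary_noise_density p \<in> borel_measurable borel"
  unfolding stationary_noise_density_def[abs_def] by measurable

lemma prob_W1: "prob_space W1"
  unfolding W1_def by (rule prob_spaceI) (use noise in \<open>simp add: noise_density_def emeasure_density\<close>)

lemma prob_W2: "prob_space W2"
  unfolding W2_def by (rule prob_spaceI)
    (use noise in \<open>simp add: noise_density_def emeasure_density stationary_noise_density_def\<close>)

sublocale W1: prob_space W1 by (rule prob_W1)
sublocale W2: prob_space W2 by (rule prob_W2)
sublocale N: prob_space std_normal by (rule prob_space_std_normal)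
sublocale U: prob_space uniform01 by (rule prob_space_uniform01)

lemma prob_PX: "prob_space (PX d)" by (intro prob_space_PiM D.prob_space_axioms)
lemma prob_PZ: "prob_space (PZ d)" by (intro prob_space_PiM N.prob_space_axioms)

lemma sets_PX [simp, measurable_cong]: "sets (PX d) = sets (PB d)" by (intro sets_PiM_cong) auto
lemma sets_PZ [simp, measurable_cong]: "sets (PZ d) = sets (PB d)" by (intro sets_PiM_cong) auto
lemma sets_PL [simp, measurable_cong]: "sets (PL d) = sets (PB d)" by (intro sets_PiM_cong) auto

lemma sigma_finite_PL: "sigma_finite_measure (PL d)"
proof -
  interpret L: product_sigma_finite "\<lambda>_::nat. lborel :: real measure" by standard
  interpret L: finite_product_sigma_finite "\<lambda>_::nat. lborel :: real measure" "{..<d}" by standard simp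
  show ?thesis by (rule L.sigma_finite_measure_axioms)
qed

lemma nn_integral_W2:
  assumes [measurable]: "f \<in> borel_measurable borel"
  shows "(\<integral>\<^sup>+w. f w \<partial>W2) = (\<integral>\<^sup>+w. ennreal (exp w) * f w \<partial>W1)"
  unfolding W1_def W2_def
  by (simp add: nn_integral_density stationary_noise_density_def ennreal_mult' p_nonneg mult_ac)

lemma nn_integral_PX:
  assumes [measurable]: "f \<in> borel_measurable (PB d)"
  shows "(\<integral>\<^sup>+x. f x \<partial>PX d) = (\<integral>\<^sup>+x. ennreal (\<Prod>i<d. \<pi> (x i)) * f x \<partial>PL d)"
proof -
  have "PX d = density (PL d) (\<lambda>x. ennreal (\<Prod>i<d. \<pi> (x i)))"
    using PiM_density_lborel[OF meas less_imp_le[OF pos] prob_D[unfolded D_def]] by (simp add: D_def)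
  then show ?thesis by (simp add: nn_integral_density cong: measurable_cong_sets)
qed

lemma proposal_measurable [measurable (raw)]:
  assumes [measurable]: "f \<in> N \<rightarrow>\<^sub>M PB d" "g \<in> N \<rightarrow>\<^sub>M PB d"
  shows "(\<lambda>y. prop d (f y) (g y)) \<in> N \<rightarrow>\<^sub>M PB d"
  unfolding proposal_def by measurable

lemma component_measurable:
  assumes "f \<in> N \<rightarrow>\<^sub>M PB d" "i < d"
  shows "(\<lambda>y. f y i) \<in> borel_measurable N"
  using measurable_compose[OF assms(1) measurable_component_singleton[of i]] assms(2) by simp

lemma q_Delta_measurable [measurable (raw)]:
  assumes [measurable]: "f \<in> N \<rightarrow>\<^sub>M PB d" "g \<in> N \<rightarrow>\<^sub>M PB d"
  shows "(\<lambda>y. q_Delta \<pi> d (f y) (g y)) \<in> borel_measurable N"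
proof -
  have "(\<lambda>y. \<Prod>i<d. \<pi> (h y i)) \<in> borel_measurable N" if "h \<in> N \<rightarrow>\<^sub>M PB d" for h
    using that by (intro borel_measurable_prod measurable_compose[OF component_measurable meas]) auto
  then show ?thesis unfolding q_Delta_def by measurable
qed

lemma s_Delta_measurable [measurable (raw)]:
  assumes "f \<in> N \<rightarrow>\<^sub>M PB d" "g \<in> N \<rightarrow>\<^sub>M PB d"
  shows "(\<lambda>y. s_Delta S \<gamma> d (f y) (g y)) \<in> borel_measurable N"
  unfolding s_Delta_def using assms
  by (intro borel_measurable_diff borel_measurable_sum measurable_compose[OF component_measurable S_meas]) auto

lemma acc_measurable [measurable (raw)]:
  assumes "f \<in> N \<rightarrow>\<^sub>M state_space d" "g \<in> N \<rightarrow>\<^sub>M state_space d"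
  shows "(\<lambda>y. acc d (f y) (g y)) \<in> borel_measurable N"
proof -
  note [measurable] = assms[unfolded state_space_def]
  show ?thesis unfolding acceptance_prob_def case_prod_beta by measurable
qed

lemma acc_bounds: "0 \<le> acc d y y'" "acc d y y' \<le> 1"
  unfolding acceptance_prob_def by (auto simp: case_prod_beta F_nonneg F_le_1 intro: mult_le_one)

lemma sets_Noise [measurable_cong]: "sets (Noise d) = sets (PB d \<Otimes>\<^sub>M borel \<Otimes>\<^sub>M uniform01)"
  unfolding Noise_def by (intro sets_pair_measure_cong) auto

lemma prob_Noise: "prob_space (Noise d)"
proof -
  interpret Z: prob_space "PZ d" by (rule prob_PZ)
  interpret WU: pair_prob_space W1 uniform01 by unfold_locales
  interpret pair_prob_space "PZ d" "W1 \<Otimes>\<^sub>M uniform01" by unfold_locales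
  show ?thesis unfolding Noise_def by unfold_locales
qed

lemma step_measurable [measurable]:
  "case_prod (step d) \<in> state_space d \<Otimes>\<^sub>M Noise d \<rightarrow>\<^sub>M state_space d"
proof -
  let ?N = "state_space d \<Otimes>\<^sub>M Noise d"
  have [measurable]: "(\<lambda>y. fst (fst y)) \<in> ?N \<rightarrow>\<^sub>M PB d" "(\<lambda>y. snd (fst y)) \<in> borel_measurable ?N"
    "(\<lambda>y. fst (snd y)) \<in> ?N \<rightarrow>\<^sub>M PB d" "(\<lambda>y. fst (snd (snd y))) \<in> borel_measurable ?N"
    and u: "(\<lambda>y. snd (snd (snd y))) \<in> ?N \<rightarrow>\<^sub>M uniform01"
    unfolding state_space_def by measurable
  note [measurable] = measurable_uniform01_borel[OF u]
  have [measurable]: "(\<lambda>y. (fst (fst y), snd (fst y))) \<in> ?N \<rightarrow>\<^sub>M state_space d"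
    "(\<lambda>y. (prop d (fst (fst y)) (fst (snd y)), fst (snd (snd y)))) \<in> ?N \<rightarrow>\<^sub>M state_space d"
    unfolding state_space_def by measurable
  show ?thesis
    unfolding step_def case_prod_beta by measurable
qed

lemma kernel_eq: "dapsmrwm_kernel \<pi> S p \<mu> \<gamma> d y = distr (Noise d) (state_space d) (step d y)"
  unfolding dapsmrwm_kernel_def Noise_def step_def W1_def by (cases y) (simp add: Let_def)

lemma stationary_law_eq: "stationary_law \<pi> p d = PX d \<Otimes>\<^sub>M W2"
  by (simp add: stationary_law_def D_def W2_def)

lemma sets_stationary [measurable_cong]: "sets (stationary_law \<pi> p d) = sets (state_space d)"
  unfolding stationary_law_eq state_space_def by (intro sets_pair_measure_cong) auto

text \<open>The uniform variable is integrated out: a step is a move with the acceptance probability, and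
otherwise a stay.\<close>

lemma nn_integral_step:
  fixes f :: "((nat \<Rightarrow> real) \<times> real) \<times> ((nat \<Rightarrow> real) \<times> real) \<Rightarrow> ennreal"
  assumes f [measurable]: "f \<in> borel_measurable (state_space d \<Otimes>\<^sub>M state_space d)"
  shows "(\<integral>\<^sup>+(y, r). f (y, step d y r) \<partial>(stationary_law \<pi> p d \<Otimes>\<^sub>M Noise d)) =
    (\<integral>\<^sup>+x. \<integral>\<^sup>+w. \<integral>\<^sup>+z. \<integral>\<^sup>+w'.
      (ennreal (acc d (x, w) (prop d x z, w')) * f ((x, w), (prop d x z, w')) +
       ennreal (1 - acc d (x, w) (prop d x z, w')) * f ((x, w), (x, w))) \<partial>W1 \<partial>PZ d \<partial>W2 \<partial>PX d)"
proof -
  interpret Z: prob_space "PZ d" by (rule prob_PZ)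
  interpret R: prob_space "Noise d" by (rule prob_Noise)
  interpret WU: pair_prob_space W1 uniform01 by unfold_locales
  have m: "(\<lambda>y. \<integral>\<^sup>+r. f (y, step d y r) \<partial>Noise d) \<in> borel_measurable (state_space d)"
    by measurable
  have "(\<integral>\<^sup>+(y, r). f (y, step d y r) \<partial>(stationary_law \<pi> p d \<Otimes>\<^sub>M Noise d)) =
      (\<integral>\<^sup>+y. \<integral>\<^sup>+r. f (y, step d y r) \<partial>Noise d \<partial>stationary_law \<pi> p d)"
    by (subst R.nn_integral_fst[symmetric]) auto
  also have "\<dots> = (\<integral>\<^sup>+x. \<integral>\<^sup>+w. \<integral>\<^sup>+r. f ((x, w), step d (x, w) r) \<partial>Noise d \<partial>W2 \<partial>PX d)"
    unfolding stationary_law_eq using m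
    by (subst W2.nn_integral_fst[symmetric]) (auto simp: state_space_def cong: measurable_cong_sets)
  also have "\<dots> = (\<integral>\<^sup>+x. \<integral>\<^sup>+w. \<integral>\<^sup>+z. \<integral>\<^sup>+w'.
      (ennreal (acc d (x, w) (prop d x z, w')) * f ((x, w), (prop d x z, w')) +
       ennreal (1 - acc d (x, w) (prop d x z, w')) * f ((x, w), (x, w))) \<partial>W1 \<partial>PZ d \<partial>W2 \<partial>PX d)"
  proof (intro nn_integral_cong)
    fix x w assume x: "x \<in> space (PX d)"
    then have xw: "(x, w) \<in> space (state_space d)"
      using sets_eq_imp_space_eq[OF sets_PX] by (auto simp: state_space_def space_pair_measure)
    have st: "step d (x, w) \<in> Noise d \<rightarrow>\<^sub>M state_space d"
      using measurable_Pair2[OF step_measurable xw] by simp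
    have m: "(\<lambda>r. f ((x, w), step d (x, w) r)) \<in> borel_measurable (PZ d \<Otimes>\<^sub>M W1 \<Otimes>\<^sub>M uniform01)"
      using st xw unfolding Noise_def[symmetric] by measurable
    have "(\<integral>\<^sup>+r. f ((x, w), step d (x, w) r) \<partial>Noise d) =
        (\<integral>\<^sup>+z. \<integral>\<^sup>+(w', u). f ((x, w), step d (x, w) (z, w', u)) \<partial>(W1 \<Otimes>\<^sub>M uniform01) \<partial>PZ d)"
      unfolding Noise_def using m by (subst WU.nn_integral_fst[symmetric]) (auto simp: case_prod_beta')
    also have "\<dots> = (\<integral>\<^sup>+z. \<integral>\<^sup>+w'. \<integral>\<^sup>+u. f ((x, w), step d (x, w) (z, w', u)) \<partial>uniform01 \<partial>W1 \<partial>PZ d)"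
    proof (intro nn_integral_cong)
      fix z assume "z \<in> space (PZ d)"
      then have "(\<lambda>r. f ((x, w), step d (x, w) (z, r))) \<in> borel_measurable (W1 \<Otimes>\<^sub>M uniform01)"
        using measurable_Pair2[OF m] by simp
      then show "(\<integral>\<^sup>+(w', u). f ((x, w), step d (x, w) (z, w', u)) \<partial>(W1 \<Otimes>\<^sub>M uniform01)) =
        (\<integral>\<^sup>+w'. \<integral>\<^sup>+u. f ((x, w), step d (x, w) (z, w', u)) \<partial>uniform01 \<partial>W1)"
        by (subst U.nn_integral_fst[symmetric]) (auto simp: case_prod_beta')
    qed
    also have "\<dots> = (\<integral>\<^sup>+z. \<integral>\<^sup>+w'.
      (ennreal (acc d (x, w) (prop d x z, w')) * f ((x, w), (prop d x z, w')) +
       ennreal (1 - acc d (x, w) (prop d x z, w')) * f ((x, w), (x, w))) \<partial>W1 \<partial>PZ d)"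
      by (intro nn_integral_cong, subst nn_integral_uniform01_if[symmetric, OF acc_bounds])
        (auto simp: step_def intro!: nn_integral_cong)
    finally show "(\<integral>\<^sup>+r. f ((x, w), step d (x, w) r) \<partial>Noise d) = (\<integral>\<^sup>+z. \<integral>\<^sup>+w'.
      (ennreal (acc d (x, w) (prop d x z, w')) * f ((x, w), (prop d x z, w')) +
       ennreal (1 - acc d (x, w) (prop d x z, w')) * f ((x, w), (x, w))) \<partial>W1 \<partial>PZ d)" .
  qed
  finally show ?thesis .
qed

lemma exp_F: "0 < a \<Longrightarrow> a * F u = min a (a * exp u)"
  by (simp add: F_def min_mult_distrib_left)

text \<open>Both stages of the acceptance probability become minima when multiplied by \<open>\<pi>\<close> and \<open>exp w\<close>. Reversing a
move changes the first minimum by the factor \<open>exp (- s)\<close> and the second by \<open>exp s\<close>.\<close>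

lemma acceptance_balance:
  "(\<Prod>i<d. \<pi> (x i)) * exp w * acc d (x, w) (x', w') = (\<Prod>i<d. \<pi> (x' i)) * exp w' * acc d (x', w') (x, w)"
proof -
  define P P' s where "P = (\<Prod>i<d. \<pi> (x i))" and "P' = (\<Prod>i<d. \<pi> (x' i))" and "s = s_Delta S \<gamma> d x x'"
  have P: "0 < P" "0 < P'" by (auto simp: P_def P'_def pos intro!: prod_pos)
  have s': "s_Delta S \<gamma> d x' x = - s" by (simp add: s_def s_Delta_def)
  have q: "q_Delta \<pi> d x x' = ln (P' / P)" "q_Delta \<pi> d x' x = ln (P / P')"
    by (simp_all add: q_Delta_def P_def P'_def)
  have e: "exp (ln (P' / P)) = P' / P" "exp (ln (P / P')) = P / P'" using P by auto
  have 1: "P * F (ln (P' / P) + s) = min P (P' * exp s)"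
    using P by (simp add: exp_F exp_add e)
  have 2: "exp w * F (w' - w - s) = min (exp w) (exp (w' - s))"
    by (simp add: exp_F exp_add[symmetric])
  have 3: "P' * F (ln (P / P') + - s) = min P' (P * exp (- s))"
    using P by (simp add: exp_F exp_diff e) (simp add: exp_minus divide_inverse)
  have 4: "exp w' * F (w - w' - - s) = min (exp w') (exp (w + s))"
    by (simp add: exp_F exp_add[symmetric])
  have 5: "min P (P' * exp s) = exp s * min P' (P * exp (- s))"
    using P by (simp add: min_mult_distrib_left exp_minus mult_ac min.commute)
  have 6: "exp s * min (exp w) (exp (w' - s)) = min (exp w') (exp (w + s))"
    by (simp add: min_mult_distrib_left exp_add[symmetric] min.commute add.commute)
  have "P * exp w * (F (ln (P' / P) + s) * F (w' - w - s)) =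
      (P * F (ln (P' / P) + s)) * (exp w * F (w' - w - s))"
    by (simp only: mult_ac)
  also have "\<dots> = min P' (P * exp (- s)) * (exp s * min (exp w) (exp (w' - s)))"
    unfolding 1 2 5 by (simp only: mult_ac)
  also have "\<dots> = P' * exp w' * (F (ln (P / P') + - s) * F (w - w' - - s))"
    unfolding 6 3[symmetric] 4[symmetric] by (simp only: mult_ac)
  finally show ?thesis
    unfolding acceptance_prob_def by (simp add: q s' flip: P_def P'_def s_def)
qed


text \<open>The substitution \<open>x \<mapsto> x - h z\<close> followed by the reflection \<open>z \<mapsto> - z\<close> exchanges a point and its proposal.\<close>

lemma proposal_reversal:
  fixes k :: "(nat \<Rightarrow> real) \<Rightarrow> (nat \<Rightarrow> real) \<Rightarrow> ennreal"
  assumes k: "case_prod k \<in> borel_measurable (PB d \<Otimes>\<^sub>M PB d)"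
  shows "(\<integral>\<^sup>+z. \<integral>\<^sup>+x. k x (prop d x z) \<partial>PL d \<partial>PZ d) = (\<integral>\<^sup>+z. \<integral>\<^sup>+x. k (prop d x z) x \<partial>PL d \<partial>PZ d)"
proof -
  interpret L: sigma_finite_measure "PL d" by (rule sigma_finite_PL)
  have km' [measurable (raw)]: "(\<lambda>y. k (f y) (g y)) \<in> borel_measurable N"
    if "f \<in> N \<rightarrow>\<^sub>M PB d" "g \<in> N \<rightarrow>\<^sub>M PB d" for f g and N :: "(nat \<Rightarrow> real) measure"
    using measurable_compose[OF measurable_Pair[OF that] k] by simp
  have km'' [measurable (raw)]: "(\<lambda>y. k (f y) (g y)) \<in> borel_measurable N"
    if "f \<in> N \<rightarrow>\<^sub>M PB d" "g \<in> N \<rightarrow>\<^sub>M PB d" for f g and N :: "((nat \<Rightarrow> real) \<times> (nat \<Rightarrow> real)) measure"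
    using measurable_compose[OF measurable_Pair[OF that] k] by simp
  have shift: "(\<integral>\<^sup>+x. k x (prop d x z) \<partial>PL d) = (\<integral>\<^sup>+x. k (prop d x (\<lambda>i\<in>{..<d}. - z i)) x \<partial>PL d)"
    if z: "z \<in> space (PB d)" for z
  proof -
    have zc: "(\<lambda>_. z) \<in> N \<rightarrow>\<^sub>M PB d" for N :: "(nat \<Rightarrow> real) measure" using z by simp
    have "(\<lambda>x. k (prop d x (\<lambda>i\<in>{..<d}. - z i)) x) \<in> borel_measurable (PB d)"
      using z by measurable
    from nn_integral_PiM_lborel_translate[of "{..<d}", OF _ this, of "\<lambda>i. \<mu> / sqrt (real d) * z i / I"]
    have "(\<integral>\<^sup>+x. k (prop d x (\<lambda>i\<in>{..<d}. - z i)) x \<partial>PL d) =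
        (\<integral>\<^sup>+x. k (prop d (prop d x z) (\<lambda>i\<in>{..<d}. - z i)) (prop d x z) \<partial>PL d)"
      by (simp add: proposal_def)
    also have "\<dots> = (\<integral>\<^sup>+x. k x (prop d x z) \<partial>PL d)"
    proof (rule nn_integral_cong)
      fix x assume "x \<in> space (PL d)"
      then have "prop d (prop d x z) (\<lambda>i\<in>{..<d}. - z i) = x"
        by (auto simp: proposal_def space_PiM PiE_def extensional_def fun_eq_iff)
      then show "k (prop d (prop d x z) (\<lambda>i\<in>{..<d}. - z i)) (prop d x z) = k x (prop d x z)" by simp
    qed
    finally show ?thesis by simp
  qed
  have m: "(\<lambda>z. \<integral>\<^sup>+x. k (prop d x z) x \<partial>PL d) \<in> borel_measurable (PB d)"
    by (rule L.borel_measurable_nn_integral) measurable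
  have "(\<integral>\<^sup>+z. \<integral>\<^sup>+x. k x (prop d x z) \<partial>PL d \<partial>PZ d) =
      (\<integral>\<^sup>+z. \<integral>\<^sup>+x. k (prop d x (\<lambda>i\<in>{..<d}. - z i)) x \<partial>PL d \<partial>PZ d)"
    by (intro nn_integral_cong shift) (simp add: space_PiM)
  also have "\<dots> = (\<integral>\<^sup>+z. \<integral>\<^sup>+x. k (prop d x z) x \<partial>PL d \<partial>PZ d)"
    by (rule nn_integral_PiM_std_normal_uminus[OF _ m]) simp
  finally show ?thesis .
qed

text \<open>The densities of the current state and of its noise become factors of the integrand. What is left is
Lebesgue measure for the state and the same law for both noise variables, which makes a move and its
reversal comparable.\<close>

lemma nn_integral_target_noise:
  fixes f :: "(nat \<Rightarrow> real) \<Rightarrow> real \<Rightarrow> (nat \<Rightarrow> real) \<Rightarrow> real \<Rightarrow> ennreal"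
  assumes f: "(\<lambda>(x, w, x', w'). f x w x' w') \<in> borel_measurable (PB4 d)"
  shows "chain_integral d (\<lambda>x w z w'. f x w (prop d x z) w') =
    (\<integral>\<^sup>+z. \<integral>\<^sup>+x. \<integral>\<^sup>+w. \<integral>\<^sup>+w'. ennreal ((\<Prod>i<d. \<pi> (x i)) * exp w) * f x w (prop d x z) w' \<partial>W1 \<partial>W1 \<partial>PL d \<partial>PZ d)"
proof -
  interpret Z: prob_space "PZ d" by (rule prob_PZ)
  interpret L: sigma_finite_measure "PL d" by (rule sigma_finite_PL)
  interpret LZ: pair_sigma_finite "PL d" "PZ d" by standard
  interpret WZ: pair_sigma_finite "W1" "PZ d" by standard
  define k where "k = (\<lambda>(x, w, z, w'). f x w (prop d x z) w')"
  have k [measurable]: "k \<in> borel_measurable (PB4 d)"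
  proof -
    have "(\<lambda>y. (fst y, fst (snd y), prop d (fst y) (fst (snd (snd y))), snd (snd (snd y)))) \<in>
      (PB4 d) \<rightarrow>\<^sub>M (PB d \<Otimes>\<^sub>M borel \<Otimes>\<^sub>M PB d \<Otimes>\<^sub>M (borel :: real measure))"
      by measurable
    from measurable_compose[OF this f] show ?thesis by (simp add: k_def case_prod_beta')
  qed
  have P [measurable]: "(\<lambda>x. \<Prod>i<d. \<pi> (x i)) \<in> borel_measurable (PB d)"
    by (intro borel_measurable_prod measurable_compose[OF component_measurable meas]) auto
  have P0: "0 \<le> (\<Prod>i<d. \<pi> (x i))" for x :: "nat \<Rightarrow> real" by (intro prod_nonneg) (auto intro: less_imp_le pos)
  have "chain_integral d (\<lambda>x w z w'. f x w (prop d x z) w') =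
    chain_integral d (\<lambda>x w z w'. k (x, w, z, w'))"
    by (simp add: k_def)
  also have "\<dots> = (\<integral>\<^sup>+x. ennreal (\<Prod>i<d. \<pi> (x i)) * (\<integral>\<^sup>+w. \<integral>\<^sup>+z. \<integral>\<^sup>+w'. k (x, w, z, w') \<partial>W1 \<partial>PZ d \<partial>W2) \<partial>PL d)"
    by (rule nn_integral_PX) measurable
  also have "\<dots> = (\<integral>\<^sup>+x. \<integral>\<^sup>+z. \<integral>\<^sup>+w. \<integral>\<^sup>+w'. ennreal ((\<Prod>i<d. \<pi> (x i)) * exp w) * k (x, w, z, w') \<partial>W1 \<partial>W1 \<partial>PZ d \<partial>PL d)"
  proof (intro nn_integral_cong)
    fix x assume "x \<in> space (PL d)"
    then have x: "x \<in> space (PB d)" using sets_eq_imp_space_eq[OF sets_PL] by blast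
    have kx [measurable]: "(\<lambda>y. k (x, y)) \<in> borel_measurable (borel \<Otimes>\<^sub>M PB d \<Otimes>\<^sub>M borel)"
      using x by measurable
    have W2: "(\<integral>\<^sup>+w. \<integral>\<^sup>+z. \<integral>\<^sup>+w'. k (x, w, z, w') \<partial>W1 \<partial>PZ d \<partial>W2) =
       (\<integral>\<^sup>+w. ennreal (exp w) * (\<integral>\<^sup>+z. \<integral>\<^sup>+w'. k (x, w, z, w') \<partial>W1 \<partial>PZ d) \<partial>W1)"
      by (rule nn_integral_W2) measurable
    have "ennreal (\<Prod>i<d. \<pi> (x i)) * (\<integral>\<^sup>+w. \<integral>\<^sup>+z. \<integral>\<^sup>+w'. k (x, w, z, w') \<partial>W1 \<partial>PZ d \<partial>W2) =
       (\<integral>\<^sup>+w. ennreal ((\<Prod>i<d. \<pi> (x i)) * exp w) * (\<integral>\<^sup>+z. \<integral>\<^sup>+w'. k (x, w, z, w') \<partial>W1 \<partial>PZ d) \<partial>W1)"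
      unfolding W2
      by (subst nn_integral_cmult[symmetric], measurable) (simp add: ennreal_mult P0 mult.assoc)
    also have "\<dots> = (\<integral>\<^sup>+w. \<integral>\<^sup>+z. \<integral>\<^sup>+w'. ennreal ((\<Prod>i<d. \<pi> (x i)) * exp w) * k (x, w, z, w') \<partial>W1 \<partial>PZ d \<partial>W1)"
    proof (intro nn_integral_cong)
      fix w :: real
      have "(\<lambda>(z, w'). k (x, w, z, w')) \<in> borel_measurable (PB d \<Otimes>\<^sub>M borel)"
        using measurable_Pair2[OF kx, of w] by (simp add: case_prod_beta')
      then have kxw [measurable]: "(\<lambda>(z, w'). k (x, w, z, w')) \<in> borel_measurable (PZ d \<Otimes>\<^sub>M W1)"
        by (simp cong: measurable_cong_sets)
      have "(\<lambda>z. \<integral>\<^sup>+w'. k (x, w, z, w') \<partial>W1) \<in> borel_measurable (PZ d)"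
        by (rule W1.borel_measurable_nn_integral[OF kxw])
      then show "ennreal ((\<Prod>i<d. \<pi> (x i)) * exp w) * (\<integral>\<^sup>+z. \<integral>\<^sup>+w'. k (x, w, z, w') \<partial>W1 \<partial>PZ d) =
        (\<integral>\<^sup>+z. \<integral>\<^sup>+w'. ennreal ((\<Prod>i<d. \<pi> (x i)) * exp w) * k (x, w, z, w') \<partial>W1 \<partial>PZ d)"
      proof (subst nn_integral_cmult[symmetric])
        show "(\<integral>\<^sup>+z. ennreal ((\<Prod>i<d. \<pi> (x i)) * exp w) * (\<integral>\<^sup>+w'. k (x, w, z, w') \<partial>W1) \<partial>PZ d) =
          (\<integral>\<^sup>+z. \<integral>\<^sup>+w'. ennreal ((\<Prod>i<d. \<pi> (x i)) * exp w) * k (x, w, z, w') \<partial>W1 \<partial>PZ d)"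
        proof (intro nn_integral_cong)
          fix z assume "z \<in> space (PZ d)"
          then have "(\<lambda>w'. k (x, w, z, w')) \<in> borel_measurable W1"
            using measurable_Pair2[OF kxw] by simp
          then show "ennreal ((\<Prod>i<d. \<pi> (x i)) * exp w) * (\<integral>\<^sup>+w'. k (x, w, z, w') \<partial>W1) =
            (\<integral>\<^sup>+w'. ennreal ((\<Prod>i<d. \<pi> (x i)) * exp w) * k (x, w, z, w') \<partial>W1)"
            by (rule nn_integral_cmult[symmetric])
        qed
      qed
    qed
    also have "\<dots> = (\<integral>\<^sup>+z. \<integral>\<^sup>+w. \<integral>\<^sup>+w'. ennreal ((\<Prod>i<d. \<pi> (x i)) * exp w) * k (x, w, z, w') \<partial>W1 \<partial>W1 \<partial>PZ d)"
      by (rule WZ.Fubini'[symmetric]) measurable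
    finally show "ennreal (\<Prod>i<d. \<pi> (x i)) * (\<integral>\<^sup>+w. \<integral>\<^sup>+z. \<integral>\<^sup>+w'. k (x, w, z, w') \<partial>W1 \<partial>PZ d \<partial>W2) =
      (\<integral>\<^sup>+z. \<integral>\<^sup>+w. \<integral>\<^sup>+w'. ennreal ((\<Prod>i<d. \<pi> (x i)) * exp w) * k (x, w, z, w') \<partial>W1 \<partial>W1 \<partial>PZ d)" .
  qed
  also have "\<dots> = (\<integral>\<^sup>+z. \<integral>\<^sup>+x. \<integral>\<^sup>+w. \<integral>\<^sup>+w'. ennreal ((\<Prod>i<d. \<pi> (x i)) * exp w) * k (x, w, z, w') \<partial>W1 \<partial>W1 \<partial>PL d \<partial>PZ d)"
    by (rule LZ.Fubini'[symmetric]) measurable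
  finally show ?thesis by (simp add: k_def)
qed

text \<open>The pointwise balance, combined with the reversal of the proposal and an exchange of the two noise
variables.\<close>

lemma balance:
  fixes g :: "(nat \<Rightarrow> real) \<times> real \<Rightarrow> ennreal"
  assumes g: "g \<in> borel_measurable (state_space d)"
  shows "chain_integral d (\<lambda>x w z w'. ennreal (acc d (x, w) (prop d x z, w')) * g (prop d x z, w')) =
    chain_integral d (\<lambda>x w z w'. ennreal (acc d (x, w) (prop d x z, w')) * g (x, w))"
proof -
  interpret WW: pair_sigma_finite W1 W1 by standard
  note [measurable] = g[unfolded state_space_def]
  define a where "a = (\<lambda>(x, w, x', w'). acc d (x, w) (x', w'))"
  have [measurable]: "a \<in> borel_measurable (PB4 d)"
  proof -
    have "(\<lambda>y. acc d (fst y, fst (snd y)) (fst (snd (snd y)), snd (snd (snd y)))) \<in>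
      borel_measurable (PB4 d)"
      by (rule acc_measurable) (simp_all add: state_space_def)
    then show ?thesis by (simp add: a_def case_prod_beta')
  qed
  have [measurable]: "(\<lambda>x. \<Prod>i<d. \<pi> (x i)) \<in> borel_measurable (PB d)"
    by (intro borel_measurable_prod measurable_compose[OF component_measurable meas]) auto
  define c where "c = (\<lambda>(x, w, x', w'). (\<Prod>i<d. \<pi> (x i)) * exp w * a (x, w, x', w'))"
  have [measurable]: "c \<in> borel_measurable (PB4 d)"
    unfolding c_def by measurable
  have sym: "c (x, w, x', w') = c (x', w', x, w)" for x w x' w'
    using acceptance_balance[of x d w x' w'] by (simp add: c_def a_def)
  have split: "ennreal ((\<Prod>i<d. \<pi> (x i)) * exp w) * (ennreal (acc d (x, w) (x', w')) * t) = ennreal (c (x, w, x', w')) * t" for x w x' w' t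
  proof -
    have P: "0 \<le> (\<Prod>i<d. \<pi> (x i)) * exp w"
      by (intro mult_nonneg_nonneg prod_nonneg) (auto intro: less_imp_le pos)
    have "ennreal (c (x, w, x', w')) = ennreal ((\<Prod>i<d. \<pi> (x i)) * exp w) * ennreal (acc d (x, w) (x', w'))"
      using P by (simp add: c_def a_def ennreal_mult acc_bounds del: prod_ennreal)
    then show ?thesis by (simp only: mult.assoc)
  qed
  define H where "H x x' = (\<integral>\<^sup>+w. \<integral>\<^sup>+w'. ennreal (c (x, w, x', w')) * g (x', w') \<partial>W1 \<partial>W1)" for x x'
  define H' where "H' x x' = (\<integral>\<^sup>+w. \<integral>\<^sup>+w'. ennreal (c (x, w, x', w')) * g (x, w) \<partial>W1 \<partial>W1)" for x x'
  have Hm: "case_prod H \<in> borel_measurable (PB d \<Otimes>\<^sub>M PB d)"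
    unfolding H_def by measurable
  have HH': "H x x' = H' x' x" if "x \<in> space (PB d)" "x' \<in> space (PB d)" for x x'
  proof -
    have "(\<lambda>(w, w'). ennreal (c (x, w, x', w')) * g (x', w')) \<in> borel_measurable (borel \<Otimes>\<^sub>M borel)"
      using that by measurable
    then have m: "(\<lambda>(w, w'). ennreal (c (x, w, x', w')) * g (x', w')) \<in> borel_measurable (W1 \<Otimes>\<^sub>M W1)"
      by (simp cong: measurable_cong_sets)
    have "H x x' = (\<integral>\<^sup>+w'. \<integral>\<^sup>+w. ennreal (c (x, w, x', w')) * g (x', w') \<partial>W1 \<partial>W1)"
      unfolding H_def by (rule WW.Fubini'[OF m, symmetric])
    then show ?thesis by (simp add: H'_def sym[of x])
  qed
  have "chain_integral d (\<lambda>x w z w'. ennreal (acc d (x, w) (prop d x z, w')) * g (prop d x z, w')) =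
      (\<integral>\<^sup>+z. \<integral>\<^sup>+x. H x (prop d x z) \<partial>PL d \<partial>PZ d)"
  proof (subst nn_integral_target_noise[where f="\<lambda>x w x' w'. ennreal (acc d (x, w) (x', w')) * g (x', w')"])
    have "(\<lambda>(x, w, x', w'). ennreal (a (x, w, x', w')) * g (x', w')) \<in> borel_measurable (PB4 d)"
      by measurable
    then show "(\<lambda>(x, w, x', w'). ennreal (acc d (x, w) (x', w')) * g (x', w')) \<in> borel_measurable (PB4 d)"
      by (simp add: a_def)
  qed (simp only: split H_def)
  also have "\<dots> = (\<integral>\<^sup>+z. \<integral>\<^sup>+x. H (prop d x z) x \<partial>PL d \<partial>PZ d)"
    by (rule proposal_reversal[OF Hm])
  also have "\<dots> = (\<integral>\<^sup>+z. \<integral>\<^sup>+x. H' x (prop d x z) \<partial>PL d \<partial>PZ d)"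
    by (intro nn_integral_cong HH') (auto simp: proposal_def space_PiM)
  also have "\<dots> = chain_integral d (\<lambda>x w z w'. ennreal (acc d (x, w) (prop d x z, w')) * g (x, w))"
  proof (subst nn_integral_target_noise[where f="\<lambda>x w x' w'. ennreal (acc d (x, w) (x', w')) * g (x, w)"])
    have "(\<lambda>(x, w, x', w'). ennreal (a (x, w, x', w')) * g (x, w)) \<in> borel_measurable (PB4 d)"
      by measurable
    then show "(\<lambda>(x, w, x', w'). ennreal (acc d (x, w) (x', w')) * g (x, w)) \<in> borel_measurable (PB4 d)"
      by (simp add: a_def)
  qed (simp only: split H'_def)
  finally show ?thesis .
qed


lemma acc_prop_measurable [measurable]:
  "(\<lambda>(x, w, z, w'). acc d (x, w) (prop d x z, w')) \<in> borel_measurable (PB4 d)"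
proof -
  have "(\<lambda>y. acc d (fst y, fst (snd y)) (prop d (fst y) (fst (snd (snd y))), snd (snd (snd y)))) \<in>
      borel_measurable (PB4 d)"
    by (rule acc_measurable; unfold state_space_def; measurable)
  then show ?thesis by (simp add: case_prod_beta')
qed

lemma nn_integral_iterated:
  fixes k :: "(nat \<Rightarrow> real) \<times> real \<times> (nat \<Rightarrow> real) \<times> real \<Rightarrow> ennreal"
  assumes k: "k \<in> borel_measurable (PB4 d)"
  shows "chain_integral d (\<lambda>x w z w'. k (x, w, z, w')) =
    (\<integral>\<^sup>+y. k y \<partial>(PX d \<Otimes>\<^sub>M W2 \<Otimes>\<^sub>M PZ d \<Otimes>\<^sub>M W1))"
proof -
  interpret Z: prob_space "PZ d" by (rule prob_PZ)
  interpret ZW: pair_prob_space "PZ d" W1 by unfold_locales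
  interpret WZW: pair_prob_space W2 "PZ d \<Otimes>\<^sub>M W1" by unfold_locales
  have k': "k \<in> borel_measurable (PX d \<Otimes>\<^sub>M W2 \<Otimes>\<^sub>M PZ d \<Otimes>\<^sub>M W1)"
    using k by (simp cong: measurable_cong_sets)
  have "(\<integral>\<^sup>+y. k y \<partial>(PX d \<Otimes>\<^sub>M W2 \<Otimes>\<^sub>M PZ d \<Otimes>\<^sub>M W1)) = (\<integral>\<^sup>+x. \<integral>\<^sup>+y. k (x, y) \<partial>(W2 \<Otimes>\<^sub>M PZ d \<Otimes>\<^sub>M W1) \<partial>PX d)"
    by (rule WZW.nn_integral_fst[OF k', symmetric])
  also have "\<dots> = chain_integral d (\<lambda>x w z w'. k (x, w, z, w'))"
  proof (intro nn_integral_cong)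
    fix x assume "x \<in> space (PX d)"
    then have kx: "(\<lambda>y. k (x, y)) \<in> borel_measurable (W2 \<Otimes>\<^sub>M PZ d \<Otimes>\<^sub>M W1)"
      using measurable_Pair2[OF k'] by blast
    have "(\<integral>\<^sup>+y. k (x, y) \<partial>(W2 \<Otimes>\<^sub>M PZ d \<Otimes>\<^sub>M W1)) = (\<integral>\<^sup>+w. \<integral>\<^sup>+y. k (x, w, y) \<partial>(PZ d \<Otimes>\<^sub>M W1) \<partial>W2)"
      by (rule ZW.nn_integral_fst[OF kx, symmetric])
    also have "\<dots> = (\<integral>\<^sup>+w. \<integral>\<^sup>+z. \<integral>\<^sup>+w'. k (x, w, z, w') \<partial>W1 \<partial>PZ d \<partial>W2)"
    proof (intro nn_integral_cong)
      fix w assume "w \<in> space W2"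
      then have "(\<lambda>y. k (x, w, y)) \<in> borel_measurable (PZ d \<Otimes>\<^sub>M W1)"
        using measurable_Pair2[OF kx] by blast
      then show "(\<integral>\<^sup>+y. k (x, w, y) \<partial>(PZ d \<Otimes>\<^sub>M W1)) = (\<integral>\<^sup>+z. \<integral>\<^sup>+w'. k (x, w, z, w') \<partial>W1 \<partial>PZ d)"
        by (rule W1.nn_integral_fst[symmetric])
    qed
    finally show "(\<integral>\<^sup>+y. k (x, y) \<partial>(W2 \<Otimes>\<^sub>M PZ d \<Otimes>\<^sub>M W1)) = (\<integral>\<^sup>+w. \<integral>\<^sup>+z. \<integral>\<^sup>+w'. k (x, w, z, w') \<partial>W1 \<partial>PZ d \<partial>W2)" .
  qed
  finally show ?thesis by simp
qed

text \<open>Rejected moves leave the test function where it is and accepted ones may be reversed by detailed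
balance, so the two parts add up to the stationary mean.\<close>

lemma stationary_invariant:
  "distr (stationary_law \<pi> p d \<Otimes>\<^sub>M Noise d) (state_space d) (case_prod (step d)) = stationary_law \<pi> p d"
    (is "?L = ?R")
proof (rule measure_eqI)
  interpret Z: prob_space "PZ d" by (rule prob_PZ)
  show "sets ?L = sets ?R" by (simp add: sets_stationary)
  fix B assume "B \<in> sets ?L"
  then have B [measurable]: "B \<in> sets (state_space d)" by simp
  define g :: "(nat \<Rightarrow> real) \<times> real \<Rightarrow> ennreal" where "g = indicator B"
  have g [measurable]: "g \<in> borel_measurable (state_space d)" unfolding g_def by measurable
  let ?a = "\<lambda>x w z w'. acc d (x, w) (prop d x z, w')"
  let ?I = "\<lambda>f. chain_integral d (\<lambda>x w z w'. f (x, w, z, w'))"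
  have Iadd: "?I (\<lambda>y. f y + h y) = ?I f + ?I h"
    if [measurable]: "f \<in> borel_measurable (PB4 d)"
      "h \<in> borel_measurable (PB4 d)"
    for f h :: "(nat \<Rightarrow> real) \<times> real \<times> (nat \<Rightarrow> real) \<times> real \<Rightarrow> ennreal"
  proof -
    have "(\<lambda>y. f y + h y) \<in> borel_measurable (PB4 d)" by measurable
    then show ?thesis
      unfolding nn_integral_iterated[OF that(1)] nn_integral_iterated[OF that(2)]
      by (subst nn_integral_iterated) (auto intro!: nn_integral_add cong: measurable_cong_sets)
  qed
  define f1 f2 f3 :: "(nat \<Rightarrow> real) \<times> real \<times> (nat \<Rightarrow> real) \<times> real \<Rightarrow> ennreal"
    where "f1 = (\<lambda>(x, w, z, w'). ennreal (?a x w z w') * g (prop d x z, w'))"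
      and "f2 = (\<lambda>(x, w, z, w'). ennreal (1 - ?a x w z w') * g (x, w))"
      and "f3 = (\<lambda>(x, w, z, w'). ennreal (?a x w z w') * g (x, w))"
  note [measurable] = g[unfolded state_space_def]
  have m: "f1 \<in> borel_measurable (PB4 d)"
    "f2 \<in> borel_measurable (PB4 d)"
    "f3 \<in> borel_measurable (PB4 d)"
  proof -
    let ?N = "PB4 d :: ((nat \<Rightarrow> real) \<times> real \<times> (nat \<Rightarrow> real) \<times> real) measure"
    have [measurable]: "(\<lambda>y. g (prop d (fst y) (fst (snd (snd y))), snd (snd (snd y)))) \<in> borel_measurable ?N"
      "(\<lambda>y. g (fst y, fst (snd y))) \<in> borel_measurable ?N"
      by measurable
    have [measurable]: "(\<lambda>y. acc d (fst y, fst (snd y)) (prop d (fst y) (fst (snd (snd y))), snd (snd (snd y)))) \<in> borel_measurable ?N"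
      using acc_prop_measurable[of d] by (simp only: case_prod_beta')
    show "f1 \<in> borel_measurable ?N" "f2 \<in> borel_measurable ?N" "f3 \<in> borel_measurable ?N"
      unfolding f1_def f2_def f3_def case_prod_beta' by (intro borel_measurable_times_ennreal measurable_compose[OF _ measurable_ennreal] borel_measurable_diff borel_measurable_const; measurable)+
  qed
  have "emeasure ?L B = (\<integral>\<^sup>+y. g y \<partial>?L)"
    unfolding g_def by (simp add: sets_stationary)
  also have "\<dots> = (\<integral>\<^sup>+y. g (case_prod (step d) y) \<partial>(stationary_law \<pi> p d \<Otimes>\<^sub>M Noise d))"
    by (rule nn_integral_distr) measurable
  also have "\<dots> = (\<integral>\<^sup>+(y, r). (g \<circ> snd) (y, step d y r) \<partial>(stationary_law \<pi> p d \<Otimes>\<^sub>M Noise d))"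
    by (simp add: case_prod_beta')
  also have "\<dots> = ?I (\<lambda>y. f1 y + f2 y)"
    by (subst nn_integral_step) (auto simp: f1_def f2_def)
  also have "\<dots> = ?I f1 + ?I f2"
    by (rule Iadd[OF m(1,2)])
  also have "\<dots> = ?I f3 + ?I f2"
    using balance[OF g] by (simp add: f1_def f3_def)
  also have "\<dots> = ?I (\<lambda>y. f3 y + f2 y)"
    by (rule Iadd[OF m(3,2), symmetric])
  also have "\<dots> = ?I (\<lambda>(x, w, z, w'). g (x, w))"
    by (simp add: f2_def f3_def distrib_right[symmetric] ennreal_plus[symmetric] acc_bounds del: ennreal_plus)
  also have "\<dots> = (\<integral>\<^sup>+x. \<integral>\<^sup>+w. g (x, w) \<partial>W2 \<partial>PX d)"
    using Z.emeasure_space_1 W1.emeasure_space_1 by simp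
  also have "\<dots> = (\<integral>\<^sup>+y. g y \<partial>(PX d \<Otimes>\<^sub>M W2))"
    by (subst W2.nn_integral_fst[symmetric]) (auto cong: measurable_cong_sets)
  also have "\<dots> = emeasure ?R B"
    unfolding g_def stationary_law_eq[symmetric] by (simp add: sets_stationary)
  finally show "emeasure ?L B = emeasure ?R B" .
qed

definition acceptance_given :: "real \<Rightarrow> real \<Rightarrow> real" where
  "acceptance_given q s = (\<integral>(w', w). F (q + s) * F ((w' - w) - s) \<partial>(W1 \<Otimes>\<^sub>M W2))"

lemma acceptance_given_measurable [measurable (raw)]:
  assumes [measurable]: "f \<in> borel_measurable N" "g \<in> borel_measurable N"
  shows "(\<lambda>y. acceptance_given (f y) (g y)) \<in> borel_measurable N"
proof -
  interpret W12: pair_prob_space W1 W2 by unfold_locales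
  have "(\<lambda>(y, w', w). F (f y + g y) * F ((w' - w) - g y)) \<in> borel_measurable (N \<Otimes>\<^sub>M (W1 \<Otimes>\<^sub>M W2))"
    by measurable
  from W12.borel_measurable_lebesgue_integral[of "\<lambda>y (w', w). F (f y + g y) * F ((w' - w) - g y)", OF this]
  show ?thesis unfolding acceptance_given_def by (simp add: case_prod_beta')
qed

lemma acceptance_given_bounds: "0 \<le> acceptance_given q s" "acceptance_given q s \<le> 1"
proof -
  interpret W12: pair_prob_space W1 W2 by unfold_locales
  show "0 \<le> acceptance_given q s"
    unfolding acceptance_given_def by (auto intro!: Bochner_Integration.integral_nonneg mult_nonneg_nonneg F_nonneg)
  have "acceptance_given q s \<le> (\<integral>y. 1 \<partial>(W1 \<Otimes>\<^sub>M W2))"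
    unfolding acceptance_given_def
    by (rule integral_mono')
       (auto intro!: mult_nonneg_nonneg F_nonneg mult_le_one F_le_1)
  then show "acceptance_given q s \<le> 1" by (simp add: W12.prob_space)
qed

lemma nn_integral_acceptance:
  assumes "x \<in> space (PB d)" "x' \<in> space (PB d)"
  shows "(\<integral>\<^sup>+w. \<integral>\<^sup>+w'. ennreal (acc d (x, w) (x', w')) \<partial>W1 \<partial>W2) =
    ennreal (acceptance_given (q_Delta \<pi> d x x') (s_Delta S \<gamma> d x x'))"
proof -
  interpret W12: pair_prob_space W1 W2 by unfold_locales
  define q s where "q = q_Delta \<pi> d x x'" and "s = s_Delta S \<gamma> d x x'"
  have "ennreal (acceptance_given q s) = (\<integral>\<^sup>+(w', w). ennreal (F (q + s) * F ((w' - w) - s)) \<partial>(W1 \<Otimes>\<^sub>M W2))"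
    unfolding acceptance_given_def
    by (subst nn_integral_eq_integral[symmetric])
      (auto intro!: W12.integrable_const_bound[where B=1] mult_nonneg_nonneg F_nonneg mult_le_one F_le_1
        simp: case_prod_beta' abs_mult abs_of_nonneg[OF F_nonneg])
  also have "\<dots> = (\<integral>\<^sup>+w. \<integral>\<^sup>+w'. ennreal (F (q + s) * F ((w' - w) - s)) \<partial>W1 \<partial>W2)"
    by (subst W12.nn_integral_snd[symmetric]) auto
  finally show ?thesis by (simp add: acceptance_prob_def q_def s_def)
qed

text \<open>Stationarity makes the right-hand side independent of the time \<open>k\<close>. A rejected move contributes nothing,
and the noise is integrated out since the jump does not depend on it.\<close>

lemma ESJD_eq:
  assumes chain: "stationary_dapsmrwm_chain \<pi> S p \<mu> \<gamma> d M Y" and d: "1 \<le> d"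
  shows "ESJD d M Y k = (\<integral>(x, z). (\<mu> / I)\<^sup>2 * ((\<Sum>i<d. (z i)\<^sup>2) / real d) *
    acceptance_given (q_Delta \<pi> d x (prop d x z)) (s_Delta S \<gamma> d x (prop d x z)) \<partial>(PXZ d))"
    (is "_ = (\<integral>(x, z). ?J z * ?G x z \<partial>_)")
proof -
  interpret Z: prob_space "PZ d" by (rule prob_PZ)
  interpret WZ: pair_sigma_finite W2 "PZ d" by standard
  define f :: "((nat \<Rightarrow> real) \<times> real) \<times> ((nat \<Rightarrow> real) \<times> real) \<Rightarrow> real"
    where "f = (\<lambda>(y, y'). \<Sum>i<d. (fst y' i - fst y i)\<^sup>2)"
  have f [measurable]: "f \<in> borel_measurable (state_space d \<Otimes>\<^sub>M state_space d)"
    unfolding f_def state_space_def by measurable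
  have f0: "0 \<le> f y" for y by (auto simp: f_def case_prod_beta intro!: sum_nonneg)
  have chain': "markov_chain (state_space d) (stationary_law \<pi> p d) (dapsmrwm_kernel \<pi> S p \<mu> \<gamma> d) M Y"
    using chain by (simp add: stationary_dapsmrwm_chain_def)
  have "ESJD d M Y k = (\<integral>\<omega>. f (Y k \<omega>, Y (Suc k) \<omega>) \<partial>M)"
    unfolding ESJD_def f_def L2_set_def by (simp add: sum_nonneg)
  also have "\<dots> = (\<integral>(y, r). f (y, step d y r) \<partial>(stationary_law \<pi> p d \<Otimes>\<^sub>M Noise d))"
    by (rule integral_markov_chain_pair[OF chain' prob_Noise step_measurable kernel_eq stationary_invariant f])
  also have "\<dots> = enn2real (\<integral>\<^sup>+(y, r). ennreal (f (y, step d y r)) \<partial>(stationary_law \<pi> p d \<Otimes>\<^sub>M Noise d))"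
    by (subst integral_eq_nn_integral) (auto simp: f0 case_prod_beta')
  also have "(\<integral>\<^sup>+(y, r). ennreal (f (y, step d y r)) \<partial>(stationary_law \<pi> p d \<Otimes>\<^sub>M Noise d)) =
      chain_integral d (\<lambda>x w z w'. ennreal (acc d (x, w) (prop d x z, w')) * ennreal (?J z))"
  proof -
    have "f ((x, w), (prop d x z, w')) = ?J z" for x w z w'
    proof -
      have "(prop d x z i - x i)\<^sup>2 = (\<mu> / I)\<^sup>2 / real d * (z i)\<^sup>2" if "i < d" for i
        using that by (simp add: proposal_def power_mult_distrib power_divide)
      then have "f ((x, w), (prop d x z, w')) = (\<Sum>i<d. (\<mu> / I)\<^sup>2 / real d * (z i)\<^sup>2)"
        by (simp add: f_def)
      also have "\<dots> = (\<mu> / I)\<^sup>2 / real d * (\<Sum>i<d. (z i)\<^sup>2)" by (rule sum_distrib_left[symmetric])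
      finally show ?thesis by simp
    qed
    moreover have "f ((x, w), (x, w)) = 0" for x w by (simp add: f_def)
    ultimately show ?thesis
      using nn_integral_step[of "\<lambda>y. ennreal (f y)" d] by simp
  qed
  also have "\<dots> = (\<integral>\<^sup>+x. \<integral>\<^sup>+z. ennreal (?J z * ?G x z) \<partial>PZ d \<partial>PX d)"
  proof (intro nn_integral_cong)
    fix x assume "x \<in> space (PX d)"
    then have x: "x \<in> space (PB d)" using sets_eq_imp_space_eq[OF sets_PX] by blast
    have a: "(\<lambda>(w, z, w'). acc d (x, w) (prop d x z, w')) \<in> borel_measurable (borel \<Otimes>\<^sub>M PB d \<Otimes>\<^sub>M borel)"
      using measurable_Pair2[OF acc_prop_measurable x] by simp
    have a' [measurable]: "(\<lambda>((w, z), w'). acc d (x, w) (prop d x z, w')) \<in> borel_measurable ((borel \<Otimes>\<^sub>M PB d) \<Otimes>\<^sub>M borel)"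
    proof -
      have "(\<lambda>y. (fst (fst y), snd (fst y), snd y)) \<in> (borel \<Otimes>\<^sub>M PB d) \<Otimes>\<^sub>M borel \<rightarrow>\<^sub>M borel \<Otimes>\<^sub>M PB d \<Otimes>\<^sub>M (borel :: real measure)"
        by measurable
      from measurable_compose[OF this a] show ?thesis by (simp add: case_prod_beta')
    qed
    have "(\<lambda>((w, z), w'). ennreal (acc d (x, w) (prop d x z, w')) * ennreal (?J z)) \<in> borel_measurable ((W2 \<Otimes>\<^sub>M PZ d) \<Otimes>\<^sub>M W1)"
      using a' by (simp add: case_prod_beta' cong: measurable_cong_sets) measurable
    then have "(\<lambda>(w, z). \<integral>\<^sup>+w'. ennreal (acc d (x, w) (prop d x z, w')) * ennreal (?J z) \<partial>W1) \<in> borel_measurable (W2 \<Otimes>\<^sub>M PZ d)"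
      using W1.borel_measurable_nn_integral[of "\<lambda>(w, z) w'. ennreal (acc d (x, w) (prop d x z, w')) * ennreal (?J z)" "W2 \<Otimes>\<^sub>M PZ d"]
      by (simp add: case_prod_beta')
    then have "(\<integral>\<^sup>+w. \<integral>\<^sup>+z. \<integral>\<^sup>+w'. ennreal (acc d (x, w) (prop d x z, w')) * ennreal (?J z) \<partial>W1 \<partial>PZ d \<partial>W2) =
        (\<integral>\<^sup>+z. \<integral>\<^sup>+w. \<integral>\<^sup>+w'. ennreal (acc d (x, w) (prop d x z, w')) * ennreal (?J z) \<partial>W1 \<partial>W2 \<partial>PZ d)"
      by (rule WZ.Fubini'[symmetric])
    also have "\<dots> = (\<integral>\<^sup>+z. ennreal (?J z * ?G x z) \<partial>PZ d)"
    proof (intro nn_integral_cong)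
      fix z assume "z \<in> space (PZ d)"
      then have z: "z \<in> space (PB d)" using sets_eq_imp_space_eq[OF sets_PZ] by blast
      have p: "prop d x z \<in> space (PB d)" by (auto simp: proposal_def space_PiM)
      let ?A = "\<lambda>w w'. ennreal (acc d (x, w) (prop d x z, w'))"
      have m: "case_prod ?A \<in> borel_measurable (W2 \<Otimes>\<^sub>M W1)"
      proof -
        have "(\<lambda>y. acc d (x, fst y) (prop d x z, snd y)) \<in> borel_measurable (borel \<Otimes>\<^sub>M borel)"
          by (rule acc_measurable; unfold state_space_def; use x p in measurable)
        then show ?thesis by (simp add: case_prod_beta' cong: measurable_cong_sets)
      qed
      have "(\<integral>\<^sup>+w. \<integral>\<^sup>+w'. ?A w w' * ennreal (?J z) \<partial>W1 \<partial>W2) = (\<integral>\<^sup>+w. (\<integral>\<^sup>+w'. ?A w w' \<partial>W1) * ennreal (?J z) \<partial>W2)"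
      proof (intro nn_integral_cong nn_integral_multc)
        fix w assume "w \<in> space W2"
        then show "(\<lambda>w'. ?A w w') \<in> borel_measurable W1" using measurable_Pair2[OF m] by simp
      qed
      also have "\<dots> = (\<integral>\<^sup>+w. \<integral>\<^sup>+w'. ?A w w' \<partial>W1 \<partial>W2) * ennreal (?J z)"
        by (rule nn_integral_multc) (rule W1.borel_measurable_nn_integral[OF m])
      also have "\<dots> = ennreal (?J z * ?G x z)"
        unfolding nn_integral_acceptance[OF x p]
        by (subst ennreal_mult[symmetric]) (auto simp: mult.commute acceptance_given_bounds intro!: sum_nonneg divide_nonneg_nonneg mult_nonneg_nonneg)
      finally show "(\<integral>\<^sup>+w. \<integral>\<^sup>+w'. ?A w w' * ennreal (?J z) \<partial>W1 \<partial>W2) = ennreal (?J z * ?G x z)" .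
    qed
    finally show "(\<integral>\<^sup>+w. \<integral>\<^sup>+z. \<integral>\<^sup>+w'. ennreal (acc d (x, w) (prop d x z, w')) * ennreal (?J z) \<partial>W1 \<partial>PZ d \<partial>W2) =
      (\<integral>\<^sup>+z. ennreal (?J z * ?G x z) \<partial>PZ d)" .
  qed
  also have "\<dots> = (\<integral>\<^sup>+(x, z). ennreal (?J z * ?G x z) \<partial>(PXZ d))"
    by (subst Z.nn_integral_fst[symmetric]) auto
  also have "enn2real \<dots> = (\<integral>(x, z). ?J z * ?G x z \<partial>(PXZ d))"
    by (subst integral_eq_nn_integral)
      (auto simp: case_prod_beta' acceptance_given_bounds intro!: sum_nonneg divide_nonneg_nonneg mult_nonneg_nonneg)
  finally show ?thesis .
qed

end

section \<open>Second-order expansion of sums of increments\<close>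

lemma (in pair_prob_space) integral_fst_only:
  fixes f :: "'a \<Rightarrow> real"
  assumes "integrable M1 f"
  shows "integrable (M1 \<Otimes>\<^sub>M M2) (\<lambda>(x, y). f x)" and "(\<integral>(x, y). f x \<partial>(M1 \<Otimes>\<^sub>M M2)) = (\<integral>x. f x \<partial>M1)"
proof -
  have d: "distr (M1 \<Otimes>\<^sub>M M2) M1 fst = M1" by (rule M2.distr_pair_fst)
  have "integrable (distr (M1 \<Otimes>\<^sub>M M2) M1 fst) f" using assms by (simp add: d)
  then show "integrable (M1 \<Otimes>\<^sub>M M2) (\<lambda>(x, y). f x)"
    using assms by (subst (asm) integrable_distr_eq) (auto simp: case_prod_beta')
  have "(\<integral>x. f x \<partial>distr (M1 \<Otimes>\<^sub>M M2) M1 fst) = (\<integral>y. f (fst y) \<partial>(M1 \<Otimes>\<^sub>M M2))"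
    using assms by (intro integral_distr) auto
  then show "(\<integral>(x, y). f x \<partial>(M1 \<Otimes>\<^sub>M M2)) = (\<integral>x. f x \<partial>M1)" by (simp add: d case_prod_beta')
qed

lemma (in pair_prob_space) integral_snd_only:
  fixes f :: "'b \<Rightarrow> real"
  assumes "integrable M2 f"
  shows "integrable (M1 \<Otimes>\<^sub>M M2) (\<lambda>(x, y). f y)" and "(\<integral>(x, y). f y \<partial>(M1 \<Otimes>\<^sub>M M2)) = (\<integral>y. f y \<partial>M2)"
proof -
  have d: "distr (M1 \<Otimes>\<^sub>M M2) M2 snd = M2"
  proof (rule measure_eqI)
    fix A assume "A \<in> sets (distr (M1 \<Otimes>\<^sub>M M2) M2 snd)"
    then have A: "A \<in> sets M2" by simp
    have "emeasure (distr (M1 \<Otimes>\<^sub>M M2) M2 snd) A = emeasure (M1 \<Otimes>\<^sub>M M2) (space M1 \<times> A)"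
      using A sets.sets_into_space[OF A]
      by (subst emeasure_distr) (auto simp: space_pair_measure intro!: arg_cong[where f="emeasure (M1 \<Otimes>\<^sub>M M2)"])
    then show "emeasure (distr (M1 \<Otimes>\<^sub>M M2) M2 snd) A = emeasure M2 A"
      using A by (simp add: M2.emeasure_pair_measure_Times M1.emeasure_space_1)
  qed simp
  have "integrable (distr (M1 \<Otimes>\<^sub>M M2) M2 snd) f" using assms by (simp add: d)
  then show "integrable (M1 \<Otimes>\<^sub>M M2) (\<lambda>(x, y). f y)"
    using assms by (subst (asm) integrable_distr_eq) (auto simp: case_prod_beta')
  have "(\<integral>x. f x \<partial>distr (M1 \<Otimes>\<^sub>M M2) M2 snd) = (\<integral>y. f (snd y) \<partial>(M1 \<Otimes>\<^sub>M M2))"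
    using assms by (intro integral_distr) auto
  then show "(\<integral>(x, y). f y \<partial>(M1 \<Otimes>\<^sub>M M2)) = (\<integral>y. f y \<partial>M2)" by (simp add: d case_prod_beta')
qed

lemma std_normal_moments:
  shows "integrable std_normal (\<lambda>z. z\<^sup>2 - 1)" "integrable std_normal (\<lambda>z. (z\<^sup>2 - 1)\<^sup>2)"
    "(\<integral>z. z\<^sup>2 - 1 \<partial>std_normal) = 0" "(\<integral>z. (z\<^sup>2 - 1)\<^sup>2 \<partial>std_normal) = 2"
    "integrable std_normal (\<lambda>z. \<bar>z\<bar> ^ 3)" "integrable std_normal (\<lambda>z. z\<^sup>2)"
proof -
  interpret N: prob_space std_normal by (rule prob_space_std_normal)
  have int: "integrable std_normal f \<longleftrightarrow> integrable lborel (\<lambda>x. std_normal_density x * f x)"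
    and val: "(\<integral>x. f x \<partial>std_normal) = (\<integral>x. std_normal_density x * f x \<partial>lborel)"
    if [measurable]: "f \<in> borel_measurable borel" for f :: "real \<Rightarrow> real"
    by (subst integrable_density integral_density; simp)+
  have i2: "integrable std_normal (\<lambda>z. z\<^sup>2)" and i4: "integrable std_normal (\<lambda>z. z ^ 4)"
    by (simp_all add: int integrable_std_normal_moment)
  have e2: "(\<integral>z. z\<^sup>2 \<partial>std_normal) = 1"
    using integral_std_normal_moment_even[of 1] by (simp add: val)
  have e4: "(\<integral>z. z ^ 4 \<partial>std_normal) = 3"
    using integral_std_normal_moment_even[of 2] by (simp add: val fact_numeral)
  show "integrable std_normal (\<lambda>z. \<bar>z\<bar> ^ 3)" by (simp add: int integrable_std_normal_moment_abs)
  show "integrable std_normal (\<lambda>z. z\<^sup>2)" by (rule i2)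
  show "integrable std_normal (\<lambda>z. z\<^sup>2 - 1)" using i2 by simp
  show "(\<integral>z. z\<^sup>2 - 1 \<partial>std_normal) = 0" using i2 N.prob_space by (simp add: e2)
  have sq: "(\<lambda>z. (z\<^sup>2 - 1)\<^sup>2) = (\<lambda>z::real. z ^ 4 - 2 * z\<^sup>2 + 1)"
    by (auto simp: power2_diff power_mult[symmetric])
  show "integrable std_normal (\<lambda>z. (z\<^sup>2 - 1)\<^sup>2)" unfolding sq using i2 i4 by simp
  show "(\<integral>z. (z\<^sup>2 - 1)\<^sup>2 \<partial>std_normal) = 2" unfolding sq using i2 i4 e2 e4 N.prob_space by simp
qed

text \<open>On the negative half-line \<open>F\<close> is the exponential function, whose slope is at most 1 there, and on the
positive half-line it is constant.\<close>

lemma F_lipschitz: "\<bar>F a - F b\<bar> \<le> \<bar>a - b\<bar>"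
proof -
  have *: "F a - F b \<le> a - b" if "b \<le> a" for a b
  proof (cases "b \<le> 0")
    case True
    let ?c = "min a 0"
    have "F a = exp ?c" by (simp add: F_def min_def)
    moreover have "F b = exp b" using True by (simp add: F_def)
    moreover have "exp ?c * (1 - exp (b - ?c)) = exp ?c - exp b"
      by (simp add: algebra_simps exp_add[symmetric])
    moreover have "exp ?c * (1 - exp (b - ?c)) \<le> 1 * (?c - b)"
    proof (rule mult_mono)
      show "1 - exp (b - ?c) \<le> ?c - b" using exp_ge_add_one_self[of "b - ?c"] by linarith
      show "0 \<le> 1 - exp (b - ?c)" using that True by simp
    qed auto
    moreover have "?c \<le> a" by simp
    ultimately show ?thesis by simp
  next
    case False
    then show ?thesis using that by (simp add: F_def)
  qed
  have mono: "F b \<le> F a" if "b \<le> a" for a b using that by (simp add: F_def min_def)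
  show ?thesis using *[of a b] *[of b a] mono[of a b] mono[of b a] by linarith
qed

context target
begin

abbreviation "PD d \<equiv> Pi\<^sub>M {..<d::nat} (\<lambda>_. D)"

lemma prob_D_UNIV [simp]: "D.prob UNIV = 1"
  using D.prob_space by simp

lemma average_L1:
  fixes g :: "nat \<Rightarrow> real \<Rightarrow> real"
  assumes g [measurable]: "\<And>i. g i \<in> borel_measurable borel"
    and g2: "\<And>i. integrable D (\<lambda>x. (g i x)\<^sup>2)"
    and le: "\<And>i. (\<integral>x. (g i x)\<^sup>2 \<partial>D) \<le> C" and d: "0 < d"
  shows "integrable (PD d) (\<lambda>x. (\<Sum>i<d. g i (x i)) / d - m)"
    and "(\<integral>x. \<bar>(\<Sum>i<d. g i (x i)) / d - m\<bar> \<partial>PD d) \<le> sqrt C / sqrt d + \<bar>(\<Sum>i<d. \<integral>x. g i x \<partial>D) / d - m\<bar>"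
proof -
  interpret P: prob_space "PD d" by (intro prob_space_PiM D.prob_space_axioms)
  define e where "e i = (\<integral>x. g i x \<partial>D)" for i
  define h where "h i x = g i x - e i" for i x
  have ig: "integrable D (g i)" for i
    by (rule D.square_integrable_imp_integrable) (use g2 in auto)
  have ih: "integrable D (h i)" for i unfolding h_def[abs_def] using ig by simp
  have hsq: "(\<lambda>x. (h i x)\<^sup>2) = (\<lambda>x. (g i x)\<^sup>2 - 2 * e i * g i x + (e i)\<^sup>2)" for i
    by (auto simp: h_def power2_diff algebra_simps)
  have ih2: "integrable D (\<lambda>x. (h i x)\<^sup>2)" for i unfolding hsq using g2 ig by simp
  have var: "(\<integral>x. (h i x)\<^sup>2 \<partial>D) = (\<integral>x. (g i x)\<^sup>2 \<partial>D) - (e i)\<^sup>2" for i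
    unfolding hsq using g2 ig by (simp add: D.prob_space e_def power2_eq_square)
  have h2: "(\<integral>x. (h i x)\<^sup>2 \<partial>D) \<le> C" for i
    by (rule order_trans[OF _ le[of i]]) (simp add: var)
  have eh: "(\<integral>x. h i x \<partial>D) = 0" for i unfolding h_def[abs_def] using ig by (simp add: D.prob_space e_def)
  have ic: "integrable (PD d) (\<lambda>x. f i (x i))" if "i < d" "integrable D (f i)" for f :: "nat \<Rightarrow> real \<Rightarrow> real" and i
    using D.integrable_component(1)[of "{..<d}" i "f i"] that by simp
  have sg: "integrable (PD d) (\<lambda>x. \<Sum>i<d. g i (x i))"
    using ig by (intro Bochner_Integration.integrable_sum ic) auto
  have sh: "integrable (PD d) (\<lambda>x. \<Sum>i<d. h i (x i))"
    using ih by (intro Bochner_Integration.integrable_sum ic) auto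
  show i: "integrable (PD d) (\<lambda>x. (\<Sum>i<d. g i (x i)) / d - m)"
    using sg by (intro Bochner_Integration.integrable_diff integrable_divide) auto
  have eq: "(\<Sum>i<d. g i (x i)) / d - m = (\<Sum>i<d. h i (x i)) / d + ((\<Sum>i<d. e i) / d - m)" for x
    by (simp add: h_def sum_subtractf diff_divide_distrib)
  have "(\<integral>x. \<bar>(\<Sum>i<d. g i (x i)) / d - m\<bar> \<partial>PD d) \<le>
      (\<integral>x. \<bar>\<Sum>i<d. h i (x i)\<bar> / d + \<bar>(\<Sum>i<d. e i) / d - m\<bar> \<partial>PD d)"
  proof (rule integral_mono)
    show "integrable (PD d) (\<lambda>x. \<bar>(\<Sum>i<d. g i (x i)) / d - m\<bar>)" using i by simp
    show "integrable (PD d) (\<lambda>x. \<bar>\<Sum>i<d. h i (x i)\<bar> / d + \<bar>(\<Sum>i<d. e i) / d - m\<bar>)" using sh by simp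
    show "\<bar>(\<Sum>i<d. g i (x i)) / d - m\<bar> \<le> \<bar>\<Sum>i<d. h i (x i)\<bar> / d + \<bar>(\<Sum>i<d. e i) / d - m\<bar>" for x
      unfolding eq by (rule order_trans[OF abs_triangle_ineq]) simp
  qed
  also have "\<dots> = (\<integral>x. \<bar>\<Sum>i<d. h i (x i)\<bar> \<partial>PD d) / d + \<bar>(\<Sum>i<d. e i) / d - m\<bar>"
    using sh by (simp add: P.prob_space)
  also have "\<dots> \<le> sqrt (card {..<d} * C) / d + \<bar>(\<Sum>i<d. e i) / d - m\<bar>"
    using ih ih2 eh h2 by (intro add_mono divide_right_mono D.expectation_abs_sum_centred_le) auto
  also have "sqrt (card {..<d} * C) / d = sqrt C / sqrt d"
    using d by (simp add: real_sqrt_mult field_simps)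
  finally show "(\<integral>x. \<bar>(\<Sum>i<d. g i (x i)) / d - m\<bar> \<partial>PD d) \<le> sqrt C / sqrt d + \<bar>(\<Sum>i<d. \<integral>x. g i x \<partial>D) / d - m\<bar>"
    by (simp add: e_def)
qed

text \<open>After subtraction of the linear form and of \<open>h\<^sup>2 d m / 2\<close>, three errors are left. In the quadratic term,
\<open>(z i)\<^sup>2\<close> fluctuates about 1 and the second derivative at \<open>x i\<close> about its mean; both are sums of
independent centred variables, the first for fixed \<open>x\<close>, and they contribute the factors 2 and 1 in
\<open>3 * B\<close>. The means of the second derivatives need only be close to \<open>m\<close> on average. Finally the
Taylor remainder is of order \<open>h ^ 3 * d\<close>, that is, \<open>1 / sqrt d\<close> for \<open>h\<close> of order \<open>1 / sqrt d\<close>.\<close>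

lemma expansion_L1:
  fixes \<psi> :: "nat \<Rightarrow> real \<Rightarrow> real" and m :: real
  assumes thrice: "\<And>i. thrice_differentiable (\<psi> i)"
    and B2: "\<And>i x. \<bar>(deriv ^^ 2) (\<psi> i) x\<bar> \<le> B" and B3: "\<And>i x. \<bar>(deriv ^^ 3) (\<psi> i) x\<bar> \<le> B"
    and d: "0 < d" and h: "0 \<le> h"
  defines "R \<equiv> \<lambda>x z. (\<Sum>i<d. \<psi> i (x i + h * z i) - \<psi> i (x i)) - h * (\<Sum>i<d. deriv (\<psi> i) (x i) * z i) - h\<^sup>2 / 2 * d * m"
  shows "integrable (PD d \<Otimes>\<^sub>M Pi\<^sub>M {..<d} (\<lambda>_. std_normal)) (\<lambda>(x, z). R x z)"
    and "(\<integral>(x, z). \<bar>R x z\<bar> \<partial>(PD d \<Otimes>\<^sub>M Pi\<^sub>M {..<d} (\<lambda>_. std_normal))) \<le>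
      h\<^sup>2 / 2 * d * (3 * B / sqrt d + \<bar>(\<Sum>i<d. \<integral>x. (deriv ^^ 2) (\<psi> i) x \<partial>D) / d - m\<bar>)
      + B / 6 * h ^ 3 * d * (\<integral>z. \<bar>z\<bar> ^ 3 \<partial>std_normal)"
proof -
  let ?PZ = "Pi\<^sub>M {..<d} (\<lambda>_. std_normal)"
  interpret N: prob_space std_normal by (rule prob_space_std_normal)
  interpret X: prob_space "PD d" by (intro prob_space_PiM D.prob_space_axioms)
  interpret Z: prob_space ?PZ by (intro prob_space_PiM N.prob_space_axioms)
  interpret XZ: pair_prob_space "PD d" ?PZ by unfold_locales
  have B: "0 \<le> B" using B2[of 0 0] by linarith
  note derivs = thrice_differentiable_derivs[OF thrice]
  have [measurable]: "\<psi> i \<in> borel_measurable borel" "deriv (\<psi> i) \<in> borel_measurable borel"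
    "(deriv ^^ 2) (\<psi> i) \<in> borel_measurable borel" for i
    by (intro borel_measurable_continuous_onI continuous_on_of_derivative[OF derivs(1)]
      continuous_on_of_derivative[OF derivs(2)] continuous_on_of_derivative[OF derivs(3)])+
  have [measurable]: "(\<lambda>x. x i) \<in> borel_measurable (PD d)" "(\<lambda>x. x i) \<in> borel_measurable ?PZ" if "i < d" for i
    using that by auto
  define T1 where "T1 = (\<lambda>(x, z). \<Sum>i<d. (deriv ^^ 2) (\<psi> i) (x i) * ((z i)\<^sup>2 - 1))"
  define T2 where "T2 x = (\<Sum>i<d. (deriv ^^ 2) (\<psi> i) (x i)) / d - m" for x
  define T3 where "T3 z = (\<Sum>i<d. \<bar>z i\<bar> ^ 3)" for z :: "nat \<Rightarrow> real"
  have Rm: "(\<lambda>(x, z). R x z) \<in> borel_measurable (PD d \<Otimes>\<^sub>M ?PZ)"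
    unfolding R_def by measurable
  have T1m [measurable]: "T1 \<in> borel_measurable (PD d \<Otimes>\<^sub>M ?PZ)"
    unfolding T1_def by measurable
  have bound: "\<bar>R x z\<bar> \<le> h\<^sup>2 / 2 * \<bar>T1 (x, z)\<bar> + h\<^sup>2 / 2 * d * \<bar>T2 x\<bar> + B / 6 * h ^ 3 * T3 z" for x z
  proof -
    define r where "r i = \<psi> i (x i + h * z i) - \<psi> i (x i) - deriv (\<psi> i) (x i) * (h * z i) - (deriv ^^ 2) (\<psi> i) (x i) * (h * z i)\<^sup>2 / 2" for i
    have r: "\<bar>r i\<bar> \<le> B / 6 * h ^ 3 * \<bar>z i\<bar> ^ 3" for i
      using taylor_remainder_le[OF thrice B3, of i "x i" "h * z i"] h
      by (simp add: r_def abs_mult power_mult_distrib)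
    have R1: "(\<Sum>i<d. r i) = (\<Sum>i<d. \<psi> i (x i + h * z i) - \<psi> i (x i)) - h * (\<Sum>i<d. deriv (\<psi> i) (x i) * z i)
        - h\<^sup>2 / 2 * (\<Sum>i<d. (deriv ^^ 2) (\<psi> i) (x i) * (z i)\<^sup>2)"
      unfolding r_def sum_subtractf sum_distrib_left
      by (intro arg_cong2[where f="(-)"] refl sum.cong) (auto simp: power_mult_distrib)
    have R2: "(\<Sum>i<d. (deriv ^^ 2) (\<psi> i) (x i) * (z i)\<^sup>2) = T1 (x, z) + d * T2 x + d * m"
      using d by (simp add: T1_def T2_def right_diff_distrib sum_subtractf)
    have R3: "h\<^sup>2 / 2 * (T1 (x, z) + d * T2 x + d * m) =
        h\<^sup>2 / 2 * T1 (x, z) + h\<^sup>2 / 2 * d * T2 x + h\<^sup>2 / 2 * d * m"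
      by (simp add: distrib_left)
    have "R x z = (\<Sum>i<d. r i) + h\<^sup>2 / 2 * T1 (x, z) + h\<^sup>2 / 2 * d * T2 x"
      unfolding R_def using R1[unfolded R2 R3] by linarith
    also have "\<bar>\<dots>\<bar> \<le> (\<Sum>i<d. \<bar>r i\<bar>) + h\<^sup>2 / 2 * \<bar>T1 (x, z)\<bar> + h\<^sup>2 / 2 * d * \<bar>T2 x\<bar>"
      by (intro abs_triangle_ineq[THEN order_trans] add_mono sum_abs) (auto simp: abs_mult)
    also have "(\<Sum>i<d. \<bar>r i\<bar>) \<le> B / 6 * h ^ 3 * T3 z"
      unfolding T3_def sum_distrib_left by (intro sum_mono r)
    finally show ?thesis by simp
  qed
  have iz: "integrable ?PZ (\<lambda>z. f (z i))" "(\<integral>z. f (z i) \<partial>?PZ) = (\<integral>z. f z \<partial>std_normal)"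
    if "i < d" "integrable std_normal f" for i and f :: "real \<Rightarrow> real"
    using N.integrable_component[of "{..<d}" i f] that by auto
  have T3: "integrable ?PZ T3" "(\<integral>z. T3 z \<partial>?PZ) = d * (\<integral>z. \<bar>z\<bar> ^ 3 \<partial>std_normal)"
  proof -
    show "integrable ?PZ T3" unfolding T3_def[abs_def]
      by (intro Bochner_Integration.integrable_sum iz std_normal_moments) auto
    show "(\<integral>z. T3 z \<partial>?PZ) = d * (\<integral>z. \<bar>z\<bar> ^ 3 \<partial>std_normal)"
      unfolding T3_def using iz[OF _ std_normal_moments(5)] by (subst Bochner_Integration.integral_sum) auto
  qed
  have B2sq: "((deriv ^^ 2) (\<psi> i) x)\<^sup>2 \<le> B\<^sup>2" for i x
    using B2[of i x] by (metis abs_ge_zero power2_abs power_mono)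
  have isq: "integrable D (\<lambda>x. ((deriv ^^ 2) (\<psi> i) x)\<^sup>2)" for i
    using B2sq by (intro integrable_D_bounded[where B="B\<^sup>2"]) auto
  have T2: "integrable (PD d) T2"
    "(\<integral>x. \<bar>T2 x\<bar> \<partial>PD d) \<le> B / sqrt d + \<bar>(\<Sum>i<d. \<integral>x. (deriv ^^ 2) (\<psi> i) x \<partial>D) / d - m\<bar>"
  proof -
    have le: "(\<integral>x. ((deriv ^^ 2) (\<psi> i) x)\<^sup>2 \<partial>D) \<le> B\<^sup>2" for i
      using B2sq isq by (intro D.integral_le_const) auto
    from average_L1[of "\<lambda>i. (deriv ^^ 2) (\<psi> i)", OF _ isq le d, of m] B
    show "integrable (PD d) T2"
      "(\<integral>x. \<bar>T2 x\<bar> \<partial>PD d) \<le> B / sqrt d + \<bar>(\<Sum>i<d. \<integral>x. (deriv ^^ 2) (\<psi> i) x \<partial>D) / d - m\<bar>"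
      by (simp_all add: T2_def[abs_def])
  qed
  have T1i: "integrable (PD d \<Otimes>\<^sub>M ?PZ) T1"
  proof (rule Bochner_Integration.integrable_bound[OF _ T1m])
    have "integrable ?PZ (\<lambda>z. \<Sum>i<d. B * ((z i)\<^sup>2 + 1))"
      by (intro Bochner_Integration.integrable_sum integrable_mult_right Bochner_Integration.integrable_add iz std_normal_moments) auto
    from XZ.integral_snd_only(1)[OF this]
    show "integrable (PD d \<Otimes>\<^sub>M ?PZ) (\<lambda>(x, z). \<Sum>i<d. B * ((z i)\<^sup>2 + 1))" .
    have "\<bar>T1 (x, z)\<bar> \<le> (\<Sum>i<d. B * ((z i)\<^sup>2 + 1))" for x z
      unfolding T1_def prod.case
    proof (rule order_trans[OF sum_abs], rule sum_mono)
      fix i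
      have "\<bar>(z i)\<^sup>2 - 1\<bar> \<le> (z i)\<^sup>2 + 1" by (simp add: abs_le_iff)
      then show "\<bar>(deriv ^^ 2) (\<psi> i) (x i) * ((z i)\<^sup>2 - 1)\<bar> \<le> B * ((z i)\<^sup>2 + 1)"
        unfolding abs_mult by (intro mult_mono B2 B) auto
    qed
    then show "AE y in PD d \<Otimes>\<^sub>M ?PZ. norm (T1 y) \<le> norm (case y of (x, z) \<Rightarrow> \<Sum>i<d. B * ((z i)\<^sup>2 + 1))"
      by (intro AE_I2) (auto intro: order_trans[OF _ abs_ge_self])
  qed
  have T1: "(\<integral>y. \<bar>T1 y\<bar> \<partial>(PD d \<Otimes>\<^sub>M ?PZ)) \<le> 2 * B * sqrt d"
  proof -
    have iT: "integrable (PD d \<Otimes>\<^sub>M ?PZ) (\<lambda>y. \<bar>T1 y\<bar>)" using T1i by simp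
    have "(\<integral>y. \<bar>T1 y\<bar> \<partial>(PD d \<Otimes>\<^sub>M ?PZ)) = (\<integral>x. \<integral>z. \<bar>T1 (x, z)\<bar> \<partial>?PZ \<partial>PD d)"
      by (rule XZ.integral_fst'[OF iT, symmetric])
    also have "\<dots> \<le> 2 * B * sqrt d"
    proof (rule X.integral_le_const)
      show "integrable (PD d) (\<lambda>x. \<integral>z. \<bar>T1 (x, z)\<bar> \<partial>?PZ)" by (rule XZ.integrable_fst'[OF iT])
      have "(\<integral>z. \<bar>T1 (x, z)\<bar> \<partial>?PZ) \<le> sqrt (card {..<d} * (2 * B\<^sup>2))" for x
        unfolding T1_def prod.case
      proof (rule N.expectation_abs_sum_centred_le)
        fix i
        let ?c = "(deriv ^^ 2) (\<psi> i) (x i)"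
        show "integrable std_normal (\<lambda>z. ?c * (z\<^sup>2 - 1))" "(\<integral>z. ?c * (z\<^sup>2 - 1) \<partial>std_normal) = 0"
          using std_normal_moments(1,3) by auto
        show "integrable std_normal (\<lambda>z. (?c * (z\<^sup>2 - 1))\<^sup>2)" "(\<integral>z. (?c * (z\<^sup>2 - 1))\<^sup>2 \<partial>std_normal) \<le> 2 * B\<^sup>2"
          unfolding power_mult_distrib using std_normal_moments(2,4) B2sq[of i "x i"] by auto
      qed simp
      also have "sqrt (card {..<d} * (2 * B\<^sup>2)) = sqrt 2 * B * sqrt d"
        using B by (simp add: real_sqrt_mult)
      also have "\<dots> \<le> 2 * B * sqrt d"
        using B sqrt2_less_2 by (intro mult_right_mono) auto
      finally show "AE x in PD d. (\<integral>z. \<bar>T1 (x, z)\<bar> \<partial>?PZ) \<le> 2 * B * sqrt d" by simp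
    qed
    finally show ?thesis .
  qed
  have maj1: "integrable (PD d \<Otimes>\<^sub>M ?PZ) (\<lambda>(x, z). \<bar>T2 x\<bar>)" "(\<integral>(x, z). \<bar>T2 x\<bar> \<partial>(PD d \<Otimes>\<^sub>M ?PZ)) = (\<integral>x. \<bar>T2 x\<bar> \<partial>PD d)"
    using XZ.integral_fst_only[of "\<lambda>x. \<bar>T2 x\<bar>"] T2 by auto
  have maj2: "integrable (PD d \<Otimes>\<^sub>M ?PZ) (\<lambda>(x, z). T3 z)" "(\<integral>(x, z). T3 z \<partial>(PD d \<Otimes>\<^sub>M ?PZ)) = (\<integral>x. T3 x \<partial>?PZ)"
    using XZ.integral_snd_only[OF T3(1)] by auto
  \<comment> \<open>The integrable majorant of the error.\<close>
  let ?M = "\<lambda>y. h\<^sup>2 / 2 * \<bar>T1 y\<bar> + h\<^sup>2 / 2 * d * (case y of (x, z) \<Rightarrow> \<bar>T2 x\<bar>) + B / 6 * h ^ 3 * (case y of (x, z) \<Rightarrow> T3 z)"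
  have iM: "integrable (PD d \<Otimes>\<^sub>M ?PZ) ?M"
    using T1i by (intro Bochner_Integration.integrable_add integrable_mult_right maj1 maj2) auto
  show iR: "integrable (PD d \<Otimes>\<^sub>M ?PZ) (\<lambda>(x, z). R x z)"
    by (rule Bochner_Integration.integrable_bound[OF iM Rm])
      (use order_trans[OF bound abs_ge_self] in \<open>auto intro!: AE_I2 simp del: times_divide_eq_left times_divide_eq_right\<close>)
  have "(\<integral>(x, z). \<bar>R x z\<bar> \<partial>(PD d \<Otimes>\<^sub>M ?PZ)) \<le> (\<integral>y. ?M y \<partial>(PD d \<Otimes>\<^sub>M ?PZ))"
  proof (rule integral_mono[OF _ iM])
    show "integrable (PD d \<Otimes>\<^sub>M ?PZ) (\<lambda>(x, z). \<bar>R x z\<bar>)"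
      using integrable_abs[OF iR] by (simp add: case_prod_beta')
  qed (use bound in auto)
  also have "\<dots> = h\<^sup>2 / 2 * (\<integral>y. \<bar>T1 y\<bar> \<partial>(PD d \<Otimes>\<^sub>M ?PZ)) + h\<^sup>2 / 2 * d * (\<integral>x. \<bar>T2 x\<bar> \<partial>PD d)
      + B / 6 * h ^ 3 * (d * (\<integral>z. \<bar>z\<bar> ^ 3 \<partial>std_normal))"
  proof -
    have i1: "integrable (PD d \<Otimes>\<^sub>M ?PZ) (\<lambda>y. h\<^sup>2 / 2 * \<bar>T1 y\<bar>)" using T1i by simp
    have i2: "integrable (PD d \<Otimes>\<^sub>M ?PZ) (\<lambda>y. h\<^sup>2 / 2 * d * (case y of (x, z) \<Rightarrow> \<bar>T2 x\<bar>))"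
      by (intro integrable_mult_right maj1)
    have i3: "integrable (PD d \<Otimes>\<^sub>M ?PZ) (\<lambda>y. B / 6 * h ^ 3 * (case y of (x, z) \<Rightarrow> T3 z))"
      by (intro integrable_mult_right maj2)
    show ?thesis
      unfolding Bochner_Integration.integral_add[OF Bochner_Integration.integrable_add[OF i1 i2] i3]
        Bochner_Integration.integral_add[OF i1 i2] integral_mult_right_zero maj1 maj2 T3 ..
  qed
  also have "\<dots> \<le> h\<^sup>2 / 2 * (2 * B * sqrt d) + h\<^sup>2 / 2 * d * (B / sqrt d + \<bar>(\<Sum>i<d. \<integral>x. (deriv ^^ 2) (\<psi> i) x \<partial>D) / d - m\<bar>)
      + B / 6 * h ^ 3 * (d * (\<integral>z. \<bar>z\<bar> ^ 3 \<partial>std_normal))"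
    by (intro add_mono mult_left_mono T1 T2 order_refl) auto
  also have "\<dots> = h\<^sup>2 / 2 * d * (3 * B / sqrt d + \<bar>(\<Sum>i<d. \<integral>x. (deriv ^^ 2) (\<psi> i) x \<partial>D) / d - m\<bar>)
      + B / 6 * h ^ 3 * d * (\<integral>z. \<bar>z\<bar> ^ 3 \<partial>std_normal)"
  proof -
    have "2 * B * sqrt d = 2 * B * (d / sqrt d)" by (simp add: real_div_sqrt)
    then have "2 * B * sqrt d = d * (2 * B / sqrt d)" by simp
    then show ?thesis by (simp add: algebra_simps)
  qed
  finally show "(\<integral>(x, z). \<bar>R x z\<bar> \<partial>(PD d \<Otimes>\<^sub>M ?PZ)) \<le>
      h\<^sup>2 / 2 * d * (3 * B / sqrt d + \<bar>(\<Sum>i<d. \<integral>x. (deriv ^^ 2) (\<psi> i) x \<partial>D) / d - m\<bar>)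
      + B / 6 * h ^ 3 * d * (\<integral>z. \<bar>z\<bar> ^ 3 \<partial>std_normal)" .
qed

end

section \<open>Moments of the error\<close>

locale target_error = target \<pi> for \<pi> :: "real \<Rightarrow> real" +
  fixes S :: "real \<Rightarrow> real \<Rightarrow> real"
  assumes S_measurable: "measurable_error S" and S_regular: "regular_error S"
begin

abbreviation "b1 \<equiv> beta1 \<pi> S"
abbreviation "b2 \<equiv> beta2 \<pi> S"

definition "S1 c x = deriv (\<lambda>y. S y c) x"
definition "S2 c x = (deriv ^^ 2) (\<lambda>y. S y c) x"
text \<open>The averages over a sequence of values of \<open>c\<close> of these two functions are all that the limit sees of that
sequence.\<close>

definition "mean_S2 c = (\<integral>x. S2 c x \<partial>D)"
definition "mean_S1_sq c = (\<integral>x. (S1 c x)\<^sup>2 \<partial>D)"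

lemma S_thrice: "c \<in> {0..1} \<Longrightarrow> thrice_differentiable (\<lambda>y. S y c)"
  using S_regular by (simp add: regular_error_def)

lemma S_bounds:
  obtains B where "0 \<le> B" "\<And>c x. c \<in> {0..1} \<Longrightarrow> \<bar>S1 c x\<bar> \<le> B" "\<And>c x. c \<in> {0..1} \<Longrightarrow> \<bar>S2 c x\<bar> \<le> B"
    "\<And>c x. c \<in> {0..1} \<Longrightarrow> \<bar>(deriv ^^ 3) (\<lambda>y. S y c) x\<bar> \<le> B"
proof -
  have "\<exists>B. \<forall>x. \<forall>\<gamma>\<in>{0..1}. \<bar>(deriv ^^ k) (\<lambda>y. S y \<gamma>) x\<bar> \<le> B" if "k \<in> {1, 2, 3}" for k
    using S_regular that unfolding regular_error_def by blast
  then obtain B1 B2 B3 where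
    B': "\<forall>x. \<forall>c\<in>{0..1}. \<bar>(deriv ^^ 1) (\<lambda>y. S y c) x\<bar> \<le> B1"
      "\<forall>x. \<forall>c\<in>{0..1}. \<bar>(deriv ^^ 2) (\<lambda>y. S y c) x\<bar> \<le> B2"
      "\<forall>x. \<forall>c\<in>{0..1}. \<bar>(deriv ^^ 3) (\<lambda>y. S y c) x\<bar> \<le> B3"
    by (meson insertCI)
  have B: "\<bar>S1 c x\<bar> \<le> B1" "\<bar>S2 c x\<bar> \<le> B2" "\<bar>(deriv ^^ 3) (\<lambda>y. S y c) x\<bar> \<le> B3" if "c \<in> {0..1}" for c x
    using B' that by (simp_all add: S1_def S2_def)
  show ?thesis
  proof (rule that[of "max (max B1 B2) (max B3 0)"])
    fix c x :: real assume c: "c \<in> {0..1}"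
    show "\<bar>S1 c x\<bar> \<le> max (max B1 B2) (max B3 0)" using B(1)[OF c, of x] by linarith
    show "\<bar>S2 c x\<bar> \<le> max (max B1 B2) (max B3 0)" using B(2)[OF c, of x] by linarith
    show "\<bar>(deriv ^^ 3) (\<lambda>y. S y c) x\<bar> \<le> max (max B1 B2) (max B3 0)" using B(3)[OF c, of x] by linarith
  qed simp
qed

lemma S_derivs:
  assumes "c \<in> {0..1}"
  shows "((\<lambda>y. S y c) has_real_derivative S1 c x) (at x)" "(S1 c has_real_derivative S2 c x) (at x)"
    "(S2 c has_real_derivative (deriv ^^ 3) (\<lambda>y. S y c) x) (at x)"
  using thrice_differentiable_derivs[OF S_thrice[OF assms]] by (simp_all add: S1_def[abs_def] S2_def[abs_def])

lemma S_section_measurable: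
  assumes "c \<in> {0..1}"
  shows "(\<lambda>y. S y c) \<in> borel_measurable borel" "S1 c \<in> borel_measurable borel" "S2 c \<in> borel_measurable borel"
  by (intro borel_measurable_continuous_onI continuous_on_of_derivative[OF S_derivs(1)[OF assms]]
    continuous_on_of_derivative[OF S_derivs(2)[OF assms]] continuous_on_of_derivative[OF S_derivs(3)[OF assms]])+

lemma space_uniform01: "space uniform01 = {0..1}"
  by (simp add: uniform01_def space_restrict_space)

lemma S_joint_measurable:
  "(\<lambda>(x, c). S1 c x) \<in> borel_measurable (D \<Otimes>\<^sub>M uniform01)" "(\<lambda>(x, c). S2 c x) \<in> borel_measurable (D \<Otimes>\<^sub>M uniform01)"
proof -
  have s: "sets (D \<Otimes>\<^sub>M uniform01) = sets (borel \<Otimes>\<^sub>M uniform01)"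
    by (intro sets_pair_measure_cong) auto
  have 0: "case_prod S \<in> borel_measurable (borel \<Otimes>\<^sub>M uniform01)"
    using S_measurable sets_pair_measure_cong[OF refl sets_uniform01, of "borel :: real measure"]
    by (simp add: measurable_error_def cong: measurable_cong_sets)
  have 1: "(\<lambda>(x, c). S1 c x) \<in> borel_measurable (borel \<Otimes>\<^sub>M uniform01)"
    unfolding S1_def
  proof (rule borel_measurable_partial_deriv[OF 0])
    show "(\<lambda>y. S y c) differentiable (at x)" if "c \<in> space uniform01" for c x
      using S_derivs(1)[of c x] that by (auto simp: space_uniform01 real_differentiable_def)
  qed
  have "(\<lambda>(x, c). deriv (\<lambda>y. (\<lambda>x c. S1 c x) y c) x) \<in> borel_measurable (borel \<Otimes>\<^sub>M uniform01)"
  proof (rule borel_measurable_partial_deriv)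
    show "case_prod (\<lambda>x c. S1 c x) \<in> borel_measurable (borel \<Otimes>\<^sub>M uniform01)" using 1 by simp
    show "(\<lambda>y. S1 c y) differentiable (at x)" if "c \<in> space uniform01" for c x
      using S_derivs(2)[of c x] that by (auto simp: space_uniform01 real_differentiable_def)
  qed
  moreover have "deriv (\<lambda>y. S1 c y) x = S2 c x" for c x
    by (simp add: S1_def[abs_def] S2_def numeral_2_eq_2)
  ultimately have 2: "(\<lambda>(x, c). S2 c x) \<in> borel_measurable (borel \<Otimes>\<^sub>M uniform01)" by simp
  show "(\<lambda>(x, c). S1 c x) \<in> borel_measurable (D \<Otimes>\<^sub>M uniform01)" "(\<lambda>(x, c). S2 c x) \<in> borel_measurable (D \<Otimes>\<^sub>M uniform01)"
    using 1 2 measurable_cong_sets[OF s refl, of "borel :: real measure"] by auto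
qed

sublocale U: prob_space uniform01 by (rule prob_space_uniform01)
sublocale DU: pair_prob_space D uniform01 by unfold_locales

lemma integrable_DU:
  fixes f :: "real \<times> real \<Rightarrow> real"
  assumes "f \<in> borel_measurable (D \<Otimes>\<^sub>M uniform01)" "\<And>x c. c \<in> {0..1} \<Longrightarrow> \<bar>f (x, c)\<bar> \<le> B"
  shows "integrable (D \<Otimes>\<^sub>M uniform01) f"
  using assms by (intro DU.integrable_const_bound[where B=B] AE_I2) (auto simp: space_pair_measure space_uniform01)

lemma mean_measurable [measurable]:
  "mean_S2 \<in> borel_measurable uniform01" "mean_S1_sq \<in> borel_measurable uniform01"
proof -
  have sw: "(\<lambda>(c, x). f x c) \<in> borel_measurable (uniform01 \<Otimes>\<^sub>M D)"
    if "(\<lambda>(x, c). f x c) \<in> borel_measurable (D \<Otimes>\<^sub>M uniform01)" for f :: "real \<Rightarrow> real \<Rightarrow> real"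
    using measurable_compose[OF measurable_pair_swap' that] by (simp add: case_prod_beta')
  have "(\<lambda>(c, x). (S1 c x)\<^sup>2) \<in> borel_measurable (uniform01 \<Otimes>\<^sub>M D)"
    using sw[OF S_joint_measurable(1)] by (simp add: case_prod_beta')
  then show "mean_S1_sq \<in> borel_measurable uniform01"
    unfolding mean_S1_sq_def[abs_def] by (rule D.borel_measurable_lebesgue_integral)
  show "mean_S2 \<in> borel_measurable uniform01"
    unfolding mean_S2_def[abs_def] by (rule D.borel_measurable_lebesgue_integral[OF sw[OF S_joint_measurable(2)]])
qed

lemma integral_mean_S2: "(\<integral>c. mean_S2 c \<partial>uniform01) = b1 * I\<^sup>2"
  and integrable_mean_S2: "integrable uniform01 mean_S2"
proof -
  obtain B where B: "0 \<le> B" "\<And>c x. c \<in> {0..1} \<Longrightarrow> \<bar>S2 c x\<bar> \<le> B" using S_bounds by metis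
  have int: "integrable (D \<Otimes>\<^sub>M uniform01) (\<lambda>(x, c). S2 c x)"
    using B by (intro integrable_DU[OF S_joint_measurable(2), where B=B]) auto
  show "integrable uniform01 mean_S2"
    using DU.integrable_snd[OF int] by (simp add: mean_S2_def[abs_def])
  show "(\<integral>c. mean_S2 c \<partial>uniform01) = b1 * I\<^sup>2"
    using DU.integral_snd[OF int] I_pos
    by (simp add: mean_S2_def beta1_def S2_def D_def)
qed

lemma integral_mean_S1_sq: "(\<integral>c. mean_S1_sq c \<partial>uniform01) = b2\<^sup>2 * I\<^sup>2"
  and integrable_mean_S1_sq: "integrable uniform01 mean_S1_sq"
proof -
  obtain B where B: "0 \<le> B" "\<And>c x. c \<in> {0..1} \<Longrightarrow> \<bar>S1 c x\<bar> \<le> B" using S_bounds by metis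
  have B': "(S1 c x)\<^sup>2 \<le> B\<^sup>2" if "c \<in> {0..1}" for c x
    using B(2)[OF that, of x] by (metis abs_ge_zero power2_abs power_mono)
  have int: "integrable (D \<Otimes>\<^sub>M uniform01) (\<lambda>(x, c). (S1 c x)\<^sup>2)"
    using B' S_joint_measurable(1)
    by (intro integrable_DU[where B="B\<^sup>2"]) (auto simp: case_prod_beta')
  show "integrable uniform01 mean_S1_sq"
    using DU.integrable_snd[OF int] by (simp add: mean_S1_sq_def[abs_def])
  have "0 \<le> (\<integral>(x, c). (S1 c x)\<^sup>2 \<partial>(D \<Otimes>\<^sub>M uniform01))"
    by (intro Bochner_Integration.integral_nonneg) auto
  then show "(\<integral>c. mean_S1_sq c \<partial>uniform01) = b2\<^sup>2 * I\<^sup>2"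
    using DU.integral_snd[OF int] I_pos
    by (simp add: mean_S1_sq_def beta2_def S1_def D_def)
qed

text \<open>Integration by parts turns the covariance of the score and the slope of the error into minus
the mean curvature of the error.\<close>

lemma integral_score_S1:
  assumes c: "c \<in> {0..1}"
  shows "integrable D (\<lambda>x. deriv l x * S1 c x)" and "(\<integral>x. deriv l x * S1 c x \<partial>D) = - mean_S2 c"
proof -
  obtain B where B: "0 \<le> B" "\<And>c x. c \<in> {0..1} \<Longrightarrow> \<bar>S1 c x\<bar> \<le> B" "\<And>c x. c \<in> {0..1} \<Longrightarrow> \<bar>S2 c x\<bar> \<le> B"
    using S_bounds by metis
  note [measurable] = S_section_measurable[OF c]
  show int: "integrable D (\<lambda>x. deriv l x * S1 c x)"
  proof (rule Bochner_Integration.integrable_bound)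
    show "integrable D (\<lambda>x. B * deriv l x)" using integrable_score by simp
    show "AE x in D. norm (deriv l x * S1 c x) \<le> norm (B * deriv l x)"
      using B(1) B(2)[OF c] by (intro AE_I2) (simp add: abs_mult mult.commute[of B] mult_left_mono)
  qed measurable
  show "(\<integral>x. deriv l x * S1 c x \<partial>D) = - mean_S2 c"
    unfolding mean_S2_def
    by (rule integral_by_parts_score[OF S_derivs(2)[OF c] continuous_on_of_derivative[OF S_derivs(3)[OF c]]])
      (use B c in \<open>auto intro!: int integrable_D_bounded[where B=B]\<close>)
qed

text \<open>This is the Cauchy-Schwarz inequality for the score and the slope of the error; it says that the limit
covariance is positive semidefinite. It is obtained by integrating the square of \<open>S1 + b1 * l'\<close>, whose
factor \<open>b1\<close> minimises the result.\<close>

lemma beta_le: "b1\<^sup>2 \<le> b2\<^sup>2"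
proof -
  obtain B where B: "0 \<le> B" "\<And>c x. c \<in> {0..1} \<Longrightarrow> \<bar>S1 c x\<bar> \<le> B" using S_bounds by metis
  have nn: "0 \<le> mean_S1_sq c - 2 * b1 * mean_S2 c + b1\<^sup>2 * I\<^sup>2" if c: "c \<in> {0..1}" for c
  proof -
    note [measurable] = S_section_measurable[OF c]
    have "(S1 c x)\<^sup>2 \<le> B\<^sup>2" for x
      using B(2)[OF c, of x] by (metis abs_ge_zero power2_abs power_mono)
    then have i1: "integrable D (\<lambda>x. (S1 c x)\<^sup>2)" by (intro integrable_D_bounded[where B="B\<^sup>2"]) auto
    have i2: "integrable D (\<lambda>x. 2 * b1 * (deriv l x * S1 c x))" using integral_score_S1(1)[OF c] by simp
    have i3: "integrable D (\<lambda>x. b1\<^sup>2 * (deriv l x)\<^sup>2)" using integrable_score_sq by simp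
    \<comment> \<open>The mixed term is known from integration by parts.\<close>
    have "0 \<le> (\<integral>x. (S1 c x + b1 * deriv l x)\<^sup>2 \<partial>D)" by simp
    also have "(\<lambda>x. (S1 c x + b1 * deriv l x)\<^sup>2) = (\<lambda>x. (S1 c x)\<^sup>2 + 2 * b1 * (deriv l x * S1 c x) + b1\<^sup>2 * (deriv l x)\<^sup>2)"
      by (auto simp: power2_eq_square algebra_simps)
    also have "(\<integral>x. (S1 c x)\<^sup>2 + 2 * b1 * (deriv l x * S1 c x) + b1\<^sup>2 * (deriv l x)\<^sup>2 \<partial>D) =
        mean_S1_sq c - 2 * b1 * mean_S2 c + b1\<^sup>2 * I\<^sup>2"
      using i1 i2 i3 by (simp add: mean_S1_sq_def integral_score_S1(2)[OF c] I_sq)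
    finally show ?thesis .
  qed
  have "0 \<le> (\<integral>c. mean_S1_sq c - 2 * b1 * mean_S2 c + b1\<^sup>2 * I\<^sup>2 \<partial>uniform01)"
    using nn by (intro integral_nonneg_AE AE_I2) (auto simp: space_uniform01)
  also have "\<dots> = b2\<^sup>2 * I\<^sup>2 - 2 * b1 * (b1 * I\<^sup>2) + b1\<^sup>2 * I\<^sup>2"
    using integrable_mean_S2 integrable_mean_S1_sq U.prob_space
    by (simp add: integral_mean_S2 integral_mean_S1_sq)
  also have "\<dots> = (b2\<^sup>2 - b1\<^sup>2) * I\<^sup>2" by (simp add: power2_eq_square algebra_simps)
  finally show ?thesis using I_pos by (simp add: zero_le_mult_iff)
qed

end

section \<open>Convergence of the acceptance rate\<close>

locale regular_dapsmrwm = target_error \<pi> S for \<pi> :: "real \<Rightarrow> real" and S :: "real \<Rightarrow> real \<Rightarrow> real" +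
  fixes p :: "real \<Rightarrow> real" and \<mu> :: real and \<gamma> :: "nat \<Rightarrow> real"
  assumes noise_density: "noise_density p" and \<mu>_positive: "0 < \<mu>" and \<gamma>: "\<And>i. \<gamma> i \<in> {0..1}"
    and average_S2: "(\<lambda>d. (\<Sum>i<d. mean_S2 (\<gamma> i)) / real d) \<longlonglongrightarrow> b1 * I\<^sup>2"
    and average_S1_sq: "(\<lambda>d. (\<Sum>i<d. mean_S1_sq (\<gamma> i)) / real d) \<longlonglongrightarrow> b2\<^sup>2 * I\<^sup>2"
begin

sublocale dapsmrwm \<pi> S p \<mu> \<gamma>
  by unfold_locales (use noise_density \<mu>_positive S_section_measurable(1)[OF \<gamma>] in auto)

abbreviation "G \<equiv> acceptance_given"

text \<open>The increment \<open>s\<close> enters both stages, whence the factor 2.\<close>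

lemma G_lipschitz: "\<bar>G q s - G q' s'\<bar> \<le> \<bar>q - q'\<bar> + 2 * \<bar>s - s'\<bar>"
proof -
  interpret W12: pair_prob_space W1 W2 by unfold_locales
  let ?f = "\<lambda>q s (y :: real \<times> real). F (q + s) * F ((fst y - snd y) - s)"
  have int: "integrable (W1 \<Otimes>\<^sub>M W2) (?f q s)" for q s
    by (rule W12.integrable_const_bound[where B=1])
      (auto intro!: mult_le_one F_nonneg F_le_1 simp: abs_mult abs_of_nonneg[OF F_nonneg])
  have pw: "\<bar>?f q s y - ?f q' s' y\<bar> \<le> \<bar>q - q'\<bar> + 2 * \<bar>s - s'\<bar>" for y
  proof -
    let ?w = "fst y - snd y"
    have "?f q s y - ?f q' s' y = (F (q + s) - F (q' + s')) * F (?w - s) + F (q' + s') * (F (?w - s) - F (?w - s'))"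
      by (simp add: algebra_simps)
    also have "\<bar>\<dots>\<bar> \<le> \<bar>F (q + s) - F (q' + s')\<bar> * 1 + 1 * \<bar>F (?w - s) - F (?w - s')\<bar>"
      by (intro order_trans[OF abs_triangle_ineq] add_mono)
        (auto simp: abs_mult abs_of_nonneg[OF F_nonneg] intro!: mult_left_le mult_left_le_one_le F_nonneg F_le_1)
    also have "\<dots> \<le> \<bar>q - q'\<bar> + 2 * \<bar>s - s'\<bar>"
    proof -
      have "\<bar>(q + s) - (q' + s')\<bar> \<le> \<bar>q - q'\<bar> + \<bar>s - s'\<bar>" by linarith
      moreover have "\<bar>(?w - s) - (?w - s')\<bar> = \<bar>s - s'\<bar>" by linarith
      ultimately show ?thesis
        using F_lipschitz[of "q + s" "q' + s'"] F_lipschitz[of "?w - s" "?w - s'"] by simp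
    qed
    finally show ?thesis .
  qed
  have eq: "G q s - G q' s' = (\<integral>y. ?f q s y - ?f q' s' y \<partial>(W1 \<Otimes>\<^sub>M W2))"
    unfolding acceptance_given_def case_prod_beta' by (rule Bochner_Integration.integral_diff[symmetric, OF int int])
  have "\<bar>G q s - G q' s'\<bar> \<le> (\<integral>y. \<bar>?f q s y - ?f q' s' y\<bar> \<partial>(W1 \<Otimes>\<^sub>M W2))"
    unfolding eq by (rule integral_abs_bound)
  also have "\<dots> \<le> \<bar>q - q'\<bar> + 2 * \<bar>s - s'\<bar>"
    using int pw by (intro W12.integral_le_const integrable_abs Bochner_Integration.integrable_diff) auto
  finally show ?thesis .
qed

text \<open>The limiting mean acceptance probability as a function of the covariance of the linear forms. The two
shifts are the limits of the quadratic terms.\<close>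

definition rate :: "real \<Rightarrow> real \<Rightarrow> real \<Rightarrow> real" where
  "rate A C B = (\<integral>(a, b). G (a - \<mu>\<^sup>2 / 2) (b + \<mu>\<^sup>2 / 2 * b1) \<partial>normal_pair A C B)"

lemma rate_bounds: "0 \<le> rate A C B" "rate A C B \<le> 1"
proof -
  interpret NP: prob_space "normal_pair A C B" by (rule prob_space_normal_pair)
  show "0 \<le> rate A C B"
    unfolding rate_def by (auto intro!: Bochner_Integration.integral_nonneg acceptance_given_bounds)
  have "rate A C B \<le> (\<integral>y. 1 \<partial>normal_pair A C B)"
    unfolding rate_def by (rule integral_mono') (auto intro: acceptance_given_bounds)
  then show "rate A C B \<le> 1" by (simp add: NP.prob_space)
qed

lemma rate_eq:
  "rate A C B = (\<integral>(x, y). G (sqrt A * x - \<mu>\<^sup>2 / 2)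
    (C / sqrt A * x + sqrt (B - (C / sqrt A)\<^sup>2) * y + \<mu>\<^sup>2 / 2 * b1) \<partial>(std_normal \<Otimes>\<^sub>M std_normal))"
  unfolding rate_def normal_pair_def by (subst integral_distr) (auto simp: case_prod_beta')

lemma rate_sequentially:
  assumes "A \<longlonglongrightarrow> A0" "C \<longlonglongrightarrow> C0" "B \<longlonglongrightarrow> B0" and A0: "0 < A0"
  shows "(\<lambda>n. rate (A n) (C n) (B n)) \<longlonglongrightarrow> rate A0 C0 B0"
  unfolding rate_eq
proof (rule integral_dominated_convergence[where w="\<lambda>_. 1"])
  interpret NN: pair_prob_space std_normal std_normal by unfold_locales
  show "integrable (std_normal \<Otimes>\<^sub>M std_normal) (\<lambda>_. 1 :: real)" by simp
  have contG: "(\<lambda>n. G (q n) (s n)) \<longlonglongrightarrow> G q0 s0" if q: "q \<longlonglongrightarrow> q0" and s: "s \<longlonglongrightarrow> s0" for q s q0 s0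
  proof (rule LIM_zero_cancel, rule Lim_null_comparison)
    show "\<forall>\<^sub>F n in sequentially. norm (G (q n) (s n) - G q0 s0) \<le> \<bar>q n - q0\<bar> + 2 * \<bar>s n - s0\<bar>"
      using G_lipschitz by auto
    have "(\<lambda>n. \<bar>q n - q0\<bar> + 2 * \<bar>s n - s0\<bar>) \<longlonglongrightarrow> \<bar>q0 - q0\<bar> + 2 * \<bar>s0 - s0\<bar>"
      by (intro tendsto_intros q s)
    then show "(\<lambda>n. \<bar>q n - q0\<bar> + 2 * \<bar>s n - s0\<bar>) \<longlonglongrightarrow> 0" by simp
  qed
  show "AE y in std_normal \<Otimes>\<^sub>M std_normal.
    (\<lambda>n. case y of (x, y) \<Rightarrow> G (sqrt (A n) * x - \<mu>\<^sup>2 / 2) (C n / sqrt (A n) * x + sqrt (B n - (C n / sqrt (A n))\<^sup>2) * y + \<mu>\<^sup>2 / 2 * b1)) \<longlonglongrightarrow>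
    (case y of (x, y) \<Rightarrow> G (sqrt A0 * x - \<mu>\<^sup>2 / 2) (C0 / sqrt A0 * x + sqrt (B0 - (C0 / sqrt A0)\<^sup>2) * y + \<mu>\<^sup>2 / 2 * b1))"
    unfolding case_prod_beta using A0 by (intro AE_I2 contG tendsto_intros assms) auto
  show "AE y in std_normal \<Otimes>\<^sub>M std_normal.
    norm (case y of (x, y) \<Rightarrow> G (sqrt (A n) * x - \<mu>\<^sup>2 / 2) (C n / sqrt (A n) * x + sqrt (B n - (C n / sqrt (A n))\<^sup>2) * y + \<mu>\<^sup>2 / 2 * b1)) \<le> 1" for n
    using acceptance_given_bounds by (auto simp: abs_of_nonneg)
qed measurable

text \<open>Continuity at one point, in a form that can be integrated: within \<open>\<delta>\<close> of that point the difference is at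
most \<open>e\<close>, and elsewhere it is at most 1, which is at most the distance divided by \<open>\<delta>\<close>. With it,
convergence of the random covariances in \<open>L\<^sup>1\<close> suffices.\<close>

lemma rate_continuous:
  assumes A0: "0 < A0" and e: "0 < e"
  obtains c where "0 < c" "\<And>A C B. \<bar>rate A C B - rate A0 C0 B0\<bar> \<le> e + c * (\<bar>A - A0\<bar> + \<bar>C - C0\<bar> + \<bar>B - B0\<bar>)"
proof -
  have "isCont (\<lambda>(A, C, B). rate A C B) (A0, C0, B0)"
    unfolding continuous_at_sequentially
  proof (intro allI impI)
    fix y :: "nat \<Rightarrow> real \<times> real \<times> real" assume y: "y \<longlonglongrightarrow> (A0, C0, B0)"
    have "(\<lambda>n. fst (y n)) \<longlonglongrightarrow> A0" "(\<lambda>n. fst (snd (y n))) \<longlonglongrightarrow> C0" "(\<lambda>n. snd (snd (y n))) \<longlonglongrightarrow> B0"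
      using tendsto_fst[OF y] tendsto_fst[OF tendsto_snd[OF y]] tendsto_snd[OF tendsto_snd[OF y]] by auto
    from rate_sequentially[OF this A0]
    show "((\<lambda>(A, C, B). rate A C B) \<circ> y) \<longlonglongrightarrow> (case (A0, C0, B0) of (A, C, B) \<Rightarrow> rate A C B)"
      by (simp add: comp_def case_prod_beta')
  qed
  then obtain \<delta> where \<delta>: "0 < \<delta>" and near: "\<And>z. dist z (A0, C0, B0) < \<delta> \<Longrightarrow>
      dist ((\<lambda>(A, C, B). rate A C B) z) (rate A0 C0 B0) < e"
    unfolding continuous_at_eps_delta using e by auto
  show ?thesis
  proof (rule that[of "1 / \<delta>"])
    show "0 < 1 / \<delta>" using \<delta> by simp
    fix A C B :: real
    define t where "t = \<bar>A - A0\<bar> + \<bar>C - C0\<bar> + \<bar>B - B0\<bar>"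
    have t0: "0 \<le> t" by (simp add: t_def)
    have "\<bar>rate A C B - rate A0 C0 B0\<bar> \<le> e + 1 / \<delta> * t"
    proof (cases "t < \<delta>")
      case True
      have "dist (A, C, B) (A0, C0, B0) \<le> dist A A0 + dist (C, B) (C0, B0)"
        unfolding dist_Pair_Pair[of A] by (rule sqrt_sum_squares_le_sum) auto
      also have "\<dots> \<le> dist A A0 + (dist C C0 + dist B B0)"
        unfolding dist_Pair_Pair[of C] by (intro add_left_mono sqrt_sum_squares_le_sum) auto
      also have "\<dots> = t" by (simp add: t_def dist_real_def)
      finally have "dist (rate A C B) (rate A0 C0 B0) < e" using near[of "(A, C, B)"] True by simp
      moreover have "0 \<le> 1 / \<delta> * t" using t0 \<delta> by simp
      ultimately show ?thesis by (simp add: dist_real_def)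
    next
      case False
      then have "1 \<le> 1 / \<delta> * t" using \<delta> by (simp add: field_simps)
      moreover have "\<bar>rate A C B - rate A0 C0 B0\<bar> \<le> 1"
        using rate_bounds[of A C B] rate_bounds[of A0 C0 B0] by (simp add: abs_le_iff)
      ultimately show ?thesis using e by linarith
    qed
    then show "\<bar>rate A C B - rate A0 C0 B0\<bar> \<le> e + 1 / \<delta> * (\<bar>A - A0\<bar> + \<bar>C - C0\<bar> + \<bar>B - B0\<bar>)"
      by (simp add: t_def)
  qed
qed

lemma alpha12_eq_rate: "alpha12 \<pi> S p \<mu> = rate (\<mu>\<^sup>2) (- \<mu>\<^sup>2 * b1) (\<mu>\<^sup>2 * b2\<^sup>2)"
proof -
  let ?L = "limit_law \<mu> b1 b2"
  have D: "distr ?L (borel \<Otimes>\<^sub>M borel) (\<lambda>v. (v $ 1 + \<mu>\<^sup>2 / 2, v $ 2 - \<mu>\<^sup>2 / 2 * b1)) =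
    normal_pair (\<mu>\<^sup>2) (- \<mu>\<^sup>2 * b1) (\<mu>\<^sup>2 * b2\<^sup>2)"
    by (rule distr_limit_law[OF \<mu>_pos beta_le])
  have sL [measurable_cong, simp]: "sets ?L = sets borel"
    by (simp add: limit_law_def normal_vector_def)
  have m [measurable]: "(\<lambda>v :: real ^ 2. (v $ 1 + \<mu>\<^sup>2 / 2, v $ 2 - \<mu>\<^sup>2 / 2 * b1)) \<in> ?L \<rightarrow>\<^sub>M borel \<Otimes>\<^sub>M borel"
    by measurable
  interpret L: prob_space ?L
    by (rule prob_space_distrD[OF m]) (unfold D, rule prob_space_normal_pair)
  interpret W12: pair_prob_space W1 W2 by unfold_locales
  interpret LW: pair_prob_space ?L "W1 \<Otimes>\<^sub>M W2" by unfold_locales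
  let ?f = "\<lambda>(v :: real ^ 2, w', w). F (v $ 1 + v $ 2) * F ((w' - w) - v $ 2)"
  have [measurable]: "(\<lambda>v :: real ^ 2. v $ i) \<in> borel_measurable borel" for i
    by (intro borel_measurable_continuous_onI continuous_intros)
  have "?f \<in> borel_measurable (borel \<Otimes>\<^sub>M borel \<Otimes>\<^sub>M borel)" by measurable
  moreover have "sets (?L \<Otimes>\<^sub>M W1 \<Otimes>\<^sub>M W2) = sets (borel \<Otimes>\<^sub>M borel \<Otimes>\<^sub>M borel)"
    by (intro sets_pair_measure_cong) auto
  ultimately have fm: "?f \<in> borel_measurable (?L \<Otimes>\<^sub>M W1 \<Otimes>\<^sub>M W2)"
    by (simp cong: measurable_cong_sets)
  have int: "integrable (?L \<Otimes>\<^sub>M W1 \<Otimes>\<^sub>M W2) ?f"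
    by (rule LW.integrable_const_bound[where B=1, OF _ fm])
      (auto intro!: mult_le_one F_nonneg F_le_1 simp: abs_mult abs_of_nonneg[OF F_nonneg])
  have "alpha12 \<pi> S p \<mu> = (\<integral>y. ?f y \<partial>(?L \<Otimes>\<^sub>M W1 \<Otimes>\<^sub>M W2))"
    by (simp add: alpha12_def W1_def W2_def)
  also have "\<dots> = (\<integral>v. G (v $ 1) (v $ 2) \<partial>?L)"
    unfolding acceptance_given_def LW.integral_fst'[OF int, symmetric] by simp
  also have "\<dots> = (\<integral>v. (\<lambda>(a, b). G (a - \<mu>\<^sup>2 / 2) (b + \<mu>\<^sup>2 / 2 * b1)) (v $ 1 + \<mu>\<^sup>2 / 2, v $ 2 - \<mu>\<^sup>2 / 2 * b1) \<partial>?L)"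
    by simp
  also have "\<dots> = rate (\<mu>\<^sup>2) (- \<mu>\<^sup>2 * b1) (\<mu>\<^sup>2 * b2\<^sup>2)"
    unfolding rate_def D[symmetric] by (rule integral_distr[symmetric]) measurable
  finally show ?thesis .
qed


definition scale :: "nat \<Rightarrow> real" where "scale d = \<mu> / sqrt (real d) / I"

lemma scale_nonneg: "0 \<le> scale d"
  using \<mu>_pos I_pos by (simp add: scale_def)

lemma scale_sq: "0 < d \<Longrightarrow> (scale d)\<^sup>2 * d = (\<mu> / I)\<^sup>2"
  by (simp add: scale_def power_divide power_mult_distrib)

lemma prop_coordinate: "i < d \<Longrightarrow> prop d x z i = x i + scale d * z i"
  by (simp add: proposal_def scale_def)

lemma q_Delta_sum: "q_Delta \<pi> d x x' = (\<Sum>i<d. l (x' i) - l (x i))"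
proof -
  have [simp]: "\<pi> x \<noteq> 0" for x using pos[of x] by simp
  have "ln (\<Prod>i<d. \<pi> (y i)) = (\<Sum>i<d. l (y i))" for y
    by (subst ln_prod) (auto simp: l_def pos)
  then show ?thesis
    unfolding q_Delta_def by (subst ln_div) (auto intro!: prod_pos pos simp: sum_subtractf)
qed

lemma s_Delta_sum: "s_Delta S \<gamma> d x x' = (\<Sum>i<d. S (x' i) (\<gamma> i) - S (x i) (\<gamma> i))"
  by (simp add: s_Delta_def sum_subtractf)

definition "linear_q d x z = scale d * (\<Sum>i<d. deriv l (x i) * z i)"
definition "linear_s d x z = scale d * (\<Sum>i<d. S1 (\<gamma> i) (x i) * z i)"

lemma S1_\<gamma>_measurable [measurable]: "S1 (\<gamma> i) \<in> borel_measurable borel" "S2 (\<gamma> i) \<in> borel_measurable borel"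
  using S_section_measurable[OF \<gamma>] by auto

abbreviation "prop_rate d x z \<equiv> G (q_Delta \<pi> d x (prop d x z)) (s_Delta S \<gamma> d x (prop d x z))"
abbreviation "linear_rate d x z \<equiv> G (linear_q d x z - \<mu>\<^sup>2 / 2) (linear_s d x z + \<mu>\<^sup>2 / 2 * b1)"

lemma linear_measurable [measurable]:
  "(\<lambda>(x, z). linear_q d x z) \<in> borel_measurable (PXZ d)"
  "(\<lambda>(x, z). linear_s d x z) \<in> borel_measurable (PXZ d)"
proof -
  have [measurable]: "(\<lambda>x. x i) \<in> borel_measurable (PX d)" "(\<lambda>x. x i) \<in> borel_measurable (PZ d)" if "i < d" for i
    using that by auto
  show "(\<lambda>(x, z). linear_q d x z) \<in> borel_measurable (PXZ d)"
    "(\<lambda>(x, z). linear_s d x z) \<in> borel_measurable (PXZ d)"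
    unfolding linear_q_def linear_s_def by measurable
qed

lemma replace_sum_of_squares:
  assumes d: "0 < d"
  shows "\<bar>(\<integral>(x, z). (\<Sum>i<d. (z i)\<^sup>2) / d * prop_rate d x z \<partial>(PXZ d))
     - (\<integral>(x, z). prop_rate d x z \<partial>(PXZ d))\<bar> \<le> sqrt 2 / sqrt d"
proof -
  interpret X: prob_space "PX d" by (rule prob_PX)
  interpret Z: prob_space "PZ d" by (rule prob_PZ)
  interpret XZ: pair_prob_space "PX d" "PZ d" by unfold_locales
  let ?P = "PXZ d"
  define g where "g = (\<lambda>(x, z). prop_rate d x z)"
  have gm [measurable]: "g \<in> borel_measurable ?P" unfolding g_def by measurable
  have gb: "0 \<le> g y" "g y \<le> 1" for y by (auto simp: g_def case_prod_beta acceptance_given_bounds)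
  have ig: "integrable ?P g" using gb by (intro XZ.integrable_const_bound[where B=1]) auto
  define t where "t z = (\<Sum>i<d. (z i)\<^sup>2 - 1)" for z :: "nat \<Rightarrow> real"
  have it: "integrable (PZ d) t" unfolding t_def[abs_def]
    by (intro Bochner_Integration.integrable_sum N.integrable_component(1)[where g="\<lambda>z. z\<^sup>2 - 1"] std_normal_moments) auto
  have it': "integrable ?P (\<lambda>(x, z). \<bar>t z\<bar> / d)" "(\<integral>(x, z). \<bar>t z\<bar> / d \<partial>?P) = (\<integral>z. \<bar>t z\<bar> / d \<partial>PZ d)"
    using XZ.integral_snd_only[of "\<lambda>z. \<bar>t z\<bar> / d"] it by auto
  have tq: "(\<Sum>i<d. (z i)\<^sup>2) / d = 1 + t z / d" for z
    using d by (simp add: t_def sum_subtractf diff_divide_distrib)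
  have tm [measurable]: "(\<lambda>y. t (snd y)) \<in> borel_measurable ?P"
    using it by (intro measurable_compose[OF measurable_snd]) auto
  have itg: "integrable ?P (\<lambda>y. t (snd y) / d * g y)"
  proof (rule Bochner_Integration.integrable_bound[OF it'(1)])
    show "AE y in ?P. norm (t (snd y) / d * g y) \<le> norm (case y of (x, z) \<Rightarrow> \<bar>t z\<bar> / d)"
      using gb by (intro AE_I2) (auto simp: abs_mult case_prod_beta intro!: mult_left_le divide_right_mono)
  qed measurable
  have "(\<integral>(x, z). (\<Sum>i<d. (z i)\<^sup>2) / d * prop_rate d x z \<partial>?P)
      = (\<integral>y. g y + t (snd y) / d * g y \<partial>?P)"
    unfolding tq by (simp add: g_def case_prod_beta' distrib_right)
  also have "\<dots> = (\<integral>y. g y \<partial>?P) + (\<integral>y. t (snd y) / d * g y \<partial>?P)"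
    by (rule Bochner_Integration.integral_add[OF ig itg])
  finally have eq: "(\<integral>(x, z). (\<Sum>i<d. (z i)\<^sup>2) / d * prop_rate d x z \<partial>?P)
      - (\<integral>y. g y \<partial>?P) = (\<integral>y. t (snd y) / d * g y \<partial>?P)" by simp
  have "\<bar>\<integral>y. t (snd y) / d * g y \<partial>?P\<bar> \<le> (\<integral>y. \<bar>t (snd y) / d * g y\<bar> \<partial>?P)"
    by (rule integral_abs_bound)
  also have "\<dots> \<le> (\<integral>(x, z). \<bar>t z\<bar> / d \<partial>?P)"
    by (rule integral_mono[OF integrable_abs[OF itg] it'(1)])
      (use gb in \<open>auto simp: abs_mult intro!: mult_left_le divide_right_mono\<close>)
  also have "\<dots> = (\<integral>z. \<bar>t z\<bar> \<partial>PZ d) / d" unfolding it' by simp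
  also have "\<dots> \<le> sqrt (real (card {..<d}) * 2) / d"
    unfolding t_def
    by (intro divide_right_mono N.expectation_abs_sum_centred_le std_normal_moments
        eq_refl[OF std_normal_moments(4)] finite_lessThan of_nat_0_le_iff)
  also have "\<dots> = sqrt 2 / sqrt d"
    using d by (simp add: real_sqrt_mult field_simps)
  finally show ?thesis using eq by (simp add: g_def)
qed

section \<open>The limit of the expected squared jumping distance\<close>

lemma replace_by_linear:
  obtains e where "e \<longlonglongrightarrow> 0"
   "\<And>d. 0 < d \<Longrightarrow> \<bar>(\<integral>(x, z). prop_rate d x z \<partial>(PXZ d)) -
     (\<integral>(x, z). linear_rate d x z \<partial>(PXZ d))\<bar> \<le> e d"
proof -
  obtain Bl where Bl: "\<And>x. \<bar>(deriv ^^ 2) l x\<bar> \<le> Bl" "\<And>x. \<bar>(deriv ^^ 3) l x\<bar> \<le> Bl" using l_bounds by metis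
  obtain B where B: "0 \<le> B" "\<And>c x. c \<in> {0..1} \<Longrightarrow> \<bar>S2 c x\<bar> \<le> B"
    "\<And>c x. c \<in> {0..1} \<Longrightarrow> \<bar>(deriv ^^ 3) (\<lambda>y. S y c) x\<bar> \<le> B" using S_bounds by metis
  define c3 where "c3 = (\<integral>z. \<bar>z\<bar> ^ 3 \<partial>std_normal)"
  define eq where "eq d = (\<mu> / I)\<^sup>2 / 2 * (3 * Bl / sqrt d) + Bl / 6 * ((\<mu> / I) ^ 3 / sqrt d) * c3" for d :: nat
  define es where "es d = (\<mu> / I)\<^sup>2 / 2 * (3 * B / sqrt d + \<bar>(\<Sum>i<d. mean_S2 (\<gamma> i)) / d - b1 * I\<^sup>2\<bar>)
    + B / 6 * ((\<mu> / I) ^ 3 / sqrt d) * c3" for d :: nat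
  have inv0: "(\<lambda>d. k / sqrt (real d)) \<longlonglongrightarrow> 0" for k :: real by real_asymp
  have eq0: "eq \<longlonglongrightarrow> 0"
  proof -
    have "eq \<longlonglongrightarrow> (\<mu> / I)\<^sup>2 / 2 * 0 + Bl / 6 * 0 * c3"
      unfolding eq_def[abs_def] by (intro tendsto_intros inv0)
    then show ?thesis by simp
  qed
  have es0: "es \<longlonglongrightarrow> 0"
  proof -
    have "es \<longlonglongrightarrow> (\<mu> / I)\<^sup>2 / 2 * (0 + \<bar>b1 * I\<^sup>2 - b1 * I\<^sup>2\<bar>) + B / 6 * 0 * c3"
      unfolding es_def[abs_def] by (intro tendsto_intros inv0 average_S2)
    then show ?thesis by simp
  qed
  have e0: "(\<lambda>d. eq d + 2 * es d) \<longlonglongrightarrow> 0"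
    using tendsto_add[OF eq0 tendsto_mult[OF tendsto_const es0, of 2]] by simp
  show ?thesis
  proof (rule that[OF e0])
    fix d :: nat assume d: "0 < d"
    interpret X: prob_space "PX d" by (rule prob_PX)
    interpret Z: prob_space "PZ d" by (rule prob_PZ)
    interpret XZ: pair_prob_space "PX d" "PZ d" by unfold_locales
    let ?P = "PXZ d"
    have h2: "(scale d)\<^sup>2 / 2 * d = (\<mu> / I)\<^sup>2 / 2" using scale_sq[OF d] by simp
    have h3: "(scale d) ^ 3 * d = (\<mu> / I) ^ 3 / sqrt d"
    proof -
      have "(scale d) ^ 3 * d = scale d * ((scale d)\<^sup>2 * d)" by (simp add: power3_eq_cube power2_eq_square)
      also have "\<dots> = (\<mu> / I) ^ 3 / sqrt d"
        unfolding scale_sq[OF d] by (simp add: scale_def power3_eq_cube power2_eq_square mult_ac)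
      finally show ?thesis .
    qed
    define Rq where "Rq = (\<lambda>x z. (\<Sum>i<d. l (x i + scale d * z i) - l (x i)) - scale d * (\<Sum>i<d. deriv l (x i) * z i) - (scale d)\<^sup>2 / 2 * d * - I\<^sup>2)"
    define Rs where "Rs = (\<lambda>x z. (\<Sum>i<d. S (x i + scale d * z i) (\<gamma> i) - S (x i) (\<gamma> i)) - scale d * (\<Sum>i<d. deriv (\<lambda>y. S y (\<gamma> i)) (x i) * z i) - (scale d)\<^sup>2 / 2 * d * (b1 * I\<^sup>2))"
    have Rq: "integrable ?P (\<lambda>(x, z). Rq x z)" "(\<integral>(x, z). \<bar>Rq x z\<bar> \<partial>?P) \<le> eq d"
    proof -
      have iq: "(\<integral>x. (deriv ^^ 2) l x \<partial>D) = - I\<^sup>2" by (rule integral_l2)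
      show "integrable ?P (\<lambda>(x, z). Rq x z)"
        unfolding Rq_def by (rule expansion_L1(1)[where \<psi>="\<lambda>_. l" and B=Bl]) (use thrice_l Bl d scale_nonneg in auto)
      have "(\<integral>(x, z). \<bar>Rq x z\<bar> \<partial>?P) \<le> (scale d)\<^sup>2 / 2 * d * (3 * Bl / sqrt d + \<bar>(\<Sum>i<d. \<integral>x. (deriv ^^ 2) l x \<partial>D) / d - - I\<^sup>2\<bar>)
          + Bl / 6 * scale d ^ 3 * d * c3"
        unfolding Rq_def c3_def by (rule expansion_L1(2)[where \<psi>="\<lambda>_. l" and B=Bl]) (use thrice_l Bl d scale_nonneg in auto)
      also have "\<dots> = eq d"
        using d unfolding h2 iq eq_def mult.assoc[of _ "scale d ^ 3"] h3 by simp
      finally show "(\<integral>(x, z). \<bar>Rq x z\<bar> \<partial>?P) \<le> eq d" .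
    qed
    have Rs: "integrable ?P (\<lambda>(x, z). Rs x z)" "(\<integral>(x, z). \<bar>Rs x z\<bar> \<partial>?P) \<le> es d"
    proof -
      have B': "\<bar>(deriv ^^ 2) (\<lambda>y. S y (\<gamma> i)) x\<bar> \<le> B" for i x using B(2)[OF \<gamma>] by (simp add: S2_def)
      show "integrable ?P (\<lambda>(x, z). Rs x z)"
        unfolding Rs_def
        by (rule expansion_L1(1)[where \<psi>="\<lambda>i y. S y (\<gamma> i)" and B=B]) (use S_thrice[OF \<gamma>] B' B(3)[OF \<gamma>] d scale_nonneg in auto)
      have "(\<integral>(x, z). \<bar>Rs x z\<bar> \<partial>?P) \<le> (scale d)\<^sup>2 / 2 * d * (3 * B / sqrt d + \<bar>(\<Sum>i<d. \<integral>x. (deriv ^^ 2) (\<lambda>y. S y (\<gamma> i)) x \<partial>D) / d - b1 * I\<^sup>2\<bar>)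
          + B / 6 * scale d ^ 3 * d * c3"
        unfolding Rs_def c3_def
        by (rule expansion_L1(2)[where \<psi>="\<lambda>i y. S y (\<gamma> i)" and B=B]) (use S_thrice[OF \<gamma>] B' B(3)[OF \<gamma>] d scale_nonneg in auto)
      also have "\<dots> = es d"
        unfolding h2 es_def mult.assoc[of _ "scale d ^ 3"] h3 mean_S2_def S2_def ..
      finally show "(\<integral>(x, z). \<bar>Rs x z\<bar> \<partial>?P) \<le> es d" .
    qed
    have mu2: "(scale d)\<^sup>2 / 2 * d * I\<^sup>2 = \<mu>\<^sup>2 / 2"
      unfolding h2 using I_pos by (simp add: power_divide)
    have dq: "q_Delta \<pi> d x (prop d x z) - (linear_q d x z - \<mu>\<^sup>2 / 2) = Rq x z" for x z
      using mu2 by (simp add: q_Delta_sum Rq_def linear_q_def prop_coordinate)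
    have ds: "s_Delta S \<gamma> d x (prop d x z) - (linear_s d x z + \<mu>\<^sup>2 / 2 * b1) = Rs x z" for x z
    proof -
      have "(scale d)\<^sup>2 / 2 * d * (b1 * I\<^sup>2) = \<mu>\<^sup>2 / 2 * b1" unfolding mu2[symmetric] by (simp only: mult_ac)
      then have "Rs x z = (\<Sum>i<d. S (x i + scale d * z i) (\<gamma> i) - S (x i) (\<gamma> i))
          - scale d * (\<Sum>i<d. deriv (\<lambda>y. S y (\<gamma> i)) (x i) * z i) - \<mu>\<^sup>2 / 2 * b1"
        unfolding Rs_def by (simp only:)
      then show ?thesis by (simp add: s_Delta_sum linear_s_def prop_coordinate S1_def)
    qed
    define g1 where "g1 = (\<lambda>(x, z). prop_rate d x z)"
    define g2 where "g2 = (\<lambda>(x, z). linear_rate d x z)"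
    have [measurable]: "g1 \<in> borel_measurable ?P" unfolding g1_def by measurable
    have [measurable]: "g2 \<in> borel_measurable ?P" unfolding g2_def by measurable
    have ig: "integrable ?P g1" "integrable ?P g2"
      by (rule XZ.integrable_const_bound[where B=1]; auto simp: g1_def g2_def acceptance_given_bounds)+
    have pw: "\<bar>g1 y - g2 y\<bar> \<le> \<bar>case_prod Rq y\<bar> + 2 * \<bar>case_prod Rs y\<bar>" for y
      using G_lipschitz[of "q_Delta \<pi> d (fst y) (prop d (fst y) (snd y))" "s_Delta S \<gamma> d (fst y) (prop d (fst y) (snd y))"
          "linear_q d (fst y) (snd y) - \<mu>\<^sup>2 / 2" "linear_s d (fst y) (snd y) + \<mu>\<^sup>2 / 2 * b1"]
      unfolding dq ds by (simp add: g1_def g2_def case_prod_beta)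
    have iRq: "integrable ?P (\<lambda>y. \<bar>case_prod Rq y\<bar>)" and iRs: "integrable ?P (\<lambda>y. 2 * \<bar>case_prod Rs y\<bar>)"
      using Rq(1) Rs(1) by auto
    have "\<bar>(\<integral>y. g1 y \<partial>?P) - (\<integral>y. g2 y \<partial>?P)\<bar> = \<bar>\<integral>y. g1 y - g2 y \<partial>?P\<bar>"
      by (simp only: Bochner_Integration.integral_diff[OF ig])
    also have "\<dots> \<le> (\<integral>y. \<bar>g1 y - g2 y\<bar> \<partial>?P)" by (rule integral_abs_bound)
    also have "\<dots> \<le> (\<integral>y. \<bar>case_prod Rq y\<bar> + 2 * \<bar>case_prod Rs y\<bar> \<partial>?P)"
      by (rule integral_mono[OF _ _ pw])
        (intro integrable_abs Bochner_Integration.integrable_diff ig Bochner_Integration.integrable_add iRq iRs)+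
    also have "\<dots> = (\<integral>y. \<bar>case_prod Rq y\<bar> \<partial>?P) + 2 * (\<integral>y. \<bar>case_prod Rs y\<bar> \<partial>?P)"
      unfolding Bochner_Integration.integral_add[OF iRq iRs] by simp
    also have "\<dots> \<le> eq d + 2 * es d"
      using Rq(2) Rs(2) by (simp add: case_prod_beta')
    finally show "\<bar>(\<integral>(x, z). prop_rate d x z \<partial>?P) -
     (\<integral>(x, z). linear_rate d x z \<partial>?P)\<bar> \<le> eq d + 2 * es d"
      by (simp add: g1_def g2_def)
  qed
qed

text \<open>Given \<open>x\<close>, the linear parts are jointly normal, with their Gram matrix as covariance.\<close>

lemma integral_linear_rate:
  "(\<integral>(x, z). linear_rate d x z \<partial>(PXZ d)) =
   (\<integral>x. rate ((scale d)\<^sup>2 * (\<Sum>i<d. (deriv l (x i))\<^sup>2)) ((scale d)\<^sup>2 * (\<Sum>i<d. deriv l (x i) * S1 (\<gamma> i) (x i)))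
      ((scale d)\<^sup>2 * (\<Sum>i<d. (S1 (\<gamma> i) (x i))\<^sup>2)) \<partial>PX d)" (is ?eq)
  and integrable_linear_rate:
  "integrable (PX d) (\<lambda>x. rate ((scale d)\<^sup>2 * (\<Sum>i<d. (deriv l (x i))\<^sup>2)) ((scale d)\<^sup>2 * (\<Sum>i<d. deriv l (x i) * S1 (\<gamma> i) (x i)))
      ((scale d)\<^sup>2 * (\<Sum>i<d. (S1 (\<gamma> i) (x i))\<^sup>2)))" (is ?int)
proof -
  interpret X: prob_space "PX d" by (rule prob_PX)
  interpret Z: prob_space "PZ d" by (rule prob_PZ)
  interpret XZ: pair_prob_space "PX d" "PZ d" by unfold_locales
  let ?P = "PXZ d"
  define g where "g = (\<lambda>(x, z). linear_rate d x z)"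
  have [measurable]: "g \<in> borel_measurable ?P" unfolding g_def by measurable
  have ig: "integrable ?P g"
    by (rule XZ.integrable_const_bound[where B=1]; auto simp: g_def acceptance_given_bounds)
  have inner: "(\<integral>z. g (x, z) \<partial>PZ d) = rate ((scale d)\<^sup>2 * (\<Sum>i<d. (deriv l (x i))\<^sup>2))
      ((scale d)\<^sup>2 * (\<Sum>i<d. deriv l (x i) * S1 (\<gamma> i) (x i))) ((scale d)\<^sup>2 * (\<Sum>i<d. (S1 (\<gamma> i) (x i))\<^sup>2))" for x
  proof -
    define u where "u i = scale d * deriv l (x i)" for i
    define v where "v i = scale d * S1 (\<gamma> i) (x i)" for i
    have A: "(scale d)\<^sup>2 * (\<Sum>i<d. (deriv l (x i))\<^sup>2) = (\<Sum>i<d. (u i)\<^sup>2)"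
      and C: "(scale d)\<^sup>2 * (\<Sum>i<d. deriv l (x i) * S1 (\<gamma> i) (x i)) = (\<Sum>i<d. u i * v i)"
      and B: "(scale d)\<^sup>2 * (\<Sum>i<d. (S1 (\<gamma> i) (x i))\<^sup>2) = (\<Sum>i<d. (v i)\<^sup>2)"
      unfolding sum_distrib_left u_def v_def by (auto intro!: sum.cong simp: power2_eq_square)
    have lin: "linear_q d x z = (\<Sum>i<d. u i * z i)" "linear_s d x z = (\<Sum>i<d. v i * z i)" for z
      unfolding linear_q_def linear_s_def sum_distrib_left u_def v_def by (auto intro!: sum.cong)
    have [measurable]: "(\<lambda>z. z i) \<in> borel_measurable (PZ d)" if "i < d" for i using that by auto
    have "(\<integral>z. g (x, z) \<partial>PZ d) =
      (\<integral>z. (\<lambda>(a, b). G (a - \<mu>\<^sup>2 / 2) (b + \<mu>\<^sup>2 / 2 * b1)) (\<Sum>i<d. u i * z i, \<Sum>i<d. v i * z i) \<partial>PZ d)"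
      by (simp add: g_def lin)
    also have "\<dots> = rate (\<Sum>i<d. (u i)\<^sup>2) (\<Sum>i<d. u i * v i) (\<Sum>i<d. (v i)\<^sup>2)"
      unfolding rate_def distr_PiM_std_normal_pair[symmetric]
      by (rule integral_distr[symmetric]) measurable
    finally show ?thesis unfolding A B C .
  qed
  show ?eq
    unfolding inner[symmetric] XZ.integral_fst'[OF ig] by (simp add: g_def)
  show ?int
    unfolding inner[symmetric] by (rule XZ.integrable_fst'[OF ig])
qed

text \<open>Each entry of the Gram matrix is an average over the coordinates of \<open>x\<close> multiplied by \<open>(\<mu> / I)\<^sup>2\<close>. For the
squared score the weak law applies; the two entries that involve the error have bounded second moments,
and their means are averages over \<open>\<gamma>\<close> that converge by hypothesis.\<close>

lemma linear_rate_tendsto: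
  "(\<lambda>d. \<integral>(x, z). linear_rate d x z \<partial>(PXZ d))
     \<longlonglongrightarrow> rate (\<mu>\<^sup>2) (- \<mu>\<^sup>2 * b1) (\<mu>\<^sup>2 * b2\<^sup>2)" (is "?E \<longlonglongrightarrow> ?r")
proof -
  obtain B where B: "0 \<le> B" "\<And>c x. c \<in> {0..1} \<Longrightarrow> \<bar>S1 c x\<bar> \<le> B" using S_bounds by metis
  define k where "k = (\<mu> / I)\<^sup>2"
  have k0: "0 \<le> k" by (simp add: k_def)
  have k: "k * I\<^sup>2 = \<mu>\<^sup>2" using I_pos by (simp add: k_def power_divide)
  define fA where "fA d x = (\<Sum>i<d. (deriv l (x i))\<^sup>2) / d - I\<^sup>2" for d :: nat and x :: "nat \<Rightarrow> real"
  define fC where "fC d x = (\<Sum>i<d. deriv l (x i) * S1 (\<gamma> i) (x i)) / d - (- (b1 * I\<^sup>2))" for d :: nat and x :: "nat \<Rightarrow> real"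
  define fB where "fB d x = (\<Sum>i<d. (S1 (\<gamma> i) (x i))\<^sup>2) / d - b2\<^sup>2 * I\<^sup>2" for d :: nat and x :: "nat \<Rightarrow> real"
  have lim_A: "(\<lambda>d. \<integral>x. \<bar>fA d x\<bar> \<partial>PX d) \<longlonglongrightarrow> 0"
    using D.weak_law_L1[OF integrable_score_sq] unfolding fA_def I_sq .
  have int_A: "integrable (PX d) (fA d)" for d
  proof -
    interpret X: prob_space "PX d" by (rule prob_PX)
    have "integrable (PX d) (\<lambda>x. (deriv l (x i))\<^sup>2)" if "i < d" for i
      using that by (intro D.integrable_component(1)[where g="\<lambda>x. (deriv l x)\<^sup>2"] integrable_score_sq) auto
    then show ?thesis
      unfolding fA_def[abs_def]
      by (intro Bochner_Integration.integrable_diff integrable_divide Bochner_Integration.integrable_sum) auto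
  qed
  have S1sq: "(S1 (\<gamma> i) x)\<^sup>2 \<le> B\<^sup>2" for i x
    using B(2)[OF \<gamma>, of i x] by (metis abs_ge_zero power2_abs power_mono)
  have iC: "integrable D (\<lambda>x. (deriv l x * S1 (\<gamma> i) x)\<^sup>2)" for i
  proof (rule Bochner_Integration.integrable_bound)
    show "integrable D (\<lambda>x. (deriv l x)\<^sup>2 * B\<^sup>2)" using integrable_score_sq by simp
    show "AE x in D. norm ((deriv l x * S1 (\<gamma> i) x)\<^sup>2) \<le> norm ((deriv l x)\<^sup>2 * B\<^sup>2)"
      using S1sq by (intro AE_I2) (auto simp: power_mult_distrib intro!: mult_left_mono)
  qed measurable
  have leC: "(\<integral>x. (deriv l x * S1 (\<gamma> i) x)\<^sup>2 \<partial>D) \<le> I\<^sup>2 * B\<^sup>2" for i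
  proof -
    have "(\<integral>x. (deriv l x * S1 (\<gamma> i) x)\<^sup>2 \<partial>D) \<le> (\<integral>x. (deriv l x)\<^sup>2 * B\<^sup>2 \<partial>D)"
      using integrable_score_sq S1sq
      by (intro integral_mono iC) (auto simp: power_mult_distrib intro!: mult_left_mono)
    then show ?thesis using integrable_score_sq by (simp add: I_sq)
  qed
  have iB: "integrable D (\<lambda>x. ((S1 (\<gamma> i) x)\<^sup>2)\<^sup>2)" for i
    using power_mono[OF S1sq, where n=2] by (intro integrable_D_bounded[where B="(B\<^sup>2)\<^sup>2"]) auto
  have leB: "(\<integral>x. ((S1 (\<gamma> i) x)\<^sup>2)\<^sup>2 \<partial>D) \<le> (B\<^sup>2)\<^sup>2" for i
    using power_mono[OF S1sq, where n=2] by (intro D.integral_le_const iB) auto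
  have C: "integrable (PX d) (fC d)"
      "(\<integral>x. \<bar>fC d x\<bar> \<partial>PX d) \<le> sqrt (I\<^sup>2 * B\<^sup>2) / sqrt d + \<bar>(\<Sum>i<d. mean_S2 (\<gamma> i)) / d - b1 * I\<^sup>2\<bar>" if d: "0 < d" for d
  proof -
    from average_L1[of "\<lambda>i x. deriv l x * S1 (\<gamma> i) x", OF _ iC leC d, of "- (b1 * I\<^sup>2)"]
    have 1: "integrable (PX d) (fC d)"
      "(\<integral>x. \<bar>fC d x\<bar> \<partial>PX d) \<le> sqrt (I\<^sup>2 * B\<^sup>2) / sqrt d + \<bar>(\<Sum>i<d. - mean_S2 (\<gamma> i)) / d - (- (b1 * I\<^sup>2))\<bar>"
      by (simp_all add: fC_def[abs_def] integral_score_S1(2)[OF \<gamma>] del: minus_diff_eq diff_minus_eq_add)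
    have "(\<Sum>i<d. - mean_S2 (\<gamma> i)) / d - (- (b1 * I\<^sup>2)) = - ((\<Sum>i<d. mean_S2 (\<gamma> i)) / d - b1 * I\<^sup>2)"
      by (simp add: sum_negf)
    with 1 show "integrable (PX d) (fC d)"
      "(\<integral>x. \<bar>fC d x\<bar> \<partial>PX d) \<le> sqrt (I\<^sup>2 * B\<^sup>2) / sqrt d + \<bar>(\<Sum>i<d. mean_S2 (\<gamma> i)) / d - b1 * I\<^sup>2\<bar>"
      by (simp_all only: abs_minus_cancel)
  qed
  have Bb: "integrable (PX d) (fB d)"
      "(\<integral>x. \<bar>fB d x\<bar> \<partial>PX d) \<le> sqrt ((B\<^sup>2)\<^sup>2) / sqrt d + \<bar>(\<Sum>i<d. mean_S1_sq (\<gamma> i)) / d - b2\<^sup>2 * I\<^sup>2\<bar>" if d: "0 < d" for d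
    using average_L1[of "\<lambda>i x. (S1 (\<gamma> i) x)\<^sup>2", OF _ iB leB d, of "b2\<^sup>2 * I\<^sup>2"]
    unfolding fB_def[abs_def] mean_S1_sq_def by auto
  define e where "e d = k * ((\<integral>x. \<bar>fA d x\<bar> \<partial>PX d)
    + (sqrt (I\<^sup>2 * B\<^sup>2) / sqrt d + \<bar>(\<Sum>i<d. mean_S2 (\<gamma> i)) / d - b1 * I\<^sup>2\<bar>)
    + (sqrt ((B\<^sup>2)\<^sup>2) / sqrt d + \<bar>(\<Sum>i<d. mean_S1_sq (\<gamma> i)) / d - b2\<^sup>2 * I\<^sup>2\<bar>))" for d :: nat
  have inv0: "(\<lambda>d. c / sqrt (real d)) \<longlonglongrightarrow> 0" for c :: real by real_asymp
  have "e \<longlonglongrightarrow> k * (0 + (0 + \<bar>b1 * I\<^sup>2 - b1 * I\<^sup>2\<bar>) + (0 + \<bar>b2\<^sup>2 * I\<^sup>2 - b2\<^sup>2 * I\<^sup>2\<bar>))"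
    unfolding e_def[abs_def] by (intro tendsto_intros lim_A inv0 average_S2 average_S1_sq)
  then have e0: "e \<longlonglongrightarrow> 0" by simp
  have key: "\<bar>?E d - ?r\<bar> \<le> r + c * e d"
    if c: "0 < c" "\<And>A C B. \<bar>rate A C B - ?r\<bar> \<le> r + c * (\<bar>A - \<mu>\<^sup>2\<bar> + \<bar>C - - \<mu>\<^sup>2 * b1\<bar> + \<bar>B - \<mu>\<^sup>2 * b2\<^sup>2\<bar>)"
      and d: "0 < d" for r c d
  proof -
    interpret X: prob_space "PX d" by (rule prob_PX)
    define R where "R x = rate ((scale d)\<^sup>2 * (\<Sum>i<d. (deriv l (x i))\<^sup>2)) ((scale d)\<^sup>2 * (\<Sum>i<d. deriv l (x i) * S1 (\<gamma> i) (x i)))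
      ((scale d)\<^sup>2 * (\<Sum>i<d. (S1 (\<gamma> i) (x i))\<^sup>2))" for x
    have E: "?E d = (\<integral>x. R x \<partial>PX d)" and iR: "integrable (PX d) R"
      using integral_linear_rate[of d] integrable_linear_rate[of d] by (simp_all add: R_def[abs_def])
    have sc: "(scale d)\<^sup>2 = k / d" 
    proof -
      have "(scale d)\<^sup>2 = (scale d)\<^sup>2 * d / d" using d by simp
      then show ?thesis unfolding scale_sq[OF d] k_def .
    qed
    have diff: "(scale d)\<^sup>2 * s - k * m = k * (s / d - m)" for s m by (simp add: sc right_diff_distrib)
    have "\<bar>R x - ?r\<bar> \<le> r + c * (k * (\<bar>fA d x\<bar> + \<bar>fC d x\<bar> + \<bar>fB d x\<bar>))" for x
    proof -
      have 1: "(scale d)\<^sup>2 * (\<Sum>i<d. (deriv l (x i))\<^sup>2) - \<mu>\<^sup>2 = k * fA d x"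
        unfolding k[symmetric] fA_def by (rule diff)
      have "- \<mu>\<^sup>2 * b1 = k * (- (b1 * I\<^sup>2))" unfolding k[symmetric] by simp
      then have 2: "(scale d)\<^sup>2 * (\<Sum>i<d. deriv l (x i) * S1 (\<gamma> i) (x i)) - - \<mu>\<^sup>2 * b1 = k * fC d x"
        unfolding fC_def by (simp only: diff)
      have "\<mu>\<^sup>2 * b2\<^sup>2 = k * (b2\<^sup>2 * I\<^sup>2)" unfolding k[symmetric] by simp
      then have 3: "(scale d)\<^sup>2 * (\<Sum>i<d. (S1 (\<gamma> i) (x i))\<^sup>2) - \<mu>\<^sup>2 * b2\<^sup>2 = k * fB d x"
        unfolding fB_def by (simp only: diff)
      show ?thesis
        using c(2)[of "(scale d)\<^sup>2 * (\<Sum>i<d. (deriv l (x i))\<^sup>2)" "(scale d)\<^sup>2 * (\<Sum>i<d. deriv l (x i) * S1 (\<gamma> i) (x i))"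
          "(scale d)\<^sup>2 * (\<Sum>i<d. (S1 (\<gamma> i) (x i))\<^sup>2)"] k0
        unfolding 1 2 3 R_def[symmetric] by (simp add: abs_mult distrib_left)
    qed
    note pw = this
    have iM: "integrable (PX d) (\<lambda>x. r + c * (k * (\<bar>fA d x\<bar> + \<bar>fC d x\<bar> + \<bar>fB d x\<bar>)))"
      using int_A[of d] C(1)[OF d] Bb(1)[OF d] by auto
    have "?E d - ?r = (\<integral>x. R x - ?r \<partial>PX d)"
      unfolding E using iR by (simp add: X.prob_space)
    then have "\<bar>?E d - ?r\<bar> = \<bar>\<integral>x. R x - ?r \<partial>PX d\<bar>" by (simp only:)
    also have "\<dots> \<le> (\<integral>x. \<bar>R x - ?r\<bar> \<partial>PX d)" by (rule integral_abs_bound)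
    also have "\<dots> \<le> (\<integral>x. r + c * (k * (\<bar>fA d x\<bar> + \<bar>fC d x\<bar> + \<bar>fB d x\<bar>)) \<partial>PX d)"
      using iR by (intro integral_mono iM pw) auto
    also have "\<dots> = r + c * (k * ((\<integral>x. \<bar>fA d x\<bar> \<partial>PX d) + (\<integral>x. \<bar>fC d x\<bar> \<partial>PX d) + (\<integral>x. \<bar>fB d x\<bar> \<partial>PX d)))"
      using int_A[of d] C(1)[OF d] Bb(1)[OF d] by (simp add: X.prob_space)
    also have "\<dots> \<le> r + c * e d"
      unfolding e_def using c(1) k0 C(2)[OF d] Bb(2)[OF d]
      by (intro add_left_mono mult_left_mono add_mono order_refl) auto
    finally show ?thesis .
  qed
  show ?thesis
  proof (rule LIMSEQ_I)
    fix r :: real assume r: "0 < r"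
    have "0 < \<mu>\<^sup>2" "0 < r / 2" using \<mu>_pos r by auto
    then obtain c where c: "0 < c" "\<And>A C B. \<bar>rate A C B - ?r\<bar> \<le> r / 2 + c * (\<bar>A - \<mu>\<^sup>2\<bar> + \<bar>C - - \<mu>\<^sup>2 * b1\<bar> + \<bar>B - \<mu>\<^sup>2 * b2\<^sup>2\<bar>)"
      by (rule rate_continuous[of "\<mu>\<^sup>2" "r / 2" "- \<mu>\<^sup>2 * b1" "\<mu>\<^sup>2 * b2\<^sup>2"]) (rule that)
    have "(\<lambda>d. c * e d) \<longlonglongrightarrow> c * 0" by (intro tendsto_intros e0)
    then have "eventually (\<lambda>d. c * e d < r / 2) sequentially"
      using r by (intro order_tendstoD(2)[of _ "0 :: real"]) auto
    then obtain n where n: "\<And>d. n \<le> d \<Longrightarrow> c * e d < r / 2" by (auto simp: eventually_sequentially)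
    show "\<exists>no. \<forall>d\<ge>no. norm (?E d - ?r) < r"
    proof (intro exI allI impI)
      fix d assume d: "max n 1 \<le> d"
      have "\<bar>?E d - ?r\<bar> \<le> r / 2 + c * e d" using d by (intro key c) auto
      then show "norm (?E d - ?r) < r" using n[of d] d by simp
    qed
  qed
qed

text \<open>The random squared length of the jump, the quadratic terms and the random covariance are replaced by
their limits in turn.\<close>

theorem ESJD_tendsto:
  assumes chain: "\<And>d. 1 \<le> d \<Longrightarrow> stationary_dapsmrwm_chain \<pi> S p \<mu> \<gamma> d (M d) (Y d)"
  shows "(\<lambda>d. ESJD d (M d) (Y d) k) \<longlonglongrightarrow> alpha12 \<pi> S p \<mu> * (\<mu> / I)\<^sup>2"
proof -
  define E1 where "E1 d = (\<integral>(x, z). (\<Sum>i<d. (z i)\<^sup>2) / d * prop_rate d x z \<partial>(PXZ d))" for d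
  define E2 where "E2 d = (\<integral>(x, z). prop_rate d x z \<partial>(PXZ d))" for d
  define E3 where "E3 d = (\<integral>(x, z). linear_rate d x z \<partial>(PXZ d))" for d
  obtain e where e: "e \<longlonglongrightarrow> 0" "\<And>d. 0 < d \<Longrightarrow> \<bar>E2 d - E3 d\<bar> \<le> e d"
  proof (rule replace_by_linear)
    fix e assume e: "e \<longlonglongrightarrow> 0" "\<And>d. 0 < d \<Longrightarrow>
      \<bar>(\<integral>(x, z). prop_rate d x z \<partial>(PXZ d)) -
       (\<integral>(x, z). linear_rate d x z \<partial>(PXZ d))\<bar> \<le> e d"
    show thesis by (rule that[OF e(1)]) (unfold E2_def E3_def, rule e(2))
  qed
  have 23: "(\<lambda>d. E2 d - E3 d) \<longlonglongrightarrow> 0"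
    by (rule Lim_null_comparison[OF eventually_sequentiallyI[of 1] e(1)]) (use e(2) in auto)
  have inv0: "(\<lambda>d. sqrt 2 / sqrt (real d)) \<longlonglongrightarrow> 0" by real_asymp
  have 12: "(\<lambda>d. E1 d - E2 d) \<longlonglongrightarrow> 0"
    by (rule Lim_null_comparison[OF eventually_sequentiallyI[of 1] inv0])
      (use replace_sum_of_squares in \<open>auto simp: E1_def E2_def\<close>)
  have 3: "E3 \<longlonglongrightarrow> alpha12 \<pi> S p \<mu>"
    unfolding alpha12_eq_rate E3_def[abs_def] by (rule linear_rate_tendsto)
  have "(\<lambda>d. ((E1 d - E2 d) + (E2 d - E3 d)) + E3 d) \<longlonglongrightarrow> (0 + 0) + alpha12 \<pi> S p \<mu>"
    by (intro tendsto_add 12 23 3)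
  then have "E1 \<longlonglongrightarrow> alpha12 \<pi> S p \<mu>" by simp
  then have "(\<lambda>d. E1 d * (\<mu> / I)\<^sup>2) \<longlonglongrightarrow> alpha12 \<pi> S p \<mu> * (\<mu> / I)\<^sup>2"
    by (intro tendsto_intros)
  moreover have "eventually (\<lambda>d. E1 d * (\<mu> / I)\<^sup>2 = ESJD d (M d) (Y d) k) sequentially"
  proof (rule eventually_sequentiallyI[of 1])
    fix d :: nat assume d: "1 \<le> d"
    show "E1 d * (\<mu> / I)\<^sup>2 = ESJD d (M d) (Y d) k"
      unfolding ESJD_eq[OF chain[OF d] d] E1_def integral_mult_left_zero[symmetric]
      by (simp add: case_prod_beta' mult_ac)
  qed
  ultimately show ?thesis by (rule Lim_transform_eventually)
qed

end

theorem proposition4p3: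
  fixes \<pi> :: "real \<Rightarrow> real" and S :: "real \<Rightarrow> real \<Rightarrow> real" and p :: "real \<Rightarrow> real" and \<mu> :: real
    and P :: "'b measure" and \<Gamma> :: "nat \<Rightarrow> 'b \<Rightarrow> real"
  assumes "positive_density \<pi>" and "regular_target \<pi>"
    and "measurable_error S" and "regular_error S"
    and "noise_density p"
    and "0 < \<mu>"
    and "prob_space P"
    and "prob_space.indep_vars P (\<lambda>i. uniform01) \<Gamma> UNIV"
    and "\<And>i. distr P uniform01 (\<Gamma> i) = uniform01"
  shows "AE \<omega> in P. \<forall>(M :: nat \<Rightarrow> 'a measure) (Y :: nat \<Rightarrow> nat \<Rightarrow> 'a \<Rightarrow> (nat \<Rightarrow> real) \<times> real).
    (\<forall>d\<ge>1. stationary_dapsmrwm_chain \<pi> S p \<mu> (\<lambda>i. \<Gamma> i \<omega>) d (M d) (Y d)) \<longrightarrow>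
    (\<forall>k. (\<lambda>d. ESJD d (M d) (Y d) k) \<longlonglongrightarrow> alpha12 \<pi> S p \<mu> * (\<mu> / const_I \<pi>)\<^sup>2)"
proof -
  interpret P: prob_space P by fact
  interpret target_error \<pi> S by unfold_locales fact+
  obtain B where B: "0 \<le> B" "\<And>c x. c \<in> {0..1} \<Longrightarrow> \<bar>S1 c x\<bar> \<le> B" "\<And>c x. c \<in> {0..1} \<Longrightarrow> \<bar>S2 c x\<bar> \<le> B"
    using S_bounds by metis
  have b2: "\<bar>mean_S2 c\<bar> \<le> B" if "c \<in> space uniform01" for c
  proof -
    have c: "c \<in> {0..1}" using that by (simp add: space_uniform01)
    have i: "integrable D (S2 c)" using B(3)[OF c] S_section_measurable[OF c] by (intro integrable_D_bounded) auto
    have "\<bar>mean_S2 c\<bar> \<le> (\<integral>x. \<bar>S2 c x\<bar> \<partial>D)" unfolding mean_S2_def by (rule integral_abs_bound)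
    also have "\<dots> \<le> B" using i B(3)[OF c] by (intro D.integral_le_const) auto
    finally show ?thesis .
  qed
  have b1: "\<bar>mean_S1_sq c\<bar> \<le> B\<^sup>2" if "c \<in> space uniform01" for c
  proof -
    have c: "c \<in> {0..1}" using that by (simp add: space_uniform01)
    have le: "(S1 c x)\<^sup>2 \<le> B\<^sup>2" for x
      using B(2)[OF c, of x] by (metis abs_ge_zero power2_abs power_mono)
    have i: "integrable D (\<lambda>x. (S1 c x)\<^sup>2)" using le S_section_measurable[OF c] by (intro integrable_D_bounded) auto
    have "0 \<le> mean_S1_sq c" unfolding mean_S1_sq_def by simp
    moreover have "mean_S1_sq c \<le> B\<^sup>2" unfolding mean_S1_sq_def using i le by (intro D.integral_le_const) auto
    ultimately show ?thesis by simp
  qed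
  have "AE \<omega> in P. (\<lambda>d. (\<Sum>i<d. mean_S2 (\<Gamma> i \<omega>)) / real d) \<longlonglongrightarrow> (\<integral>c. mean_S2 c \<partial>uniform01)"
    by (rule P.strong_law_bounded[OF assms(8,9) mean_measurable(1) b2])
  moreover have "AE \<omega> in P. (\<lambda>d. (\<Sum>i<d. mean_S1_sq (\<Gamma> i \<omega>)) / real d) \<longlonglongrightarrow> (\<integral>c. mean_S1_sq c \<partial>uniform01)"
    by (rule P.strong_law_bounded[OF assms(8,9) mean_measurable(2) b1])
  moreover have "AE \<omega> in P. \<forall>i. \<Gamma> i \<omega> \<in> {0..1}"
  proof (rule AE_I2, rule allI)
    fix \<omega> i assume w: "\<omega> \<in> space P"
    have "\<Gamma> i \<in> measurable P uniform01" using assms(8) by (simp add: P.indep_vars_def)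
    from measurable_space[OF this w] show "\<Gamma> i \<omega> \<in> {0..1}" by (simp add: space_uniform01)
  qed
  ultimately show ?thesis
  proof eventually_elim
    case (elim \<omega>)
    interpret regular_dapsmrwm \<pi> S p \<mu> "\<lambda>i. \<Gamma> i \<omega>"
      by unfold_locales (use elim assms in \<open>auto simp: integral_mean_S2 integral_mean_S1_sq\<close>)
    show ?case
      using ESJD_tendsto by blast
  qed
qed

end
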